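(* Let $p$ be a prime, $n\ge 1$ an integer, and put $v=p^{4n}$ and $k=(p^{2n}+1)(p^n-1)$. Let $C=\{C_0,\dots,C_{p^n}\}$ be the $(v,k,k-1)$ disjoint difference family in the additive group of the finite field $\mathbb{F}_{p^{4n}}$ given by the cosets in $\mathbb{F}_{p^{4n}}^*$ of the subgroup of order $k$ (index $p^n+1$). Let $D=\{D_0,\dots,D_{p^n}\}$ be a disjoint difference family with the same parameters in the additive group of the Galois ring $\mathrm{GR}(p^2,2n)$ obtained by the Momihara construction described in the context. Then the $2$-$(v,k,k-1)$ designs $dev(C)$ and $dev(D)$ are nonisomorphic.
   Context: Difference families and designs. For a subset $A$ of an abelian group $G$, $\Delta A$ is the multiset $\{a-a' : a,a'\in A, a\neq a'\}$. A collection of mutually disjoint $k$-subsets $D_1,\dots,D_b$ of an abelian group $G$ of order $v$ is a $(v,k,\lambda)$ disjoint difference family if each nonzero element of $G$ occurs exactly $\lambda$ times in the multiset union $\bigcup_i \Delta D_i$. The development $dev(D)$ of a family $D=\{D_1,\dots,D_b\}$ is the collection of all translates $D_i+g$ ($1\le i\le b$, $g\in G$); if $D$ is a $(v,k,\lambda)$ difference family then $dev(D)$, with point set $G$, is a $2$-$(v,k,\lambda)$ design, i.e. a collection of $k$-subsets (blocks) of a $v$-set of points such that each $2$-subset of points lies in exactly $\lambda$ blocks. Two designs are isomorphic if there is a bijection between their point sets that maps the collection of blocks of one onto the collection of blocks of the other. Finite field construction. Let $q$ be a prime power, $\alpha$ a generator of $\mathbb{F}_q^*$, and $ef=q-1$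 with $e,f\ge2$. Put $C_i=\{\alpha^t : t\equiv i \pmod e\}$ for $i=0,\dots,e-1$. Then $C=\{C_0,\dots,C_{e-1}\}$ is a $(q,f,f-1)$ disjoint difference family in $(\mathbb{F}_q,+)$. Here $q=p^{4n}$, $e=p^n+1$, $f=k$. Galois rings. $\mathrm{GR}(p^m,r)=\mathbb{Z}_{p^m}[x]/\langle f(x)\rangle$, where $\mathbb{Z}_{p^m}$ is the ring of integers modulo $p^m$ and $f$ is a monic basic irreducible polynomial of degree $r$ (monic and irreducible modulo $p$); it is unique up to isomorphism. Momihara construction. Let $R_{2n}=\mathrm{GR}(p^2,2n)$, with $\xi\in R_{2n}$ a root of $f$ of multiplicative order $p^{2n}-1$, Teichmüller set $\mathcal{T}_{2n}=\{0,1,\xi,\dots,\xi^{p^{2n}-2}\}$, and maximal ideal $\mathcal{I}_{2n}=pR_{2n}$. Every element of $R_{2n}$ is uniquely $a_0+pa_1$ with $a_0,a_1\in\mathcal{T}_{2n}$. Put $\mathcal{T}_n=\{0,1,\xi^{p^n+1},\xi^{2(p^n+1)},\dots,\xi^{(p^n-2)(p^n+1)}\}$. Then $R_n=\{a_0+pa_1: a_0,a_1\in\mathcal{T}_n\}$ is the unique subring of $R_{2n}$ that is a Galois ring $\mathrm{GR}(p^2,n)$; its maximal ideal is $\mathcal{I}_n=pR_n$ and its unit group is $R_n^*=\{\alpha_0(1+p\alpha_1):\alpha_0,\alpha_1\in\mathcal{T}_n,\alpha_0\ne0\}$. Let $S=\{x_0,x_1,\dots,x_{p^n-1}\}\subseteq\mathcal{T}_{2n}$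 be such that $pS=\{px:x\in S\}$ is a system of representatives of $\mathcal{I}_{2n}/\mathcal{I}_n$. Let $P=\{p\,\xi^{\ell(p^n+1)+p^n} : \ell=0,1,\dots,p^n-2\}$. For $i=0,1,\dots,p^n$ define $$D_i=\xi^i\Big(P\cup\bigcup_{j=0}^{p^n-1}\xi^j(1+px_j)R_n^*\Big).$$ It is known (Momihara) that $D=\{D_0,\dots,D_{p^n}\}$ is a $(p^{4n},(p^{2n}+1)(p^n-1),(p^{2n}+1)(p^n-1)-1)$ disjoint difference family in $(R_{2n},+)$. *)

theory Defs
  imports
    "HOL-Algebra.Algebra"
    "HOL-Number_Theory.Number_Theory"
    "HOL-Library.Multiset"
begin

section \<open>Developments of families of base blocks, and isomorphism of designs\<close>

text \<open>
  Blocks form a multiset, as translates of base blocks may a priori coincide.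
  Only the additive structure of \<open>G\<close> is used.
\<close>

definition dev :: "('a, 'c) ring_scheme \<Rightarrow> nat \<Rightarrow> (nat \<Rightarrow> 'a set) \<Rightarrow> 'a set multiset" where
  "dev G b D = image_mset (\<lambda>(i, g). D i +>\<^bsub>G\<^esub> g) (mset_set ({..<b} \<times> carrier G))"

definition isomorphic_designs ::
  "'a set \<times> 'a set multiset \<Rightarrow> 'b set \<times> 'b set multiset \<Rightarrow> bool" where
  "isomorphic_designs \<D> \<E> \<longleftrightarrow>
     (\<exists>\<phi>. bij_betw \<phi> (fst \<D>) (fst \<E>) \<and> image_mset (\<lambda>B. \<phi> ` B) (snd \<D>) = snd \<E>)"


section \<open>The finite field construction\<close>

definition cyclotomic_class :: "('a, 'c) ring_scheme \<Rightarrow> nat \<Rightarrow> 'a \<Rightarrow> nat \<Rightarrow> 'a set" where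
  "cyclotomic_class F e \<alpha> i = {\<alpha> [^]\<^bsub>F\<^esub> t | t :: nat. [t = i] (mod e)}"


section \<open>Galois rings\<close>

definition basic_irreducible :: "nat \<Rightarrow> nat \<Rightarrow> nat \<Rightarrow> (nat \<Rightarrow> int) \<Rightarrow> bool" where
  "basic_irreducible p m r f \<longleftrightarrow>
     (let Z = residue_ring (int (p ^ m)); Zp = residue_ring (int p) in
        f \<in> carrier (UP Z) \<and> deg Z f = r \<and> coeff (UP Z) f r = \<one>\<^bsub>Z\<^esub> \<and>
        ring_irreducible\<^bsub>UP Zp\<^esub> (\<lambda>i. coeff (UP Z) f i mod int p))"

definition galois_ring :: "nat \<Rightarrow> nat \<Rightarrow> (nat \<Rightarrow> int) \<Rightarrow> (nat \<Rightarrow> int) set ring" where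
  "galois_ring p m f =
     (let P = UP (residue_ring (int (p ^ m))) in P Quot (PIdl\<^bsub>P\<^esub> f))"

text \<open>The canonical map from the integers modulo \<open>p ^ m\<close> to the Galois ring.\<close>

definition galois_const :: "nat \<Rightarrow> nat \<Rightarrow> (nat \<Rightarrow> int) \<Rightarrow> int \<Rightarrow> (nat \<Rightarrow> int) set" where
  "galois_const p m f a =
     (let P = UP (residue_ring (int (p ^ m))) in (PIdl\<^bsub>P\<^esub> f) +>\<^bsub>P\<^esub> monom P a 0)"


section \<open>The Momihara construction\<close>

text \<open>
  With \<open>\<xi>\<close> of order \<open>p ^ (2 * n) - 1\<close>, the set written $\mathcal{T}_{2n}$ is
  \<open>teichmueller R \<xi> (p ^ (2 * n) - 1)\<close>, and $\mathcal{T}_n$ is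
  \<open>teichmueller R (\<xi> [^] (p ^ n + 1)) (p ^ n - 1)\<close>.
\<close>

definition teichmueller :: "('a, 'c) ring_scheme \<Rightarrow> 'a \<Rightarrow> nat \<Rightarrow> 'a set" where
  "teichmueller R \<xi> N = insert \<zero>\<^bsub>R\<^esub> {\<xi> [^]\<^bsub>R\<^esub> l | l :: nat. l < N}"

definition multiples :: "('a, 'c) ring_scheme \<Rightarrow> nat \<Rightarrow> 'a set \<Rightarrow> 'a set" where
  "multiples R p A = {add_pow R p a | a. a \<in> A}"

definition galois_subring :: "('a, 'c) ring_scheme \<Rightarrow> nat \<Rightarrow> nat \<Rightarrow> 'a \<Rightarrow> 'a set" where
  "galois_subring R p n \<xi> =
     (let T = teichmueller R (\<xi> [^]\<^bsub>R\<^esub> (p ^ n + 1)) (p ^ n - 1) in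
        {a\<^sub>0 \<oplus>\<^bsub>R\<^esub> add_pow R p a\<^sub>1 | a\<^sub>0 a\<^sub>1. a\<^sub>0 \<in> T \<and> a\<^sub>1 \<in> T})"

text \<open>\<open>W\<close> contains exactly one element of each coset of \<open>J\<close> in \<open>I\<close>.\<close>

definition representative_system :: "('a, 'c) ring_scheme \<Rightarrow> 'a set \<Rightarrow> 'a set \<Rightarrow> 'a set \<Rightarrow> bool" where
  "representative_system R I J W \<longleftrightarrow>
     W \<subseteq> I \<and> (\<forall>y\<in>I. \<exists>!s. s \<in> W \<and> s \<in> (J +>\<^bsub>R\<^esub> y))"

definition momihara_block ::
  "('a, 'c) ring_scheme \<Rightarrow> nat \<Rightarrow> nat \<Rightarrow> 'a \<Rightarrow> (nat \<Rightarrow> 'a) \<Rightarrow> nat \<Rightarrow> 'a set" where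
  "momihara_block R p n \<xi> x i =
     (let U = Units (R\<lparr>carrier := galois_subring R p n \<xi>\<rparr>);
          P = {add_pow R p (\<xi> [^]\<^bsub>R\<^esub> (l * (p ^ n + 1) + p ^ n)) | l :: nat. l < p ^ n - 1}
      in (\<xi> [^]\<^bsub>R\<^esub> i) <#\<^bsub>R\<^esub>
           (P \<union> (\<Union>j<p ^ n. (\<xi> [^]\<^bsub>R\<^esub> j \<otimes>\<^bsub>R\<^esub> (\<one>\<^bsub>R\<^esub> \<oplus>\<^bsub>R\<^esub> add_pow R p (x j))) <#\<^bsub>R\<^esub> U)))"

end

theory Submission
  imports Defs
begin

text \<open>
  Write \<open>N = p\<^sup>n\<close>. The two designs are told apart by block intersection numbers if \<open>N \<ge> 3\<close>, and
  by the triples of points that lie in no block if \<open>N = 2\<close>.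

  The cyclotomic classes of order \<open>N + 1\<close> in the field with \<open>N\<^sup>4\<close> elements are uniform: the number of
  solutions of \<open>u - w = a\<close> with \<open>u\<close> in one class and \<open>w\<close> in another one takes, for nonzero \<open>a\<close>, only
  the values \<open>N - 2\<close>, \<open>N\<^sup>2 - N\<close> and \<open>(N - 1)\<^sup>2\<close>. For a single class this is a count of quadratic
  polynomials over the field with \<open>N\<^sup>2\<close> elements, because the class of \<open>x\<close> is determined by the line,
  over the field with \<open>N\<close> elements, on which the norm \<open>x\<^bsup>N\<^sup>2 + 1\<^esup>\<close> lies; for two different classes it
  follows from a variance computation.

  In the Galois ring, the unit part of \<open>D\<^sub>0\<close> consists of the units in the modules \<open>v\<^sub>j R\<^sub>n\<close>, where
  \<open>v\<^sub>j = \<xi>\<^sup>j (1 + p x\<^sub>j)\<close>, and any two of these modules form a direct sum decomposition of the ring.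
  Hence \<open>D\<^sub>0\<close> and its translate by \<open>v\<^sub>0\<close> have \<open>(N - 1) (N - 2) + N\<^sup>2 - 2 N\<close> points in common,
  which for \<open>N \<ge> 3\<close> is not an intersection number of the other design. For \<open>N = 2\<close> this number is
  \<open>0\<close>. In the field design the triples in no block are then the triples on the lines of the affine plane
  over the field with four elements, so that two of them with two common points generate a third one,
  whereas this fails in the Galois ring design.
\<close>

text \<open>The ring's intersection number \<open>(N - 1) * (N - 2) + (N^2 - 2 * N)\<close> equals
  \<open>(N - 2) * (2 * N - 1)\<close>. At \<open>N = 2\<close> it vanishes, and \<open>0\<close>
  also occurs in the field design, for equal translates of two different classes; hence the separate
  argument there.

  Since \<open>N\<close> is \<open>-1\<close> modulo the number \<open>N + 1\<close> of classes, the
  field counts are those that semiprimitive Gauss sums would give. The elementary substitute is to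
  prove an inequality and let an exactly known sum force equality: upper bounds on the counts
  against the total \<open>k * k\<close> for one class, nonnegative squares against a vanishing
  total for two.

  In the ring, \<open>v j\<close> reduces modulo \<open>p\<close> to \<open>\<xi> [^] j\<close>, and
  the powers of \<xi> with exponents \<open>0\<close> to \<open>N\<close> span the
  \<open>N + 1\<close> lines of the residue field over its subfield of order \<open>N\<close>. Two
  lines are independent modulo \<open>p\<close>, and once more inside the multiples of
  \<open>p\<close>, which form a copy of the residue field; this is why two modules have a direct
  sum. The part \<open>P\<close> of the block occupies the remaining line, with exponent
  \<open>N\<close>, on the second layer only.\<close>

no_notation ideal_prod (infixl "\<cdot>\<index>" 80)

section \<open>Difference counts in abelian groups\<close>

lemma sum_square_deviation:
  fixes f :: "'a \<Rightarrow> int"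
  shows "(\<Sum>a\<in>A. (f a - c)\<^sup>2) = (\<Sum>a\<in>A. (f a)\<^sup>2) - 2 * c * (\<Sum>a\<in>A. f a) + c\<^sup>2 * int (card A)"
proof -
  have "(\<Sum>a\<in>A. (f a - c)\<^sup>2) = (\<Sum>a\<in>A. (f a)\<^sup>2 - 2 * c * f a + c\<^sup>2)"
    by (rule sum.cong) (simp_all add: power2_diff mult.commute)
  also have "\<dots> = (\<Sum>a\<in>A. (f a)\<^sup>2) - (\<Sum>a\<in>A. 2 * c * f a) + (\<Sum>a\<in>A. c\<^sup>2)"
    by (simp only: sum.distrib sum_subtractf)
  also have "(\<Sum>a\<in>A. 2 * c * f a) = 2 * c * (\<Sum>a\<in>A. f a)"
    by (simp only: sum_distrib_left)
  finally show ?thesis by simp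
qed

text \<open>As a function of \<open>a\<close> this is the coefficient function of the product of
  \<open>A\<close> with the negative of \<open>B\<close> in the group ring. For cyclotomic classes
  its values are the cyclotomic numbers.\<close>

definition diff_count :: "('a, 'c) ring_scheme \<Rightarrow> 'a set \<Rightarrow> 'a set \<Rightarrow> 'a \<Rightarrow> nat" where
  "diff_count G A B a = card {(u, w). u \<in> A \<and> w \<in> B \<and> u \<ominus>\<^bsub>G\<^esub> w = a}"

context abelian_group
begin

lemma minus_eq_iff:
  assumes "u \<in> carrier G" "w \<in> carrier G" "a \<in> carrier G"
  shows "u \<ominus> w = a \<longleftrightarrow> u = a \<oplus> w"
  using assms by (metis a_minus_def add.inv_solve_right)

lemma minus_minus_cancel:
  assumes "u \<in> carrier G" "w \<in> carrier G"
  shows "u \<ominus> (u \<ominus> w) = w"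
  using assms by (metis a_comm minus_closed minus_eq_iff)

lemma a_coset_conv: "A +> g = (\<lambda>u. u \<oplus> g) ` A"
  by (auto simp: a_r_coset_def')

text \<open>A common point \<open>u \<oplus> g = w \<oplus> h\<close> is the same as a difference
  \<open>u \<ominus> w = h \<ominus> g\<close>, so intersection numbers of blocks are difference
  counts of base blocks.\<close>

lemma card_coset_Int:
  assumes "A \<subseteq> carrier G" "B \<subseteq> carrier G" "g \<in> carrier G" "h \<in> carrier G"
  shows "card ((A +> g) \<inter> (B +> h)) = diff_count G A B (h \<ominus> g)"
proof -
  have key: "u \<ominus> w = h \<ominus> g \<longleftrightarrow> u \<oplus> g = w \<oplus> h" if "u \<in> carrier G" "w \<in> carrier G" for u w
  proof -
    have "u \<ominus> w = h \<ominus> g \<longleftrightarrow> u = (h \<ominus> g) \<oplus> w"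
      using that assms by (intro minus_eq_iff) auto
    also have "(h \<ominus> g) \<oplus> w = (w \<oplus> h) \<ominus> g"
      using that assms by (simp add: a_minus_def a_ac)
    also have "u = (w \<oplus> h) \<ominus> g \<longleftrightarrow> u \<oplus> g = w \<oplus> h"
      using that assms by (metis a_closed minus_eq_iff)
    finally show ?thesis .
  qed
  have "bij_betw (\<lambda>(u, w). u \<oplus> g) {(u, w). u \<in> A \<and> w \<in> B \<and> u \<ominus> w = h \<ominus> g}
      ((A +> g) \<inter> (B +> h))"
  proof (rule bij_betw_imageI)
    show "inj_on (\<lambda>(u, w). u \<oplus> g) {(u, w). u \<in> A \<and> w \<in> B \<and> u \<ominus> w = h \<ominus> g}"
    proof (rule inj_onI, clarsimp)
      fix u w u' w'
      assume *: "u \<in> A" "w \<in> B" "u \<ominus> w = h \<ominus> g" "u' \<in> A" "w' \<in> B" "u' \<ominus> w' = h \<ominus> g"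
        "u \<oplus> g = u' \<oplus> g"
      have c: "u \<in> carrier G" "w \<in> carrier G" "u' \<in> carrier G" "w' \<in> carrier G"
        using * assms by auto
      have "w \<oplus> h = w' \<oplus> h" using *(3,6,7) key c by metis
      then show "u = u' \<and> w = w'" using *(7) c assms by simp
    qed
    show "(\<lambda>(u, w). u \<oplus> g) ` {(u, w). u \<in> A \<and> w \<in> B \<and> u \<ominus> w = h \<ominus> g} = (A +> g) \<inter> (B +> h)"
    proof (intro equalityI subsetI)
      fix y
      assume "y \<in> (\<lambda>(u, w). u \<oplus> g) ` {(u, w). u \<in> A \<and> w \<in> B \<and> u \<ominus> w = h \<ominus> g}"
      then obtain u w where "u \<in> A" "w \<in> B" "u \<ominus> w = h \<ominus> g" "y = u \<oplus> g" by auto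
      then show "y \<in> (A +> g) \<inter> (B +> h)"
        using key assms(1,2) unfolding a_coset_conv by blast
    next
      fix y
      assume "y \<in> (A +> g) \<inter> (B +> h)"
      then obtain u w where *: "u \<in> A" "w \<in> B" "y = u \<oplus> g" "u \<oplus> g = w \<oplus> h"
        unfolding a_coset_conv by blast
      then have "(u, w) \<in> {(u, w). u \<in> A \<and> w \<in> B \<and> u \<ominus> w = h \<ominus> g}"
        using key assms(1,2) by blast
      then show "y \<in> (\<lambda>(u, w). u \<oplus> g) ` {(u, w). u \<in> A \<and> w \<in> B \<and> u \<ominus> w = h \<ominus> g}"
        unfolding \<open>y = u \<oplus> g\<close> by (rule rev_image_eqI) simp
    qed
  qed
  then show ?thesis by (auto simp: diff_count_def dest: bij_betw_same_card)
qed

end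

locale finite_abelian_group = abelian_group +
  assumes finite_carrier [simp]: "finite (carrier G)"
begin

lemma sum_diff_count:
  assumes "A \<subseteq> carrier G" "B \<subseteq> carrier G" "finite T"
  shows "(\<Sum>a\<in>T. diff_count G A B a) = card {(u, w). u \<in> A \<and> w \<in> B \<and> u \<ominus> w \<in> T}"
proof -
  have fin: "finite A" "finite B" using assms finite_subset finite_carrier by blast+
  have "{(u, w). u \<in> A \<and> w \<in> B \<and> u \<ominus> w \<in> T}
      = (\<Union>a\<in>T. {(u, w). u \<in> A \<and> w \<in> B \<and> u \<ominus> w = a})" by auto
  also have "card \<dots> = (\<Sum>a\<in>T. diff_count G A B a)"
    unfolding diff_count_def
  proof (rule card_UN_disjoint)
    show "\<forall>a\<in>T. finite {(u, w). u \<in> A \<and> w \<in> B \<and> u \<ominus> w = a}"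
    proof
      fix a
      show "finite {(u, w). u \<in> A \<and> w \<in> B \<and> u \<ominus> w = a}"
        by (rule finite_subset[OF _ finite_cartesian_product[OF fin]]) blast
    qed
  qed (use assms(3) in auto)
  finally show ?thesis by simp
qed

lemma sum_diff_count_carrier:
  assumes "A \<subseteq> carrier G" "B \<subseteq> carrier G"
  shows "(\<Sum>a\<in>carrier G. diff_count G A B a) = card A * card B"
proof -
  have "{(u, w). u \<in> A \<and> w \<in> B \<and> u \<ominus> w \<in> carrier G} = A \<times> B"
    using assms by (auto simp: subsetD)
  then show ?thesis using sum_diff_count[OF assms finite_carrier] by (simp add: card_cartesian_product)
qed

text \<open>Fixing \<open>u\<close> and exchanging \<open>w\<close> with
  \<open>u \<ominus> w\<close> is an involution, which trades the requirements on these two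
  elements. It gives the first moment of a mixed count on \<open>A\<close> from counts inside
  \<open>A\<close>.\<close>

lemma sum_diff_count_left:
  assumes "A \<subseteq> carrier G" "B \<subseteq> carrier G"
  shows "(\<Sum>a\<in>A. diff_count G A B a) = (\<Sum>w\<in>B. diff_count G A A w)"
proof -
  have fin: "finite A" "finite B" using assms finite_subset finite_carrier by blast+
  have "bij_betw (\<lambda>(u, w). (u, u \<ominus> w)) {(u, w). u \<in> A \<and> w \<in> B \<and> u \<ominus> w \<in> A}
      {(u, w). u \<in> A \<and> w \<in> A \<and> u \<ominus> w \<in> B}"
    by (rule bij_betw_byWitness[where f' = "\<lambda>(u, w). (u, u \<ominus> w)"])
      (use assms in \<open>auto simp: minus_minus_cancel subsetD\<close>)
  then show ?thesis
    using sum_diff_count[OF assms fin(1)] sum_diff_count[OF assms(1,1) fin(2)]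
    by (simp add: bij_betw_same_card)
qed

text \<open>The pair \<open>(u, w)\<close> goes to \<open>(u \<ominus> w, \<ominus> w)\<close>,
  whose difference is \<open>u\<close>; closure of \<open>B\<close> under negation keeps the second
  entry in \<open>B\<close>.\<close>

lemma sum_diff_count_right:
  assumes "A \<subseteq> carrier G" "B \<subseteq> carrier G" and sym: "\<And>b. b \<in> B \<Longrightarrow> \<ominus> b \<in> B"
  shows "(\<Sum>a\<in>B. diff_count G A B a) = (\<Sum>u\<in>A. diff_count G B B u)"
proof -
  have fin: "finite A" "finite B" using assms finite_subset finite_carrier by blast+
  have "bij_betw (\<lambda>(u, w). (u \<ominus> w, \<ominus> w)) {(u, w). u \<in> A \<and> w \<in> B \<and> u \<ominus> w \<in> B}
      {(u, w). u \<in> B \<and> w \<in> B \<and> u \<ominus> w \<in> A}"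
    by (rule bij_betw_byWitness[where f' = "\<lambda>(u, w). (u \<ominus> w, \<ominus> w)"])
      (use assms in \<open>auto simp: a_minus_def a_assoc l_neg r_neg subsetD\<close>)
  then show ?thesis
    using sum_diff_count[OF assms(1,2) fin(2)] sum_diff_count[OF assms(2,2) fin(1)]
    by (simp add: bij_betw_same_card)
qed

text \<open>Both sides count quadruples, since \<open>u \<ominus> w = u' \<ominus> w'\<close>
  rearranges to \<open>u \<ominus> u' = w \<ominus> w'\<close>. Second moments of mixed counts are
  thereby reduced to counts inside single sets.\<close>

lemma sum_diff_count_square:
  assumes "A \<subseteq> carrier G" "B \<subseteq> carrier G"
  shows "(\<Sum>a\<in>carrier G. (diff_count G A B a)\<^sup>2)
       = (\<Sum>a\<in>carrier G. diff_count G A A a * diff_count G B B a)"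
proof -
  have fin: "finite A" "finite B" using assms finite_subset finite_carrier by blast+
  let ?S = "\<lambda>A B a. {(u, w). u \<in> A \<and> w \<in> B \<and> u \<ominus> w = a}"
  have finS: "finite (?S A B a)" if "finite A" "finite B" for A B :: "'a set" and a
    by (rule finite_subset[OF _ finite_cartesian_product[OF that]]) blast
  have sumS: "(\<Sum>a\<in>carrier G. card (?S A B a \<times> ?S C D a))
      = card {((u, w), (u', w')). u \<in> A \<and> w \<in> B \<and> u' \<in> C \<and> w' \<in> D \<and> u \<ominus> w = u' \<ominus> w'}"
    if "A \<subseteq> carrier G" "B \<subseteq> carrier G" "C \<subseteq> carrier G" "D \<subseteq> carrier G" for A B C D
  proof -
    have fin: "finite A" "finite B" "finite C" "finite D"
      using that finite_subset finite_carrier by blast+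
    have "(\<Sum>a\<in>carrier G. card (?S A B a \<times> ?S C D a)) = card (\<Union>a\<in>carrier G. ?S A B a \<times> ?S C D a)"
      by (rule card_UN_disjoint[symmetric]) (auto simp: finS fin)
    also have "(\<Union>a\<in>carrier G. ?S A B a \<times> ?S C D a)
        = {((u, w), (u', w')). u \<in> A \<and> w \<in> B \<and> u' \<in> C \<and> w' \<in> D \<and> u \<ominus> w = u' \<ominus> w'}"
      using that by (auto simp: subsetD)
    finally show ?thesis .
  qed
  have swap: "u \<ominus> w = u' \<ominus> w' \<longleftrightarrow> u \<ominus> u' = w \<ominus> w'"
    if "u \<in> carrier G" "w \<in> carrier G" "u' \<in> carrier G" "w' \<in> carrier G" for u w u' w'
  proof -
    have "u \<ominus> w = u' \<ominus> w' \<longleftrightarrow> u = (u' \<ominus> w') \<oplus> w" using that by (intro minus_eq_iff) auto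
    also have "(u' \<ominus> w') \<oplus> w = (w \<ominus> w') \<oplus> u'" using that by (simp add: a_minus_def a_ac)
    also have "u = (w \<ominus> w') \<oplus> u' \<longleftrightarrow> u \<ominus> u' = w \<ominus> w'"
      using that by (intro minus_eq_iff[symmetric]) auto
    finally show ?thesis .
  qed
  have "bij_betw (\<lambda>((u, w), (u', w')). ((u, u'), (w, w')))
     {((u, w), (u', w')). u \<in> A \<and> w \<in> B \<and> u' \<in> A \<and> w' \<in> B \<and> u \<ominus> w = u' \<ominus> w'}
     {((u, w), (u', w')). u \<in> A \<and> w \<in> A \<and> u' \<in> B \<and> w' \<in> B \<and> u \<ominus> w = u' \<ominus> w'}"
    by (rule bij_betw_byWitness[where f' = "\<lambda>((u, w), (u', w')). ((u, u'), (w, w'))"])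
      (use assms swap in \<open>auto simp: subsetD\<close>)
  from bij_betw_same_card[OF this] show ?thesis
    unfolding sumS[OF assms assms, symmetric] sumS[OF assms(1,1) assms(2,2), symmetric]
    by (simp add: card_cartesian_product diff_count_def power2_eq_square)
qed

lemma diff_count_zero:
  assumes "A \<subseteq> carrier G" "B \<subseteq> carrier G"
  shows "diff_count G A B \<zero> = card (A \<inter> B)"
proof -
  have "{(u, w). u \<in> A \<and> w \<in> B \<and> u \<ominus> w = \<zero>} = (\<lambda>u. (u, u)) ` (A \<inter> B)"
    using assms by (auto simp: minus_eq_iff subsetD)
  then show ?thesis by (simp add: diff_count_def card_image inj_on_def)
qed

end

section \<open>Powers of sums in commutative rings\<close>

context cring
begin

lemma binomial_finsum:
  assumes [simp]: "x \<in> carrier R" "y \<in> carrier R"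
  shows "(x \<oplus> y) [^] n = (\<Oplus>i\<in>{..n}. [(n choose i)] \<cdot> (x [^] i \<otimes> y [^] (n - i)))"
proof (induction n)
  case 0
  show ?case by simp
next
  case (Suc n)
  let ?t = "\<lambda>i. x [^] i \<otimes> y [^] (n - i)"
  let ?s = "\<lambda>i. x [^] i \<otimes> y [^] (Suc n - i)"
  have c: "\<And>f :: nat \<Rightarrow> 'a. (\<And>i. f i \<in> carrier R) \<Longrightarrow> f \<in> UNIV \<rightarrow> carrier R" by auto
  have X: "(\<Oplus>i\<in>{..n}. [(n choose i)] \<cdot> ?t i) \<otimes> x
      = (\<Oplus>i\<in>{..Suc n}. [(case i of 0 \<Rightarrow> 0 | Suc j \<Rightarrow> n choose j)] \<cdot> ?s i)"
  proof -
    have "(\<Oplus>i\<in>{..n}. [(n choose i)] \<cdot> ?t i) \<otimes> x = (\<Oplus>i\<in>{..n}. ([(n choose i)] \<cdot> ?t i) \<otimes> x)"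
      by (rule finsum_ldistr) auto
    also have "\<dots> = (\<Oplus>i\<in>{..n}. [(n choose i)] \<cdot> ?s (Suc i))"
      by (rule finsum_cong') (auto simp: add_pow_ldistr m_assoc m_comm[of x] m_lcomm[of x])
    also have "\<dots> = (\<Oplus>i\<in>{..Suc n}. [(case i of 0 \<Rightarrow> 0 | Suc j \<Rightarrow> n choose j)] \<cdot> ?s i)"
      by (subst finsum_Suc2) auto
    finally show ?thesis .
  qed
  have Y: "(\<Oplus>i\<in>{..n}. [(n choose i)] \<cdot> ?t i) \<otimes> y = (\<Oplus>i\<in>{..Suc n}. [(n choose i)] \<cdot> ?s i)"
  proof -
    have "(\<Oplus>i\<in>{..n}. [(n choose i)] \<cdot> ?t i) \<otimes> y = (\<Oplus>i\<in>{..n}. ([(n choose i)] \<cdot> ?t i) \<otimes> y)"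
      by (rule finsum_ldistr) auto
    also have "\<dots> = (\<Oplus>i\<in>{..n}. [(n choose i)] \<cdot> ?s i)"
      by (rule finsum_cong') (auto simp: add_pow_ldistr m_assoc Suc_diff_le)
    also have "\<dots> = (\<Oplus>i\<in>{..Suc n}. [(n choose i)] \<cdot> ?s i)"
      by (subst finsum_Suc) (auto simp: binomial_eq_0)
    finally show ?thesis .
  qed
  have "(x \<oplus> y) [^] Suc n = (\<Oplus>i\<in>{..n}. [(n choose i)] \<cdot> ?t i) \<otimes> x \<oplus> (\<Oplus>i\<in>{..n}. [(n choose i)] \<cdot> ?t i) \<otimes> y"
    unfolding nat_pow_Suc Suc by (rule r_distr) auto
  also have "\<dots> = (\<Oplus>i\<in>{..Suc n}. [(case i of 0 \<Rightarrow> 0 | Suc j \<Rightarrow> n choose j)] \<cdot> ?s i \<oplus> [(n choose i)] \<cdot> ?s i)"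
    unfolding X Y by (rule finsum_addf[symmetric]) auto
  also have "\<dots> = (\<Oplus>i\<in>{..Suc n}. [(Suc n choose i)] \<cdot> ?s i)"
    by (rule finsum_cong') (auto simp: add.nat_pow_mult split: nat.split)
  finally show ?case .
qed

text \<open>The inner binomial coefficients are divisible by \<open>p\<close>, and their quotients
  are collected in \<open>z\<close>. The error term is kept explicit because it survives in the
  Galois ring; in characteristic \<open>p\<close> it is zero.\<close>

lemma prime_power_sum:
  assumes "Factorial_Ring.prime (p :: nat)" and [simp]: "x \<in> carrier R" "y \<in> carrier R"
  shows "\<exists>z\<in>carrier R. (x \<oplus> y) [^] p = x [^] p \<oplus> y [^] p \<oplus> [p] \<cdot> z"
proof -
  \<comment> \<open>With \<open>p = Suc (Suc m)\<close> the inner indices \<open>1\<close> to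
    \<open>p - 1\<close> are the \<open>Suc i\<close> with \<open>i \<le> m\<close>.\<close>
  define m where "m = p - 2"
  have p: "p = Suc (Suc m)"
    using prime_ge_2_nat[OF assms(1)] by (simp add: m_def)
  let ?s = "\<lambda>i. x [^] i \<otimes> y [^] (p - i)"
  define z where "z = (\<Oplus>i\<in>{..m}. [((p choose Suc i) div p)] \<cdot> ?s (Suc i))"
  have z: "z \<in> carrier R" unfolding z_def by (rule finsum_closed) auto
  have pow: "[p] \<cdot> z = (\<Oplus>i\<in>{..m}. [(p choose Suc i)] \<cdot> ?s (Suc i))"
  proof -
    have "[p] \<cdot> z = ([p] \<cdot> \<one>) \<otimes> z" using z by (simp add: add_pow_ldistr)
    also have "\<dots> = (\<Oplus>i\<in>{..m}. ([p] \<cdot> \<one>) \<otimes> ([((p choose Suc i) div p)] \<cdot> ?s (Suc i)))"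
      unfolding z_def by (rule finsum_rdistr) auto
    also have "\<dots> = (\<Oplus>i\<in>{..m}. [(p choose Suc i)] \<cdot> ?s (Suc i))"
    proof (rule finsum_cong')
      fix i assume i: "i \<in> {..m}"
      have "p dvd (p choose Suc i)"
        using i p assms(1) by (intro dvd_choose_prime) auto
      then have "(p choose Suc i) div p * p = (p choose Suc i)" by simp
      then show "([p] \<cdot> \<one>) \<otimes> ([((p choose Suc i) div p)] \<cdot> ?s (Suc i)) = [(p choose Suc i)] \<cdot> ?s (Suc i)"
        by (simp add: add_pow_ldistr add.nat_pow_pow)
    qed auto
    finally show ?thesis .
  qed
  have "(x \<oplus> y) [^] p = (\<Oplus>i\<in>{..Suc (Suc m)}. [(p choose i)] \<cdot> ?s i)"
    using binomial_finsum[of x y p] p by simp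
  also have "\<dots> = [(p choose p)] \<cdot> ?s p \<oplus> (\<Oplus>i\<in>{..Suc m}. [(p choose i)] \<cdot> ?s i)"
    by (subst finsum_Suc) (use p in auto)
  also have "(\<Oplus>i\<in>{..Suc m}. [(p choose i)] \<cdot> ?s i) = (\<Oplus>i\<in>{..m}. [(p choose Suc i)] \<cdot> ?s (Suc i)) \<oplus> [(p choose 0)] \<cdot> ?s 0"
    by (subst finsum_Suc2) auto
  also have "[(p choose p)] \<cdot> ?s p \<oplus> ((\<Oplus>i\<in>{..m}. [(p choose Suc i)] \<cdot> ?s (Suc i)) \<oplus> [(p choose 0)] \<cdot> ?s 0)
      = x [^] p \<oplus> y [^] p \<oplus> [p] \<cdot> z"
    unfolding pow[symmetric] using z by (simp add: a_ac)
  finally show ?thesis using z by blast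
qed

lemma freshman:
  assumes "Factorial_Ring.prime (p :: nat)" "[p] \<cdot> \<one> = \<zero>" and [simp]: "x \<in> carrier R" "y \<in> carrier R"
  shows "(x \<oplus> y) [^] (p ^ m) = x [^] (p ^ m) \<oplus> y [^] (p ^ m)"
proof (induction m)
  case 0
  show ?case by simp
next
  case (Suc m)
  have step: "(a \<oplus> b) [^] p = a [^] p \<oplus> b [^] p" if [simp]: "a \<in> carrier R" "b \<in> carrier R" for a b
  proof -
    obtain z where z [simp]: "z \<in> carrier R" and e: "(a \<oplus> b) [^] p = a [^] p \<oplus> b [^] p \<oplus> [p] \<cdot> z"
      using prime_power_sum[OF assms(1), of a b] by auto
    have "[p] \<cdot> z = ([p] \<cdot> \<one>) \<otimes> z" by (simp add: add_pow_ldistr)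
    then show ?thesis using e assms(2) by simp
  qed
  have "(x \<oplus> y) [^] (p ^ Suc m) = ((x \<oplus> y) [^] (p ^ m)) [^] p"
    by (simp add: nat_pow_pow mult.commute)
  also have "\<dots> = (x [^] (p ^ m)) [^] p \<oplus> (y [^] (p ^ m)) [^] p"
    unfolding Suc by (rule step) auto
  finally show ?case by (simp add: nat_pow_pow mult.commute)
qed

text \<open>Keeping the error term in \<open>H\<close> is what later keeps the carry of a sum of
  Teichmueller elements in the preimage of the small residue field.\<close>

lemma pow_sum_subring:
  assumes "Factorial_Ring.prime (p :: nat)" "subring H R" "x \<in> H" "y \<in> H"
  shows "\<exists>z\<in>H. (x \<oplus> y) [^] p = x [^] p \<oplus> y [^] p \<oplus> [p] \<cdot> z"
proof -
  interpret H: cring "R\<lparr>carrier := H\<rparr>"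
    using assms(2) by (intro subcring_iff[THEN iffD1] subcringI' subringE)
  have "x [^]\<^bsub>R\<lparr>carrier := H\<rparr>\<^esub> m = x [^] m" for x and m :: nat
    by (rule nat_pow_consistent[symmetric])
  moreover have "[m] \<cdot>\<^bsub>R\<lparr>carrier := H\<rparr>\<^esub> x = [m] \<cdot> x" for x and m :: nat
    by (simp add: add_pow_def nat_pow_def)
  ultimately show ?thesis using H.prime_power_sum[OF assms(1), of x y] assms(3,4) by simp
qed

end

section \<open>Blocks of isomorphic developments\<close>

lemma mem_dev_iff:
  assumes "finite (carrier G)"
  shows "B \<in># dev G b D \<longleftrightarrow> (\<exists>i<b. \<exists>g\<in>carrier G. B = D i +>\<^bsub>G\<^esub> g)"
proof -
  have "set_mset (dev G b D) = (\<lambda>(i, g). D i +>\<^bsub>G\<^esub> g) ` ({..<b} \<times> carrier G)"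
    unfolding dev_def using assms by simp
  then show ?thesis by auto
qed

text \<open>The equality of multisets is turned into a correspondence of blocks in both directions:
  going back transports intersections and covered triples to the first design, going forward shows
  that uncovered triples stay uncovered there.\<close>

lemma isomorphic_designsE:
  assumes "isomorphic_designs (V, \<D>) (W, \<E>)"
  obtains \<phi> where "bij_betw \<phi> V W" "\<And>B. B \<in># \<D> \<Longrightarrow> \<phi> ` B \<in># \<E>"
    "\<And>E. E \<in># \<E> \<Longrightarrow> \<exists>B. B \<in># \<D> \<and> E = \<phi> ` B"
proof -
  obtain \<phi> where \<phi>: "bij_betw \<phi> V W" "image_mset (\<lambda>B. \<phi> ` B) \<D> = \<E>"
    using assms by (auto simp: isomorphic_designs_def)
  have "\<E> = image_mset (\<lambda>B. \<phi> ` B) \<D>" using \<phi>(2) by (rule sym)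
  then have *: "set_mset \<E> = (\<lambda>B. \<phi> ` B) ` set_mset \<D>" by simp
  show thesis
    by (rule that[OF \<phi>(1)]) (use * in blast)+
qed

section \<open>Cyclotomic classes of order \<open>N + 1\<close> in the field of order \<open>N ^ 4\<close>\<close>

locale semiprimitive_field = field F for F (structure) +
  fixes p n N :: nat and \<alpha>
  assumes prime_p: "Factorial_Ring.prime p" and n_pos: "n \<ge> 1" and N_eq: "N = p ^ n"
    and finite_F: "finite (carrier F)" and card_F: "card (carrier F) = N ^ 4"
    and alpha_Units: "\<alpha> \<in> Units F" and generator: "generate (units_of F) {\<alpha>} = Units F"
begin

sublocale finite_abelian_group F
  by unfold_locales (rule finite_F)

definition k :: nat where "k = (N\<^sup>2 + 1) * (N - 1)"

definition C :: "nat \<Rightarrow> 'a set" where "C = cyclotomic_class F (N + 1) \<alpha>"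

definition Fix :: "nat \<Rightarrow> 'a set" where "Fix M = {x \<in> carrier F. x [^] M = x}"

abbreviation \<theta> :: "'a \<Rightarrow> 'a" where "\<theta> x \<equiv> x [^] N\<^sup>2"

lemma N_ge_2: "N \<ge> 2"
proof -
  have "p \<le> p ^ n" using n_pos prime_gt_0_nat[OF prime_p] by (simp add: self_le_power)
  then show ?thesis using prime_ge_2_nat[OF prime_p] N_eq by linarith
qed

lemma N4_eq: "N ^ 4 = Suc ((N + 1) * k)"
proof -
  obtain M where M: "N = Suc M" using N_ge_2 by (cases N) auto
  show ?thesis unfolding k_def unfolding M by (simp add: eval_nat_numeral algebra_simps)
qed

lemma k_pos: "k > 0" using N_ge_2 by (simp add: k_def)

section \<open>Powers of the generator\<close>

lemma alpha_closed [simp]: "\<alpha> \<in> carrier F"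
  using alpha_Units by (rule Units_closed)

lemma alpha_pow_closed [simp]: "\<alpha> [^] (t :: nat) \<in> carrier F"
  by simp

lemma alpha_pow_nonzero [simp]: "\<alpha> [^] (t :: nat) \<noteq> \<zero>"
  using Units_pow_closed[OF alpha_Units, of t] by (simp add: field_Units)

lemma ord_alpha: "group.ord (units_of F) \<alpha> = (N + 1) * k"
proof -
  interpret U: group "units_of F" by (rule units_group)
  have "group.ord (units_of F) \<alpha> = card (generate (units_of F) {\<alpha>})"
    by (rule U.generate_pow_card) (simp add: units_of_carrier alpha_Units)
  also have "\<dots> = card (carrier F - {\<zero>})" by (simp add: generator field_Units)
  also have "\<dots> = (N + 1) * k" using card_F N4_eq by simp
  finally show ?thesis .
qed

lemma alpha_pow_eq_iff: "\<alpha> [^] (a :: nat) = \<alpha> [^] (b :: nat) \<longleftrightarrow> [a = b] (mod (N + 1) * k)"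
proof -
  interpret U: group "units_of F" by (rule units_group)
  have c: "\<alpha> \<in> carrier (units_of F)" by (simp add: units_of_carrier alpha_Units)
  have "\<alpha> [^] a = \<alpha> [^] b \<longleftrightarrow> \<alpha> [^]\<^bsub>units_of F\<^esub> int a = \<alpha> [^]\<^bsub>units_of F\<^esub> int b"
    by (simp add: int_pow_int units_of_pow[OF alpha_Units])
  also have "\<dots> \<longleftrightarrow> int ((N + 1) * k) dvd int b - int a"
    using U.int_pow_eq[OF c, of "int a" "int b"] ord_alpha by simp
  also have "\<dots> \<longleftrightarrow> [int b = int a] (mod int ((N + 1) * k))"
    by (simp add: cong_iff_dvd_diff)
  also have "\<dots> \<longleftrightarrow> [b = a] (mod (N + 1) * k)" by (rule cong_int_iff)
  finally show ?thesis using cong_sym_eq by blast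
qed

lemma ex_alpha_pow:
  assumes "x \<in> carrier F" "x \<noteq> \<zero>"
  obtains t :: nat where "x = \<alpha> [^] t"
proof -
  interpret U: group "units_of F" by (rule units_group)
  have "x \<in> generate (units_of F) {\<alpha>}" using assms generator by (simp add: field_Units)
  then have "x \<in> {\<alpha> [^]\<^bsub>units_of F\<^esub> t | t. t \<in> (UNIV :: nat set)}"
    using U.generate_pow_nat[of \<alpha>] ord_alpha k_pos by (simp add: units_of_carrier alpha_Units)
  then obtain t :: nat where "x = \<alpha> [^]\<^bsub>units_of F\<^esub> t" by blast
  then show thesis using that by (simp add: units_of_pow[OF alpha_Units])
qed

lemma card_roots_of_unity:
  assumes "m dvd (N + 1) * k"
  shows "card {x \<in> carrier F. x \<noteq> \<zero> \<and> x [^] m = \<one>} = m"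
proof -
  obtain d where d: "(N + 1) * k = m * d" using assms by blast
  have md': "m * d > 0" unfolding d[symmetric] using k_pos by simp
  have md: "m > 0" "d > 0" using md' by (cases m; cases d; simp)+
  have "{x \<in> carrier F. x \<noteq> \<zero> \<and> x [^] m = \<one>} = (\<lambda>s. \<alpha> [^] (s * d)) ` {..<m}"
  proof (intro equalityI subsetI)
    fix x assume "x \<in> {x \<in> carrier F. x \<noteq> \<zero> \<and> x [^] m = \<one>}"
    then have x: "x \<in> carrier F" "x \<noteq> \<zero>" "x [^] m = \<one>" by auto
    then obtain t :: nat where t: "x = \<alpha> [^] t" using ex_alpha_pow by blast
    have "\<alpha> [^] (t * m) = \<alpha> [^] (0 :: nat)" using x(3) by (simp add: t nat_pow_pow)
    then have "[t * m = 0] (mod m * d)" unfolding alpha_pow_eq_iff d .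
    then have "m * d dvd m * t" by (simp add: cong_0_iff mult.commute)
    then have "d dvd t" using md by simp
    then obtain s where s: "t = d * s" by blast
    have "[d * s = d * (s mod m)] (mod d * m)" by (simp add: cong_def)
    then have "x = \<alpha> [^] (s mod m * d)" unfolding t s alpha_pow_eq_iff d by (simp add: mult.commute)
    then show "x \<in> (\<lambda>s. \<alpha> [^] (s * d)) ` {..<m}" using md by auto
  next
    fix x assume "x \<in> (\<lambda>s. \<alpha> [^] (s * d)) ` {..<m}"
    then obtain s where s: "x = \<alpha> [^] (s * d)" by auto
    have "\<alpha> [^] (s * d * m) = \<alpha> [^] (0 :: nat)"
      unfolding alpha_pow_eq_iff d by (simp add: cong_0_iff mult.commute mult.left_commute)
    then show "x \<in> {x \<in> carrier F. x \<noteq> \<zero> \<and> x [^] m = \<one>}" by (simp add: s nat_pow_pow)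
  qed
  moreover have "inj_on (\<lambda>s. \<alpha> [^] (s * d)) {..<m}"
  proof (rule inj_onI)
    fix s s' assume *: "s \<in> {..<m}" "s' \<in> {..<m}" "\<alpha> [^] (s * d) = \<alpha> [^] (s' * d)"
    have "[d * s = d * s'] (mod d * m)"
      using *(3) unfolding alpha_pow_eq_iff d by (simp add: mult.commute)
    then have "d * (s mod m) = d * (s' mod m)" by (simp add: cong_def)
    then show "s = s'" using * md by simp
  qed
  ultimately show ?thesis by (simp add: card_image)
qed

section \<open>Fixed fields of powers of the Frobenius map\<close>

lemma Fix_eq:
  assumes "M \<ge> 2"
  shows "Fix M = insert \<zero> {x \<in> carrier F. x \<noteq> \<zero> \<and> x [^] (M - 1) = \<one>}"
proof -
  have key: "x [^] M = x \<longleftrightarrow> x [^] (M - 1) = \<one>" if x: "x \<in> carrier F" "x \<noteq> \<zero>" for x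
  proof -
    have "x [^] M = x [^] (M - 1) \<otimes> x" using assms using nat_pow_Suc[of x "M - 1"] by simp
    moreover have "x [^] (M - 1) \<otimes> x = \<one> \<otimes> x \<longleftrightarrow> x [^] (M - 1) = \<one>"
      using x by (intro m_rcancel) auto
    ultimately show ?thesis using x by simp
  qed
  have "\<zero> [^] M = \<zero>" using assms by (intro nat_pow_zero) auto
  then show ?thesis using key by (auto simp: Fix_def)
qed

lemma card_Fix:
  assumes "M \<ge> 2" "M - 1 dvd (N + 1) * k"
  shows "card (Fix M) = M"
  using card_roots_of_unity[OF assms(2)] assms(1) finite_F by (simp add: Fix_eq)

lemma card_Fix_N: "card (Fix N) = N"
  using N_ge_2 by (intro card_Fix dvd_mult) (simp_all only: k_def dvd_triv_right)

lemma card_Fix_N2: "card (Fix (N\<^sup>2)) = N\<^sup>2"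
proof (rule card_Fix)
  show "2 \<le> N\<^sup>2" using power_mono[OF N_ge_2, of 2] by simp
  have "(N + 1) * k = (N\<^sup>2 - 1) * (N\<^sup>2 + 1)"
  proof -
    obtain M where M: "N = Suc M" using N_ge_2 by (cases N) auto
    show ?thesis unfolding k_def unfolding M by (simp add: algebra_simps power2_eq_square)
  qed
  then show "N\<^sup>2 - 1 dvd (N + 1) * k" by simp
qed

text \<open>The additive order of \<open>\<one>\<close> divides \<open>N ^ 4\<close>, a power of
  \<open>p\<close>, so a power of \<open>[p] \<cdot> \<one>\<close> vanishes; a field has no nonzero
  nilpotent elements.\<close>

lemma char_p: "[p] \<cdot> \<one> = \<zero>"
proof -
  have pow: "[(p ^ m)] \<cdot> \<one> = ([p] \<cdot> \<one>) [^] m" for m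
  proof (induction m)
    case (Suc m)
    have "([p] \<cdot> \<one>) [^] Suc m = ([(p ^ m)] \<cdot> \<one>) \<otimes> ([p] \<cdot> \<one>)" by (simp add: Suc)
    also have "\<dots> = [(p ^ Suc m)] \<cdot> \<one>"
      by (simp add: add_pow_ldistr add.nat_pow_pow mult.commute)
    finally show ?case by simp
  qed simp
  have "[order F] \<cdot> \<one> = \<zero>"
    using add.pow_order_eq_1[of \<one>] by (simp add: order_def)
  then have "([p] \<cdot> \<one>) [^] (n * 4) = \<zero>"
    unfolding pow[symmetric] by (simp add: order_def card_F N_eq power_mult)
  moreover have "x = \<zero>" if "x \<in> carrier F" "x [^] m = \<zero>" for x and m :: nat
    using that by (induction m) (auto simp: integral_iff)
  ultimately show ?thesis by simp
qed

text \<open>Only \<open>M = N\<close> and \<open>M = N\<^sup>2\<close> are used, for which \<open>Fix M\<close> is the subfield of order \<open>M\<close>.\<close>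

definition ppower :: "nat \<Rightarrow> bool" where "ppower M \<longleftrightarrow> (\<exists>m. M = p ^ m)"

lemma ppower_N: "ppower N" and ppower_N2: "ppower (N\<^sup>2)"
  by (auto simp: ppower_def N_eq simp flip: power_mult)

lemma frob_add:
  assumes "ppower M" "x \<in> carrier F" "y \<in> carrier F"
  shows "(x \<oplus> y) [^] M = x [^] M \<oplus> y [^] M"
  using assms freshman[OF prime_p char_p] by (auto simp: ppower_def)

lemma ppower_pos: "ppower M \<Longrightarrow> M > 0"
  using prime_gt_0_nat[OF prime_p] by (auto simp: ppower_def)

lemma frob_uminus:
  assumes "ppower M" "x \<in> carrier F"
  shows "(\<ominus> x) [^] M = \<ominus> (x [^] M)"
proof -
  have "(\<ominus> x) [^] M \<oplus> x [^] M = (\<ominus> x \<oplus> x) [^] M" using assms by (simp add: frob_add)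
  also have "\<dots> = \<zero>" using assms ppower_pos[OF assms(1)] by (simp add: l_neg nat_pow_zero)
  finally show ?thesis using assms by (simp add: minus_equality)
qed

lemma frob_minus:
  assumes "ppower M" "x \<in> carrier F" "y \<in> carrier F"
  shows "(x \<ominus> y) [^] M = x [^] M \<ominus> y [^] M"
  using assms by (simp add: a_minus_def frob_add frob_uminus)

lemma Fix_closed: "x \<in> Fix M \<Longrightarrow> x \<in> carrier F"
  by (simp add: Fix_def)

lemma Fix_zero: "ppower M \<Longrightarrow> \<zero> \<in> Fix M"
  using ppower_pos[of M] by (simp add: Fix_def nat_pow_zero)

lemma Fix_one: "\<one> \<in> Fix M"
  by (simp add: Fix_def)

lemma Fix_add: "ppower M \<Longrightarrow> x \<in> Fix M \<Longrightarrow> y \<in> Fix M \<Longrightarrow> x \<oplus> y \<in> Fix M"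
  by (simp add: Fix_def frob_add)

lemma Fix_uminus: "ppower M \<Longrightarrow> x \<in> Fix M \<Longrightarrow> \<ominus> x \<in> Fix M"
  by (simp add: Fix_def frob_uminus)

lemma Fix_minus: "ppower M \<Longrightarrow> x \<in> Fix M \<Longrightarrow> y \<in> Fix M \<Longrightarrow> x \<ominus> y \<in> Fix M"
  by (simp add: Fix_def frob_minus)

lemma Fix_mult: "x \<in> Fix M \<Longrightarrow> y \<in> Fix M \<Longrightarrow> x \<otimes> y \<in> Fix M"
  by (simp add: Fix_def nat_pow_distrib)

lemma inv_nonzero [simp]: "x \<in> carrier F \<Longrightarrow> x \<noteq> \<zero> \<Longrightarrow> inv x \<in> carrier F"
  "x \<in> carrier F \<Longrightarrow> x \<noteq> \<zero> \<Longrightarrow> x \<otimes> inv x = \<one>"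
  by (simp_all add: field_Units)

lemma Fix_inv:
  assumes "x \<in> Fix M" "x \<noteq> \<zero>"
  shows "inv x \<in> Fix M"
proof -
  have x: "x \<in> carrier F" "x [^] M = x" using assms by (auto simp: Fix_def)
  have "x [^] M \<otimes> (inv x) [^] M = (x \<otimes> inv x) [^] M" using x(1) assms by (intro nat_pow_distrib[symmetric]) auto
  also have "\<dots> = \<one>" using x(1) assms by simp
  finally have "x \<otimes> (inv x) [^] M = \<one>" unfolding x(2) .
  then have "inv x = (inv x) [^] M" using x assms by (intro comm_inv_char) auto
  then show ?thesis using x assms by (simp add: Fix_def)
qed

lemma Fix_N_subset: "Fix N \<subseteq> Fix (N\<^sup>2)"
  by (auto simp: Fix_def power2_eq_square simp flip: nat_pow_pow)

lemma finite_Fix [simp]: "finite (Fix M)"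
  using finite_F by (auto simp: Fix_def)

text \<open>The \<open>k\<close>-th power map on the multiplicative group has the subgroup of index
  \<open>N + 1\<close> as its kernel, so the classes are its fibres.\<close>

lemma mem_C_iff: "x \<in> C i \<longleftrightarrow> x \<in> carrier F \<and> x \<noteq> \<zero> \<and> x [^] k = \<alpha> [^] (i * k)"
proof -
  have key: "[t = i] (mod (N + 1)) \<longleftrightarrow> (\<alpha> [^] t) [^] k = \<alpha> [^] (i * k)" for t :: nat
  proof -
    have "(\<alpha> [^] t) [^] k = \<alpha> [^] (i * k) \<longleftrightarrow> [k * t = k * i] (mod k * (N + 1))"
      by (simp only: nat_pow_pow[OF alpha_closed] alpha_pow_eq_iff mult.commute)
    also have "\<dots> \<longleftrightarrow> [t = i] (mod (N + 1))"
      using k_pos unfolding cong_def mod_mult_mult1 by simp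
    finally show ?thesis by simp
  qed
  show ?thesis
  proof
    assume "x \<in> C i"
    then obtain t :: nat where "x = \<alpha> [^] t" "[t = i] (mod (N + 1))" by (auto simp: C_def cyclotomic_class_def)
    then show "x \<in> carrier F \<and> x \<noteq> \<zero> \<and> x [^] k = \<alpha> [^] (i * k)" using key by simp
  next
    assume *: "x \<in> carrier F \<and> x \<noteq> \<zero> \<and> x [^] k = \<alpha> [^] (i * k)"
    then obtain t :: nat where "x = \<alpha> [^] t" using ex_alpha_pow by blast
    then show "x \<in> C i" using key * by (auto simp: C_def cyclotomic_class_def)
  qed
qed

section \<open>Elementary properties of the classes\<close>

lemma C_closed: "C i \<subseteq> carrier F"
  by (auto simp: mem_C_iff)

lemma zero_notin_C: "\<zero> \<notin> C i"
  by (simp add: mem_C_iff)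

text \<open>The exponent factors as \<open>k = (N^2 + 1) * (N - 1)\<close>: the first factor
  produces the norm, and among nonzero elements the second one tests membership in
  \<open>Fix N\<close>.\<close>

lemma mem_C0_iff: "x \<in> C 0 \<longleftrightarrow> x \<in> carrier F \<and> x \<noteq> \<zero> \<and> x \<otimes> \<theta> x \<in> Fix N"
proof (cases "x \<in> carrier F \<and> x \<noteq> \<zero>")
  case True
  then have [simp]: "x \<in> carrier F" "x \<noteq> \<zero>" by auto
  have pz: "x [^] t \<noteq> \<zero>" for t :: nat by (induction t) (auto simp: integral_iff)
  then have nz: "x \<otimes> \<theta> x \<noteq> \<zero>" by (simp add: integral_iff)
  have e: "x \<otimes> \<theta> x = x [^] (N\<^sup>2 + 1)" by (simp add: m_comm)
  have "(x \<otimes> \<theta> x) [^] (N - 1) = x [^] k" unfolding e k_def by (rule nat_pow_pow) simp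
  then show ?thesis using nz N_ge_2 by (simp add: mem_C_iff Fix_eq)
qed (auto simp: mem_C_iff)

lemma card_C0: "card (C 0) = k"
proof -
  have "C 0 = {x \<in> carrier F. x \<noteq> \<zero> \<and> x [^] k = \<one>}" by (auto simp: mem_C_iff)
  then show ?thesis using card_roots_of_unity[of k] by simp
qed

lemma C_mult: "x \<in> C i \<Longrightarrow> y \<in> C j \<Longrightarrow> x \<otimes> y \<in> C (i + j)"
  by (simp add: mem_C_iff nat_pow_distrib nat_pow_mult integral_iff algebra_simps)

lemma C0_cancel:
  assumes "a \<in> C 0" "g \<in> carrier F"
  shows "a \<otimes> g \<in> C 0 \<longleftrightarrow> g \<in> C 0"
  using assms by (auto simp: mem_C_iff nat_pow_distrib integral_iff)

lemma C_scale:
  assumes "x \<in> carrier F"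
  shows "\<alpha> [^] i \<otimes> x \<in> C i \<longleftrightarrow> x \<in> C 0"
proof -
  have "(\<alpha> [^] i \<otimes> x) [^] k = \<alpha> [^] (i * k) \<otimes> x [^] k"
    using assms by (simp add: nat_pow_distrib nat_pow_pow)
  moreover have "\<alpha> [^] (i * k) \<otimes> x [^] k = \<alpha> [^] (i * k) \<otimes> \<one> \<longleftrightarrow> x [^] k = \<one>"
    using assms by (intro m_lcancel) auto
  ultimately show ?thesis using assms by (simp add: mem_C_iff integral_iff)
qed

lemma carrier_scale:
  assumes "x \<in> carrier F"
  obtains y where "y \<in> carrier F" "x = \<alpha> [^] (i :: nat) \<otimes> y"
proof
  show "inv (\<alpha> [^] i) \<otimes> x \<in> carrier F" using assms by simp
  show "x = \<alpha> [^] i \<otimes> (inv (\<alpha> [^] i) \<otimes> x)" using assms by (simp flip: m_assoc)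
qed

lemma C_eq_image: "C i = (\<lambda>x. \<alpha> [^] i \<otimes> x) ` C 0"
proof (intro equalityI subsetI)
  fix x assume x: "x \<in> C i"
  then have "x \<in> carrier F" using C_closed by blast
  then obtain y where "y \<in> carrier F" "x = \<alpha> [^] i \<otimes> y" using carrier_scale by blast
  then show "x \<in> (\<lambda>x. \<alpha> [^] i \<otimes> x) ` C 0" using x C_scale by blast
qed (use C_scale C_closed in blast)

lemma inj_on_scale: "inj_on (\<lambda>x. \<alpha> [^] (i :: nat) \<otimes> x) (carrier F)"
  by (rule inj_onI) (simp add: m_lcancel)

lemma card_C: "card (C i) = k"
  using card_image[OF inj_on_subset[OF inj_on_scale C_closed]] C_eq_image card_C0 by metis

lemma C_disjoint:
  assumes "i < N + 1" "j < N + 1" "i \<noteq> j"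
  shows "C i \<inter> C j = {}"
proof (rule ccontr)
  assume "C i \<inter> C j \<noteq> {}"
  then have "\<alpha> [^] (i * k) = \<alpha> [^] (j * k)" by (auto simp: mem_C_iff)
  then have "[k * i = k * j] (mod k * (N + 1))" by (simp only: alpha_pow_eq_iff mult.commute)
  then have "[i = j] (mod (N + 1))"
    using k_pos unfolding cong_def mod_mult_mult1 by simp
  then show False using assms by (simp add: cong_def)
qed

text \<open>This makes every class symmetric under negation, as \<open>sum_diff_count_right\<close>
  requires. It holds because \<open>\<ominus> \<one>\<close> lies in the prime field and hence has
  its norm in \<open>Fix N\<close>.\<close>

lemma minus_one_C0: "\<ominus> \<one> \<in> C 0"
proof -
  have "\<ominus> \<one> \<in> Fix N" by (rule Fix_uminus[OF ppower_N Fix_one])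
  moreover have "\<theta> (\<ominus> \<one>) = \<ominus> \<one>" by (simp add: frob_uminus[OF ppower_N2])
  ultimately show ?thesis by (simp add: mem_C0_iff Fix_mult)
qed

lemma C_uminus:
  assumes "x \<in> C i"
  shows "\<ominus> x \<in> C i"
proof -
  have x: "x \<in> carrier F" using assms C_closed by blast
  have "\<ominus> x = \<ominus> \<one> \<otimes> x" using x by (simp add: l_minus)
  then show ?thesis using C_mult[OF minus_one_C0 assms] by simp
qed

lemma diff_count_scale:
  assumes "a \<in> carrier F"
  shows "diff_count F (C i) (C i) (\<alpha> [^] i \<otimes> a) = diff_count F (C 0) (C 0) a"
proof -
  let ?f = "\<lambda>x. \<alpha> [^] i \<otimes> x"
  have key: "?f u \<ominus> ?f w = ?f a \<longleftrightarrow> u \<ominus> w = a" if "u \<in> carrier F" "w \<in> carrier F" for u w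
  proof -
    have "?f u \<ominus> ?f w = ?f (u \<ominus> w)" using that by (simp add: a_minus_def r_distr r_minus)
    moreover have "?f (u \<ominus> w) = ?f a \<longleftrightarrow> u \<ominus> w = a"
      using that assms by (intro m_lcancel) auto
    ultimately show ?thesis by simp
  qed
  have "{(u, w). u \<in> C i \<and> w \<in> C i \<and> u \<ominus> w = ?f a}
      = (\<lambda>(u, w). (?f u, ?f w)) ` {(u, w). u \<in> C 0 \<and> w \<in> C 0 \<and> u \<ominus> w = a}"
  proof (intro equalityI subsetI)
    fix z assume "z \<in> {(u, w). u \<in> C i \<and> w \<in> C i \<and> u \<ominus> w = ?f a}"
    then obtain u w where z: "z = (u, w)" "u \<in> C i" "w \<in> C i" "u \<ominus> w = ?f a" by blast
    then obtain u' w' where *: "u = ?f u'" "w = ?f w'" "u' \<in> C 0" "w' \<in> C 0"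
      unfolding C_eq_image[of i] by blast
    then have "u' \<ominus> w' = a" using z key C_closed by blast
    then show "z \<in> (\<lambda>(u, w). (?f u, ?f w)) ` {(u, w). u \<in> C 0 \<and> w \<in> C 0 \<and> u \<ominus> w = a}"
      unfolding z(1) *(1,2) by (intro rev_image_eqI[of "(u', w')"]) (simp_all add: *)
  next
    fix z assume "z \<in> (\<lambda>(u, w). (?f u, ?f w)) ` {(u, w). u \<in> C 0 \<and> w \<in> C 0 \<and> u \<ominus> w = a}"
    then obtain u w where *: "z = (?f u, ?f w)" "u \<in> C 0" "w \<in> C 0" "u \<ominus> w = a" by auto
    have "?f u \<ominus> ?f w = ?f a" using key * C_closed by blast
    moreover have "?f u \<in> C i" "?f w \<in> C i" unfolding C_eq_image[of i] using * by blast+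
    ultimately show "z \<in> {(u, w). u \<in> C i \<and> w \<in> C i \<and> u \<ominus> w = ?f a}" using * by blast
  qed
  moreover have "inj_on (\<lambda>(u, w). (?f u, ?f w)) {(u, w). u \<in> C 0 \<and> w \<in> C 0 \<and> u \<ominus> w = a}"
  proof (rule inj_onI)
    fix z z' assume z: "z \<in> {(u, w). u \<in> C 0 \<and> w \<in> C 0 \<and> u \<ominus> w = a}"
      "z' \<in> {(u, w). u \<in> C 0 \<and> w \<in> C 0 \<and> u \<ominus> w = a}"
      "(\<lambda>(u, w). (?f u, ?f w)) z = (\<lambda>(u, w). (?f u, ?f w)) z'"
    obtain u w u' w' where e: "z = (u, w)" "z' = (u', w')" by fastforce
    have c: "u \<in> carrier F" "w \<in> carrier F" "u' \<in> carrier F" "w' \<in> carrier F"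
      using z e C_closed by blast+
    have "?f u = ?f u'" "?f w = ?f w'" using z(3) e by simp_all
    then show "z = z'" using c inj_onD[OF inj_on_scale] e by blast
  qed
  ultimately show ?thesis by (simp add: diff_count_def card_image)
qed


section \<open>Conjugation and norm over the subfield of order N^2\<close>

lemma theta_closed: "x \<in> carrier F \<Longrightarrow> \<theta> x \<in> carrier F"
  by simp

lemma theta_theta:
  assumes "x \<in> carrier F"
  shows "\<theta> (\<theta> x) = x"
proof (cases "x = \<zero>")
  case True
  then show ?thesis using N_ge_2 by (simp add: nat_pow_zero)
next
  case False
  then obtain t :: nat where t: "x = \<alpha> [^] t" using ex_alpha_pow assms by blast
  have "\<theta> (\<theta> x) = \<alpha> [^] (t * N ^ 4)"
    by (simp add: t nat_pow_pow power4_eq_xxxx power2_eq_square mult.assoc)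
  also have "\<dots> = \<alpha> [^] t" unfolding alpha_pow_eq_iff N4_eq by (simp add: cong_def)
  finally show ?thesis using t by simp
qed

lemma theta_Fix: "x \<in> Fix (N\<^sup>2) \<Longrightarrow> \<theta> x = x"
  by (simp add: Fix_def)

lemma norm_Fix:
  assumes "x \<in> carrier F"
  shows "x \<otimes> \<theta> x \<in> Fix (N\<^sup>2)"
  using assms theta_theta by (simp add: Fix_def nat_pow_distrib m_comm)

lemma norm_add_one:
  assumes "x \<in> carrier F"
  shows "(x \<oplus> \<one>) \<otimes> \<theta> (x \<oplus> \<one>) = x \<otimes> \<theta> x \<oplus> (x \<oplus> \<theta> x) \<oplus> \<one>"
proof -
  have "\<theta> (x \<oplus> \<one>) = \<theta> x \<oplus> \<one>" using assms by (simp add: frob_add[OF ppower_N2])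
  moreover have "(x \<oplus> \<one>) \<otimes> (\<theta> x \<oplus> \<one>) = x \<otimes> \<theta> x \<oplus> (x \<oplus> \<theta> x) \<oplus> \<one>"
    using assms theta_closed[OF assms] by algebra
  ultimately show ?thesis by simp
qed

text \<open>The polynomial with roots \<open>g\<close> and \<open>h\<close>, arranged so that its
  coefficients are the two quantities which the norm conditions at \<open>g\<close> and
  \<open>g \<oplus> \<one>\<close> place in \<open>Fix N\<close> when \<open>h = \<theta> g\<close>.
  The condition at \<open>g \<oplus> \<one>\<close> causes the shift from
  \<open>x \<otimes> x\<close> to \<open>x \<otimes> x \<oplus> x\<close>.\<close>

lemma vieta:
  assumes "\<kappa> \<in> carrier F" "x \<in> carrier F" "g \<in> carrier F" "h \<in> carrier F"
  shows "\<kappa> \<otimes> (x \<otimes> x \<oplus> x) \<oplus> \<kappa> \<otimes> (g \<otimes> h) \<ominus> \<kappa> \<otimes> (g \<oplus> h \<oplus> \<one>) \<otimes> x = \<kappa> \<otimes> ((x \<ominus> g) \<otimes> (x \<ominus> h))"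
  using assms by algebra

text \<open>A root of a quadratic polynomial over the field with \<open>N\<close> elements lies in the field with
  \<open>N\<^sup>2\<close> elements, so it can only have conjugates \<open>w\<close> and \<open>\<theta> w\<close> if it is already fixed by
  the \<open>N\<close>-th power map.\<close>

lemma Fix_N_if_norms:
  assumes w: "w \<in> carrier F" and n0: "w \<otimes> \<theta> w \<in> Fix N" and n1: "(w \<oplus> \<one>) \<otimes> \<theta> (w \<oplus> \<one>) \<in> Fix N"
  shows "w \<in> Fix N"
proof -
  let ?q = "w \<otimes> \<theta> w" and ?t = "w \<oplus> \<theta> w" and ?y = "w [^] N"
  have c [simp]: "?q \<in> carrier F" "?t \<in> carrier F" "?y \<in> carrier F" "\<theta> w \<in> carrier F" using w by auto
  have "?t = (?q \<oplus> ?t \<oplus> \<one>) \<ominus> ?q \<ominus> \<one>" using c(1,2) by algebra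
  then have t: "?t \<in> Fix N"
    using n0 n1 unfolding norm_add_one[OF w] by (metis Fix_minus Fix_one ppower_N)
  \<comment> \<open>\<open>w\<close> is a root of the quadratic polynomial with trace
    \<open>?t\<close> and norm \<open>?q\<close>. Both coefficients are fixed by the
    \<open>N\<close>-th power map, so \<open>?y\<close> is a root as well.\<close>
  have "(w \<otimes> w \<ominus> ?t \<otimes> w) \<oplus> ?q = \<zero>" using w c(4) by algebra
  then have "((w \<otimes> w \<ominus> ?t \<otimes> w) \<oplus> ?q) [^] N = \<zero>" using N_ge_2 by (simp add: nat_pow_zero)
  moreover have "((w \<otimes> w \<ominus> ?t \<otimes> w) \<oplus> ?q) [^] N = (?y \<otimes> ?y \<ominus> ?t \<otimes> ?y) \<oplus> ?q"
    using w c n0 t by (simp add: frob_add[OF ppower_N] frob_minus[OF ppower_N] nat_pow_distrib Fix_def del: c)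
  moreover have "(?y \<otimes> ?y \<ominus> ?t \<otimes> ?y) \<oplus> ?q = (?y \<ominus> w) \<otimes> (?y \<ominus> \<theta> w)"
    using w c(3,4) by algebra
  ultimately have "?y \<ominus> w = \<zero> \<or> ?y \<ominus> \<theta> w = \<zero>"
    using w by (simp add: integral_iff)
  then show ?thesis
  proof
    assume "?y \<ominus> w = \<zero>"
    then show ?thesis using w by (simp add: Fix_def)
  next
    assume "?y \<ominus> \<theta> w = \<zero>"
    then have "?y = \<theta> w" using w by simp
    \<comment> \<open>If the \<open>N\<close>-th power map sent \<open>w\<close> to its conjugate,
      applying it twice would give the same element as applying it once, and injectivity of the map
      then puts \<open>w\<close> into \<open>Fix N\<close>.\<close>
    moreover have "?y [^] N = \<theta> w" using w by (simp add: nat_pow_pow power2_eq_square)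
    ultimately have "?y = ?y [^] N" by simp
    then have "(?y \<ominus> w) [^] N = \<zero>" using w by (simp add: frob_minus[OF ppower_N])
    then have "?y \<ominus> w = \<zero>"
    proof (rule contrapos_pp)
      assume nz: "?y \<ominus> w \<noteq> \<zero>"
      have "(?y \<ominus> w) [^] m \<noteq> \<zero>" for m :: nat
        using nz w by (induction m) (auto simp: integral_iff)
      then show "(?y \<ominus> w) [^] N \<noteq> \<zero>" by blast
    qed
    then show ?thesis using w by (simp add: Fix_def)
  qed
qed

text \<open>Dividing by \<open>a\<close>, a solution has the form \<open>w = a \<otimes> g\<close>,
  \<open>u = a \<otimes> (g \<oplus> \<one>)\<close>. In the norm conditions \<open>a\<close> then
  enters only through its own norm.\<close>

lemma diff_count_C0_eq:
  assumes "a \<in> carrier F" "a \<noteq> \<zero>"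
  shows "diff_count F (C 0) (C 0) a = card {g \<in> carrier F. a \<otimes> g \<in> C 0 \<and> a \<otimes> (g \<oplus> \<one>) \<in> C 0}"
proof -
  let ?S = "{g \<in> carrier F. a \<otimes> g \<in> C 0 \<and> a \<otimes> (g \<oplus> \<one>) \<in> C 0}"
  have "{(u, w). u \<in> C 0 \<and> w \<in> C 0 \<and> u \<ominus> w = a} = (\<lambda>g. (a \<otimes> (g \<oplus> \<one>), a \<otimes> g)) ` ?S"
  proof (intro equalityI subsetI)
    fix z assume "z \<in> {(u, w). u \<in> C 0 \<and> w \<in> C 0 \<and> u \<ominus> w = a}"
    then obtain u w where z: "z = (u, w)" "u \<in> C 0" "w \<in> C 0" "u \<ominus> w = a" by blast
    then have uw: "u \<in> carrier F" "w \<in> carrier F" using C_closed by blast+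
    let ?g = "inv a \<otimes> w"
    have 1: "a \<otimes> ?g = w" using uw assms by (simp flip: m_assoc)
    have "u = a \<oplus> w" using z(4) uw assms by (simp add: minus_eq_iff)
    then have 2: "a \<otimes> (?g \<oplus> \<one>) = u" using 1 uw assms by (simp add: r_distr a_comm)
    have "?g \<in> ?S" unfolding mem_Collect_eq 1 2 using z uw assms by simp
    then show "z \<in> (\<lambda>g. (a \<otimes> (g \<oplus> \<one>), a \<otimes> g)) ` ?S"
      by (rule rev_image_eqI) (simp only: z 1 2)
  next
    fix z assume "z \<in> (\<lambda>g. (a \<otimes> (g \<oplus> \<one>), a \<otimes> g)) ` ?S"
    then obtain g where g: "g \<in> carrier F" "a \<otimes> g \<in> C 0" "a \<otimes> (g \<oplus> \<one>) \<in> C 0"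
      "z = (a \<otimes> (g \<oplus> \<one>), a \<otimes> g)" by blast
    have "a \<otimes> (g \<oplus> \<one>) \<ominus> a \<otimes> g = a" using g(1) assms(1) by algebra
    then show "z \<in> {(u, w). u \<in> C 0 \<and> w \<in> C 0 \<and> u \<ominus> w = a}" using g by simp
  qed
  moreover have "inj_on (\<lambda>g. (a \<otimes> (g \<oplus> \<one>), a \<otimes> g)) ?S"
    by (rule inj_onI) (use assms in \<open>auto simp: m_lcancel\<close>)
  ultimately show ?thesis by (simp add: diff_count_def card_image)
qed

section \<open>Difference counts of the class C 0\<close>

lemma minus_one_Fix: "\<ominus> \<one> \<in> Fix M" if "ppower M"
  using that by (intro Fix_uminus Fix_one)

lemma Fix_N_C0:
  assumes "g \<in> Fix N" "g \<noteq> \<zero>"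
  shows "g \<in> C 0"
proof -
  have "\<theta> g = g" using assms Fix_N_subset by (intro theta_Fix) blast
  then show ?thesis using assms by (simp add: mem_C0_iff Fix_mult Fix_closed)
qed

lemma minus_eq_zero_iff_eq:
  assumes "x \<in> carrier F" "y \<in> carrier F"
  shows "x \<oplus> y = \<zero> \<longleftrightarrow> x = \<ominus> y"
  using assms by (metis minus_equality r_neg a_comm l_neg)

text \<open>A factor \<open>a\<close> from the subgroup can be cancelled, leaving \<open>g\<close>
  and \<open>g \<oplus> \<one>\<close> in \<open>C 0\<close>. By \<open>Fix_N_if_norms\<close> these
  \<open>g\<close> form the field of order \<open>N\<close> without the two elements for which
  \<open>g\<close> or \<open>g \<oplus> \<one>\<close> is zero.\<close>

lemma diff_count_C0_in:
  assumes a: "a \<in> C 0"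
  shows "diff_count F (C 0) (C 0) a = N - 2"
proof -
  have ac: "a \<in> carrier F" "a \<noteq> \<zero>" using a by (auto simp: mem_C_iff)
  have "{g \<in> carrier F. a \<otimes> g \<in> C 0 \<and> a \<otimes> (g \<oplus> \<one>) \<in> C 0} = Fix N - {\<zero>, \<ominus> \<one>}"
  proof (intro equalityI subsetI)
    fix g assume "g \<in> {g \<in> carrier F. a \<otimes> g \<in> C 0 \<and> a \<otimes> (g \<oplus> \<one>) \<in> C 0}"
    then have g: "g \<in> carrier F" "g \<in> C 0" "g \<oplus> \<one> \<in> C 0" using C0_cancel[OF a] by auto
    have "g \<otimes> \<theta> g \<in> Fix N" using g(2) by (simp only: mem_C0_iff)
    moreover have "(g \<oplus> \<one>) \<otimes> \<theta> (g \<oplus> \<one>) \<in> Fix N" using g(3) by (simp only: mem_C0_iff)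
    ultimately have "g \<in> Fix N" by (rule Fix_N_if_norms[OF g(1)])
    moreover have "g \<noteq> \<zero>" using g(2) unfolding mem_C_iff by blast
    moreover have "g \<oplus> \<one> \<noteq> \<zero>" using g(3) unfolding mem_C_iff by blast
    then have "g \<noteq> \<ominus> \<one>" by (auto simp: l_neg)
    ultimately show "g \<in> Fix N - {\<zero>, \<ominus> \<one>}" using \<open>g \<noteq> \<zero>\<close> by simp
  next
    fix g assume "g \<in> Fix N - {\<zero>, \<ominus> \<one>}"
    then have g: "g \<in> Fix N" "g \<noteq> \<zero>" "g \<noteq> \<ominus> \<one>" "g \<in> carrier F" by (auto simp: Fix_def)
    have "g \<oplus> \<one> \<noteq> \<zero>" using g by (simp add: minus_eq_zero_iff_eq)
    then have "g \<in> C 0" "g \<oplus> \<one> \<in> C 0"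
      using g Fix_add[OF ppower_N g(1) Fix_one] by (auto intro: Fix_N_C0)
    then show "g \<in> {g \<in> carrier F. a \<otimes> g \<in> C 0 \<and> a \<otimes> (g \<oplus> \<one>) \<in> C 0}"
      using g(4) C0_cancel[OF a] by simp
  qed
  moreover have "\<ominus> \<one> \<noteq> \<zero>" using minus_one_C0 by (auto simp: mem_C_iff)
  then have "card {\<zero>, \<ominus> \<one>} = 2" by (metis card_2_iff)
  then have "card (Fix N - {\<zero>, \<ominus> \<one>}) = N - 2"
    using Fix_zero[OF ppower_N] minus_one_Fix[OF ppower_N]
    by (subst card_Diff_subset) (simp_all add: card_Fix_N del: card.insert)
  ultimately show ?thesis using diff_count_C0_eq[OF ac] by simp
qed

text \<open>For \<open>a\<close> outside \<open>C 0\<close> put \<open>\<kappa> = a \<otimes> \<theta> a\<close>. The elements \<open>g\<close> to be counted are those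
  for which \<open>X\<^sup>2 - (g + \<theta> g) X + g \<theta> g\<close> has prescribed coefficients \<open>s / \<kappa>\<close> and
  \<open>t / \<kappa> - 1\<close> with \<open>s, t\<close> fixed by the \<open>N\<close>-th power map. For given \<open>s, t\<close> at most two
  elements arise as such a \<open>g\<close> or as a root of that polynomial in the subfield of order
  \<open>N\<^sup>2\<close>, and the total number of those roots is easy to determine.\<close>

lemma diff_count_C0_notin:
  assumes a: "a \<in> carrier F" "a \<noteq> \<zero>" "a \<notin> C 0"
  shows "diff_count F (C 0) (C 0) a \<le> N\<^sup>2 - N"
proof -
  define \<kappa> where "\<kappa> = a \<otimes> \<theta> a"
  have \<kappa>: "\<kappa> \<in> Fix (N\<^sup>2)" "\<kappa> \<notin> Fix N" using a norm_Fix by (auto simp: \<kappa>_def mem_C0_iff)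
  have \<kappa>c [simp]: "\<kappa> \<in> carrier F" using \<kappa>(1) by (rule Fix_closed)
  have \<kappa>0 [simp]: "\<kappa> \<noteq> \<zero>" using \<kappa>(2) Fix_zero[OF ppower_N] by blast
  define A where "A = (\<lambda>(s, t). {g \<in> carrier F. \<kappa> \<otimes> (g \<otimes> \<theta> g) = s \<and> \<kappa> \<otimes> (g \<oplus> \<theta> g \<oplus> \<one>) = t})"
  define B where "B = (\<lambda>(s, t). {x \<in> Fix (N\<^sup>2). \<kappa> \<otimes> (x \<otimes> x \<oplus> x) \<oplus> s = t \<otimes> x})"
  let ?I = "Fix N \<times> Fix N"
  have finA: "finite (A st)" and finB: "finite (B st)" for st
    using finite_F by (auto simp: A_def B_def split: prod.split)
  have AB: "card (A st) + card (B st) \<le> 2" if st: "st \<in> ?I" for st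
  proof -
    obtain s t where e: "st = (s, t)" by fastforce
    have c [simp]: "s \<in> carrier F" "t \<in> carrier F" using st e Fix_closed by auto
    show ?thesis
    proof (cases "A st = {}")
      case True
      have "B st \<subseteq> {x, t \<otimes> inv \<kappa> \<ominus> \<one> \<ominus> x}" if x: "x \<in> B st" for x
      proof
        fix y assume y: "y \<in> B st"
        have xc: "x \<in> carrier F" and yc: "y \<in> carrier F" using x y e Fix_closed by (auto simp: B_def)
        have ex: "\<kappa> \<otimes> (x \<otimes> x \<oplus> x) \<oplus> s = t \<otimes> x" and ey: "\<kappa> \<otimes> (y \<otimes> y \<oplus> y) \<oplus> s = t \<otimes> y"
          using x y e by (auto simp: B_def)
        have "(x \<ominus> y) \<otimes> (\<kappa> \<otimes> (x \<oplus> y \<oplus> \<one>) \<ominus> t)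
            = (\<kappa> \<otimes> (x \<otimes> x \<oplus> x) \<oplus> s \<ominus> t \<otimes> x) \<ominus> (\<kappa> \<otimes> (y \<otimes> y \<oplus> y) \<oplus> s \<ominus> t \<otimes> y)"
          using xc yc c \<kappa>c by algebra
        also have "\<dots> = \<zero>" unfolding ex ey using xc yc by (simp add: a_minus_def r_neg)
        finally have "x \<ominus> y = \<zero> \<or> \<kappa> \<otimes> (x \<oplus> y \<oplus> \<one>) \<ominus> t = \<zero>"
          using xc yc by (simp add: integral_iff)
        then show "y \<in> {x, t \<otimes> inv \<kappa> \<ominus> \<one> \<ominus> x}"
        proof
          assume "x \<ominus> y = \<zero>"
          then show ?thesis using xc yc by simp
        next
          assume "\<kappa> \<otimes> (x \<oplus> y \<oplus> \<one>) \<ominus> t = \<zero>"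
          then have "\<kappa> \<otimes> (x \<oplus> y \<oplus> \<one>) = t" using xc yc by simp
          moreover have S: "x \<oplus> y \<oplus> \<one> \<in> carrier F" using xc yc by simp
          ultimately have "t = (x \<oplus> y \<oplus> \<one>) \<otimes> \<kappa>" using m_comm[OF \<kappa>c S] by simp
          then have t: "t \<otimes> inv \<kappa> = x \<oplus> y \<oplus> \<one>" using S by (simp add: m_assoc)
          have "y = (x \<oplus> y \<oplus> \<one>) \<ominus> \<one> \<ominus> x" using xc yc by algebra
          then show ?thesis unfolding t by simp
        qed
      qed
      then have "card (B st) \<le> 2"
      proof (cases "B st = {}")
        case False
        then obtain x where "x \<in> B st" by blast
        then have "card (B st) \<le> card {x, t \<otimes> inv \<kappa> \<ominus> \<one> \<ominus> x}"
          using \<open>\<And>x. x \<in> B st \<Longrightarrow> B st \<subseteq> {x, t \<otimes> inv \<kappa> \<ominus> \<one> \<ominus> x}\<close> by (intro card_mono) auto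
        also have "\<dots> \<le> 2" by (simp add: card_insert_if)
        finally show ?thesis .
      qed simp
      then show ?thesis using True by simp
    next
      case False
      then obtain g where g: "g \<in> carrier F" and s: "\<kappa> \<otimes> (g \<otimes> \<theta> g) = s"
        and t: "\<kappa> \<otimes> (g \<oplus> \<theta> g \<oplus> \<one>) = t" by (auto simp: A_def e)
      have root: "x = g \<or> x = \<theta> g" if x: "x \<in> carrier F" and eq: "\<kappa> \<otimes> (x \<otimes> x \<oplus> x) \<oplus> s = t \<otimes> x" for x
      proof -
        have "\<kappa> \<otimes> ((x \<ominus> g) \<otimes> (x \<ominus> \<theta> g)) = \<kappa> \<otimes> (x \<otimes> x \<oplus> x) \<oplus> s \<ominus> t \<otimes> x"
          using vieta[of \<kappa> x g "\<theta> g"] x g by (simp add: s t)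
        also have "\<dots> = \<zero>" unfolding eq using x by simp
        finally show ?thesis using x g by (auto simp: integral_iff)
      qed
      have rootA: "x = g \<or> x = \<theta> g" if x: "x \<in> A st" for x
      proof -
        have xc: "x \<in> carrier F" and "\<kappa> \<otimes> (x \<otimes> \<theta> x) = s" "\<kappa> \<otimes> (x \<oplus> \<theta> x \<oplus> \<one>) = t"
          using x by (auto simp: A_def e)
        then have "\<kappa> \<otimes> (x \<otimes> x \<oplus> x) \<oplus> s \<ominus> t \<otimes> x = \<kappa> \<otimes> ((x \<ominus> x) \<otimes> (x \<ominus> \<theta> x))"
          using vieta[of \<kappa> x x "\<theta> x"] by simp
        also have "\<dots> = \<zero>" using xc by (simp add: a_minus_def r_neg)
        finally have "\<kappa> \<otimes> (x \<otimes> x \<oplus> x) \<oplus> s = t \<otimes> x" using xc by simp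
        then show ?thesis by (rule root[OF xc])
      qed
      have rootB: "x = g \<or> x = \<theta> g" if x: "x \<in> B st" for x
        using x root Fix_closed by (auto simp: B_def e)
      \<comment> \<open>The roots are now \<open>g\<close> and \<open>\<theta> g\<close>. If they
        coincide, the single root is counted at most once in each of \<open>A st\<close> and
        \<open>B st\<close>; otherwise neither lies in the subfield, so \<open>B st\<close> is empty
        and \<open>A st\<close> has at most two elements.\<close>
      show ?thesis
      proof (cases "g \<in> Fix (N\<^sup>2)")
        case True
        then have "\<theta> g = g" by (rule theta_Fix)
        then have "A st \<subseteq> {g}" "B st \<subseteq> {g}" using rootA rootB by auto
        then have "card (A st) \<le> card {g}" "card (B st) \<le> card {g}" using card_mono[of "{g}" "A st"] card_mono[of "{g}" "B st"] by simp_all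
        then show ?thesis by simp
      next
        case False
        have "\<theta> g \<notin> Fix (N\<^sup>2)" using False theta_theta[OF g] by (auto simp: Fix_def)
        then have "B st = {}" using rootB False by (auto simp: B_def e)
        moreover have "A st \<subseteq> {g, \<theta> g}" using rootA by auto
        then have "card (A st) \<le> card {g, \<theta> g}" by (intro card_mono) auto
        moreover have "card {g, \<theta> g} \<le> 2" by (simp add: card_insert_if)
        ultimately show ?thesis by simp
      qed
    qed
  qed
  \<comment> \<open>Each of the \<open>N^2 - N\<close> elements \<open>x\<close> outside
    \<open>Fix N\<close> is a root for some \<open>(s, t)\<close>, as \<open>\<one>\<close> and
    \<open>x\<close> span the subfield over \<open>Fix N\<close>. The roots \<open>\<zero>\<close>
    (for \<open>s = \<zero>\<close>) and \<open>\<ominus> \<one>\<close> (for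
    \<open>s = \<ominus> t\<close>) occur once for each of the \<open>N\<close> values of
    \<open>t\<close>. Subtracting \<open>N^2 + N\<close> from the bound \<open>2\<close> per pair
    leaves \<open>N^2 - N\<close>.\<close>
  have sumB: "N\<^sup>2 + N \<le> (\<Sum>st\<in>?I. card (B st))"
  proof -
    have ex: "\<exists>st. st \<in> ?I \<and> x \<in> B st" if x: "x \<in> Fix (N\<^sup>2) - Fix N" for x
    proof -
      have xc [simp]: "x \<in> carrier F" using x Fix_closed by blast
      let ?f = "\<lambda>(s, t). t \<otimes> x \<ominus> s"
      have inj: "inj_on ?f ?I"
      proof (rule inj_onI, clarify)
        fix s t s' t' assume *: "s \<in> Fix N" "t \<in> Fix N" "s' \<in> Fix N" "t' \<in> Fix N"
          "t \<otimes> x \<ominus> s = t' \<otimes> x \<ominus> s'"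
        have [simp]: "s \<in> carrier F" "t \<in> carrier F" "s' \<in> carrier F" "t' \<in> carrier F"
          using * Fix_closed by auto
        have "(t \<ominus> t') \<otimes> x = (t \<otimes> x \<ominus> s) \<ominus> (t' \<otimes> x \<ominus> s') \<oplus> (s \<ominus> s')"
          using xc *(1-4)[THEN Fix_closed] by algebra
        then have e: "(t \<ominus> t') \<otimes> x = s \<ominus> s'" unfolding *(5) by simp
        have tt: "t \<ominus> t' = \<zero>"
        proof (rule ccontr)
          assume nz: "t \<ominus> t' \<noteq> \<zero>"
          have "x = inv (t \<ominus> t') \<otimes> ((t \<ominus> t') \<otimes> x)"
            using nz by (simp add: Units_l_inv field_Units flip: m_assoc)
          then have "x \<in> Fix N" unfolding e
            using * nz by (metis Fix_mult Fix_inv Fix_minus[OF ppower_N])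
          then show False using x by blast
        qed
        have "s \<ominus> s' = \<zero>" unfolding e[symmetric] tt by simp
        then show "s = s' \<and> t = t'" using tt by simp
      qed
      have sub: "?f ` ?I \<subseteq> Fix (N\<^sup>2)"
        using x Fix_N_subset by (auto intro!: Fix_minus[OF ppower_N2] Fix_mult)
      have "?f ` ?I = Fix (N\<^sup>2)"
        by (rule card_subset_eq[OF _ sub])
          (simp_all add: card_image[OF inj] card_cartesian_product card_Fix_N
            card_Fix_N2[unfolded power2_eq_square] power2_eq_square)
      moreover have "\<kappa> \<otimes> (x \<otimes> x \<oplus> x) \<in> Fix (N\<^sup>2)"
        using x \<kappa> by (intro Fix_mult Fix_add ppower_N2) auto
      ultimately have "\<kappa> \<otimes> (x \<otimes> x \<oplus> x) \<in> ?f ` ?I" by simp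
      then obtain s t where st: "s \<in> Fix N" "t \<in> Fix N" "\<kappa> \<otimes> (x \<otimes> x \<oplus> x) = t \<otimes> x \<ominus> s"
        by auto
      have "t \<otimes> x \<ominus> s \<oplus> s = t \<otimes> x" using xc st(1,2)[THEN Fix_closed] by algebra
      then have "x \<in> B (s, t)" using x st by (simp add: B_def)
      then show ?thesis using st by blast
    qed
    define c where "c = (\<lambda>x. SOME st. st \<in> ?I \<and> x \<in> B st)"
    have c: "c x \<in> ?I" "x \<in> B (c x)" if "x \<in> Fix (N\<^sup>2) - Fix N" for x
      using someI_ex[OF ex[OF that]] by (auto simp: c_def)
    let ?E = "SIGMA st:?I. B st"
    let ?E1 = "(\<lambda>x. (c x, x)) ` (Fix (N\<^sup>2) - Fix N)"
    let ?E2 = "(\<lambda>t. ((\<zero>, t), \<zero>)) ` Fix N"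
    let ?E3 = "(\<lambda>t. ((\<ominus> t, t), \<ominus> \<one>)) ` Fix N"
    have m1: "\<ominus> \<one> \<noteq> \<zero>" using minus_one_C0 by (auto simp: mem_C_iff)
    have mem0: "\<zero> \<in> Fix N" "\<ominus> \<one> \<in> Fix N" "\<zero> \<in> Fix (N\<^sup>2)" "\<ominus> \<one> \<in> Fix (N\<^sup>2)"
      using Fix_zero minus_one_Fix ppower_N ppower_N2 by auto
    have "?E1 \<subseteq> ?E" using c by (intro image_subsetI SigmaI)
    moreover have "?E2 \<subseteq> ?E" using mem0 Fix_closed by (auto simp: B_def)
    moreover have "?E3 \<subseteq> ?E"
    proof (rule image_subsetI, rule SigmaI)
      fix t assume t: "t \<in> Fix N"
      then show "(\<ominus> t, t) \<in> ?I" using Fix_uminus[OF ppower_N] by simp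
      have "\<kappa> \<otimes> (\<ominus> \<one> \<otimes> \<ominus> \<one> \<oplus> \<ominus> \<one>) \<oplus> \<ominus> t = t \<otimes> \<ominus> \<one>"
        using \<kappa>c t[THEN Fix_closed] by algebra
      then show "\<ominus> \<one> \<in> B (\<ominus> t, t)" using mem0 by (simp add: B_def)
    qed
    ultimately have "card (?E1 \<union> ?E2 \<union> ?E3) \<le> card ?E"
      using finB by (intro card_mono finite_SigmaI) auto
    moreover have "card (?E1 \<union> ?E2 \<union> ?E3) = card ?E1 + card ?E2 + card ?E3"
      using mem0 m1 by (subst card_Un_disjoint; auto)+
    moreover have "card ?E1 = N\<^sup>2 - N"
      using Fix_N_subset by (subst card_image) (auto simp: inj_on_def card_Diff_subset card_Fix_N card_Fix_N2)
    moreover have "card ?E2 = N" "card ?E3 = N"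
      by (subst card_image; auto simp: inj_on_def card_Fix_N)+
    moreover have "N \<le> N\<^sup>2" by (simp add: power2_eq_square)
    ultimately have "N\<^sup>2 + N \<le> card ?E" by linarith
    then show ?thesis using finB by (simp add: card_SigmaI)
  qed
  have "{g \<in> carrier F. a \<otimes> g \<in> C 0 \<and> a \<otimes> (g \<oplus> \<one>) \<in> C 0} \<subseteq> (\<Union>st\<in>?I. A st)"
  proof
    fix g assume "g \<in> {g \<in> carrier F. a \<otimes> g \<in> C 0 \<and> a \<otimes> (g \<oplus> \<one>) \<in> C 0}"
    then have g: "g \<in> carrier F" "a \<otimes> g \<in> C 0" "a \<otimes> (g \<oplus> \<one>) \<in> C 0" by auto
    have n: "(a \<otimes> h) \<otimes> \<theta> (a \<otimes> h) = \<kappa> \<otimes> (h \<otimes> \<theta> h)" if "h \<in> carrier F" for h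
      using that a by (simp add: nat_pow_distrib \<kappa>_def m_ac)
    have s: "\<kappa> \<otimes> (g \<otimes> \<theta> g) \<in> Fix N"
      using g(2) unfolding mem_C0_iff n[OF g(1)] by simp
    have "\<kappa> \<otimes> ((g \<oplus> \<one>) \<otimes> \<theta> (g \<oplus> \<one>)) \<in> Fix N"
      using g(3) n[of "g \<oplus> \<one>"] g(1) unfolding mem_C0_iff by simp
    \<comment> \<open>The difference of the two norm conditions is free of
      \<open>g \<otimes> \<theta> g\<close> and leaves the trace condition.\<close>
    then have "\<kappa> \<otimes> (g \<otimes> \<theta> g \<oplus> (g \<oplus> \<theta> g) \<oplus> \<one>) \<ominus> \<kappa> \<otimes> (g \<otimes> \<theta> g) \<in> Fix N"
      using s unfolding norm_add_one[OF g(1)] by (intro Fix_minus ppower_N)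
    also have "\<kappa> \<otimes> (g \<otimes> \<theta> g \<oplus> (g \<oplus> \<theta> g) \<oplus> \<one>) \<ominus> \<kappa> \<otimes> (g \<otimes> \<theta> g) = \<kappa> \<otimes> (g \<oplus> \<theta> g \<oplus> \<one>)"
      using g(1) theta_closed[OF g(1)] \<kappa>c by algebra
    finally show "g \<in> (\<Union>st\<in>?I. A st)" using s g(1) by (auto simp: A_def)
  qed
  then have "diff_count F (C 0) (C 0) a \<le> card (\<Union>st\<in>?I. A st)"
    unfolding diff_count_C0_eq[OF a(1,2)] using finA by (intro card_mono) auto
  also have "\<dots> \<le> (\<Sum>st\<in>?I. card (A st))" by (rule card_UN_le) simp
  finally have "diff_count F (C 0) (C 0) a + (N\<^sup>2 + N) \<le> (\<Sum>st\<in>?I. card (A st)) + (\<Sum>st\<in>?I. card (B st))"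
    using sumB by simp
  also have "\<dots> \<le> (\<Sum>st\<in>?I. 2)" unfolding sum.distrib[symmetric] using AB by (rule sum_mono)
  also have "\<dots> = 2 * N\<^sup>2" by (simp add: card_cartesian_product card_Fix_N power2_eq_square)
  finally show ?thesis by simp
qed


section \<open>Exact difference counts of all classes\<close>

lemma diff_count_C_zero: "diff_count F (C i) (C i) \<zero> = k"
  by (simp add: diff_count_zero[OF C_closed C_closed] card_C)

lemma card_rest: "card (carrier F - {\<zero>} - C 0) = N * k"
proof -
  have "card (carrier F - {\<zero>} - C 0) = card (carrier F - {\<zero>}) - card (C 0)"
    using finite_F C_closed[of 0] zero_notin_C[of 0] by (intro card_Diff_subset) (auto intro: finite_subset)
  also have "\<dots> = N * k" using card_F N4_eq by (simp add: card_C0)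
  finally show ?thesis .
qed

text \<open>The upper bound is attained everywhere because the counts sum up to \<open>k\<^sup>2\<close>.\<close>

lemma diff_count_C0:
  assumes "a \<in> carrier F" "a \<noteq> \<zero>" "a \<notin> C 0"
  shows "diff_count F (C 0) (C 0) a = N\<^sup>2 - N"
proof -
  let ?c = "diff_count F (C 0) (C 0)" and ?E = "carrier F - {\<zero>} - C 0"
  obtain M where M: "N = Suc (Suc M)" using N_ge_2 by (metis add_2_eq_Suc le_Suc_ex)
  have "(\<Sum>a\<in>carrier F. ?c a) = ?c \<zero> + (\<Sum>a\<in>C 0. ?c a) + (\<Sum>a\<in>?E. ?c a)"
  proof -
    have "(\<Sum>a\<in>carrier F. ?c a) = ?c \<zero> + (\<Sum>a\<in>carrier F - {\<zero>}. ?c a)"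
      using finite_F by (intro sum.remove) auto
    also have "(\<Sum>a\<in>carrier F - {\<zero>}. ?c a) = (\<Sum>a\<in>?E. ?c a) + (\<Sum>a\<in>C 0. ?c a)"
      using finite_F C_closed zero_notin_C by (intro sum.subset_diff) auto
    finally show ?thesis by simp
  qed
  then have "k * k = k + k * (N - 2) + (\<Sum>a\<in>?E. ?c a)"
    by (simp add: sum_diff_count_carrier[OF C_closed C_closed] card_C diff_count_C_zero diff_count_C0_in)
  moreover have "k * k = k + k * (N - 2) + (\<Sum>a\<in>?E. N\<^sup>2 - N)"
  proof -
    \<comment> \<open>Multiplied by \<open>k\<close>, this says that after the counts at
      \<open>\<zero>\<close> and on \<open>C 0\<close> the total leaves exactly the average
      \<open>N^2 - N\<close> for the \<open>N * k\<close> remaining elements.\<close>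
    have "k = 1 + (N - 2) + N * (N\<^sup>2 - N)"
      unfolding k_def unfolding M by (simp add: power2_eq_square algebra_simps)
    then have "k * k = k * (1 + (N - 2) + N * (N\<^sup>2 - N))" by simp
    then show ?thesis by (simp add: card_rest algebra_simps)
  qed
  ultimately have eq: "(\<Sum>a\<in>?E. ?c a) = (\<Sum>a\<in>?E. N\<^sup>2 - N)" by linarith
  show ?thesis
    by (rule sum_mono_inv[OF eq]) (use assms finite_F diff_count_C0_notin in auto)
qed

lemma diff_count_C_same:
  assumes "a \<in> carrier F" "a \<noteq> \<zero>"
  shows "diff_count F (C i) (C i) a = (if a \<in> C i then N - 2 else N\<^sup>2 - N)"
proof -
  obtain b where b: "b \<in> carrier F" "a = \<alpha> [^] i \<otimes> b" by (rule carrier_scale[OF assms(1)])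
  have "b \<noteq> \<zero>" using b assms by auto
  moreover have "a \<in> C i \<longleftrightarrow> b \<in> C 0" using b C_scale by simp
  ultimately show ?thesis
    using b diff_count_C0 diff_count_C0_in by (simp add: diff_count_scale)
qed

text \<open>First and second moments of the counts for two different classes follow from the counts for
  single classes, and they force the variance on each part of the field to vanish.\<close>

lemma diff_count_C_distinct:
  assumes ij: "i < N + 1" "j < N + 1" "i \<noteq> j" and a: "a \<in> carrier F" "a \<noteq> \<zero>"
  shows "diff_count F (C i) (C j) a = (if a \<in> C i \<union> C j then N\<^sup>2 - N else (N - 1)\<^sup>2)"
proof -
  define c where "c a = int (diff_count F (C i) (C j) a)" for a
  define E where "E = carrier F - {\<zero>} - (C i \<union> C j)"
  \<comment> \<open>\<open>V\<close> and \<open>W\<close> are the means dictated by the first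
    moments: \<open>V\<close> on each of the two classes, and on the rest
    \<open>(K^2 - 2 * K * V) / ((L - 1) * K) = L^2 + 1 - 2 * L\<close>. Integers are used so that
    deviations from the mean are true differences.\<close>
  define L K V W where "L = int N" and "K = int k" and "V = L\<^sup>2 - L" and "W = (L - 1)\<^sup>2"
  have L2: "int (N\<^sup>2 - N) = V" "int (N - 2) = L - 2" "int ((N - 1)\<^sup>2) = W"
    using N_ge_2 by (simp_all add: L_def V_def W_def of_nat_diff power2_eq_square)
  have "int (N - 1) = int N - 1" using N_ge_2 by simp
  then have K: "K = (L\<^sup>2 + 1) * (L - 1)"
    by (simp only: K_def k_def L_def of_nat_mult of_nat_add of_nat_power of_nat_1)
  have disj: "C i \<inter> C j = {}" using ij by (rule C_disjoint)
  have fin: "finite (C i)" "finite (C j)" "finite E"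
    using finite_subset[OF C_closed finite_F] finite_F by (auto simp: E_def)
  have split: "(\<Sum>a\<in>carrier F. h a) = h \<zero> + (\<Sum>a\<in>C i. h a) + (\<Sum>a\<in>C j. h a) + (\<Sum>a\<in>E. h a)"
    for h :: "'a \<Rightarrow> int"
  proof -
    have "(\<Sum>a\<in>carrier F. h a) = h \<zero> + (\<Sum>a\<in>carrier F - {\<zero>}. h a)"
      using finite_F by (intro sum.remove) auto
    also have "(\<Sum>a\<in>carrier F - {\<zero>}. h a) = (\<Sum>a\<in>E. h a) + (\<Sum>a\<in>C i \<union> C j. h a)"
      unfolding E_def using finite_F C_closed zero_notin_C by (intro sum.subset_diff) auto
    also have "(\<Sum>a\<in>C i \<union> C j. h a) = (\<Sum>a\<in>C i. h a) + (\<Sum>a\<in>C j. h a)"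
      using fin disj by (intro sum.union_disjoint)
    finally show ?thesis by simp
  qed
  have cardE: "int (card E) = (L - 1) * K"
  proof -
    have "int (card (carrier F)) = 1 + K + K + int (card E)"
      using split[of "\<lambda>_. 1"] by (simp add: card_C K_def)
    moreover have "int (card (carrier F)) = 1 + (L + 1) * K"
      using card_F N4_eq by (simp add: L_def K_def algebra_simps)
    ultimately show ?thesis by (simp add: algebra_simps)
  qed
  have c0: "c \<zero> = 0" using diff_count_zero[OF C_closed C_closed] disj by (simp add: c_def)
  have nz: "x \<in> carrier F" "x \<noteq> \<zero>" if "x \<in> C m" for x m using that by (auto simp: mem_C_iff)
  have ni: "x \<notin> C i" if "x \<in> C j" for x using that disj by blast
  have nj: "x \<notin> C j" if "x \<in> C i" for x using that disj by blast
  have Si: "(\<Sum>a\<in>C i. c a) = K * V"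
  proof -
    have "(\<Sum>a\<in>C i. diff_count F (C i) (C j) a) = (\<Sum>w\<in>C j. N\<^sup>2 - N)"
      unfolding sum_diff_count_left[OF C_closed C_closed]
      by (rule sum.cong) (use nz ni in \<open>auto simp: diff_count_C_same\<close>)
    then have "int (\<Sum>a\<in>C i. diff_count F (C i) (C j) a) = int (k * (N\<^sup>2 - N))" by (simp add: card_C)
    then show ?thesis by (simp add: c_def K_def L2)
  qed
  have Sj: "(\<Sum>a\<in>C j. c a) = K * V"
  proof -
    have "(\<Sum>a\<in>C j. diff_count F (C i) (C j) a) = (\<Sum>w\<in>C i. N\<^sup>2 - N)"
    proof -
      have "(\<Sum>a\<in>C j. diff_count F (C i) (C j) a) = (\<Sum>u\<in>C i. diff_count F (C j) (C j) u)"
        by (rule sum_diff_count_right[OF C_closed C_closed]) (rule C_uminus)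
      also have "\<dots> = (\<Sum>w\<in>C i. N\<^sup>2 - N)"
        by (rule sum.cong) (use nz nj in \<open>auto simp: diff_count_C_same\<close>)
      finally show ?thesis .
    qed
    then have "int (\<Sum>a\<in>C j. diff_count F (C i) (C j) a) = int (k * (N\<^sup>2 - N))" by (simp add: card_C)
    then show ?thesis by (simp add: c_def K_def L2)
  qed
  have SE: "(\<Sum>a\<in>E. c a) = K\<^sup>2 - 2 * K * V"
  proof -
    have "(\<Sum>a\<in>carrier F. c a) = int (k * k)"
      unfolding c_def of_nat_sum[symmetric] sum_diff_count_carrier[OF C_closed C_closed] card_C ..
    then show ?thesis using split[of c] c0 Si Sj by (simp add: K_def power2_eq_square algebra_simps)
  qed
  \<comment> \<open>At \<open>\<zero>\<close> both single-class counts are \<open>k\<close>; on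
    either of the two classes one of them is \<open>L - 2\<close> and the other is \<open>V\<close>;
    on \<open>E\<close> both are \<open>V\<close>.\<close>
  have S2: "(\<Sum>a\<in>C i. (c a)\<^sup>2) + (\<Sum>a\<in>C j. (c a)\<^sup>2) + (\<Sum>a\<in>E. (c a)\<^sup>2)
      = K\<^sup>2 + 2 * (K * ((L - 2) * V)) + (L - 1) * K * V\<^sup>2"
  proof -
    let ?h = "\<lambda>a. int (diff_count F (C i) (C i) a) * int (diff_count F (C j) (C j) a)"
    have "(\<Sum>a\<in>carrier F. (c a)\<^sup>2) = int (\<Sum>a\<in>carrier F. (diff_count F (C i) (C j) a)\<^sup>2)"
      by (simp add: c_def)
    also have "\<dots> = (\<Sum>a\<in>carrier F. ?h a)"
      unfolding sum_diff_count_square[OF C_closed C_closed] by simp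
    also have "\<dots> = ?h \<zero> + (\<Sum>a\<in>C i. ?h a) + (\<Sum>a\<in>C j. ?h a) + (\<Sum>a\<in>E. ?h a)" by (rule split)
    also have "?h \<zero> = K\<^sup>2" by (simp add: diff_count_C_zero K_def power2_eq_square)
    also have "(\<Sum>a\<in>C i. ?h a) = (\<Sum>a\<in>C i. (L - 2) * V)"
      by (rule sum.cong) (use nz nj in \<open>auto simp: diff_count_C_same L2\<close>)
    also have "(\<Sum>a\<in>C j. ?h a) = (\<Sum>a\<in>C j. (L - 2) * V)"
      by (rule sum.cong) (use nz ni in \<open>auto simp: diff_count_C_same L2\<close>)
    also have "(\<Sum>a\<in>E. ?h a) = (\<Sum>a\<in>E. V\<^sup>2)"
    proof (rule sum.cong)
      fix a assume "a \<in> E"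
      then have "diff_count F (C i) (C i) a = N\<^sup>2 - N" "diff_count F (C j) (C j) a = N\<^sup>2 - N"
        by (auto simp: diff_count_C_same E_def)
      then show "?h a = V\<^sup>2" by (simp only: L2 power2_eq_square[of V])
    qed simp
    finally show ?thesis
      unfolding split[of "\<lambda>a. (c a)\<^sup>2"] using c0 by (simp add: card_C cardE K_def)
  qed
  have "(\<Sum>a\<in>C i. (c a - V)\<^sup>2) + (\<Sum>a\<in>C j. (c a - V)\<^sup>2) + (\<Sum>a\<in>E. (c a - W)\<^sup>2)
      = (K\<^sup>2 + 2 * (K * ((L - 2) * V)) + (L - 1) * K * V\<^sup>2)
        - 2 * V * (K * V) - 2 * V * (K * V) - 2 * W * (K\<^sup>2 - 2 * K * V)
        + V\<^sup>2 * K + V\<^sup>2 * K + W\<^sup>2 * ((L - 1) * K)"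
    unfolding sum_square_deviation Si Sj SE card_C cardE S2[symmetric] K_def[symmetric] by simp
  \<comment> \<open>After inserting \<open>K = (L^2 + 1) * (L - 1)\<close> everything is a
    polynomial in \<open>L\<close>, and it vanishes identically.\<close>
  also have "\<dots> = 0"
    unfolding K V_def W_def by (simp add: algebra_simps power2_eq_square)
  finally have zero: "(\<Sum>a\<in>C i. (c a - V)\<^sup>2) + (\<Sum>a\<in>C j. (c a - V)\<^sup>2) + (\<Sum>a\<in>E. (c a - W)\<^sup>2) = 0" .
  have nonneg: "0 \<le> (\<Sum>a\<in>C i. (c a - V)\<^sup>2)" "0 \<le> (\<Sum>a\<in>C j. (c a - V)\<^sup>2)" "0 \<le> (\<Sum>a\<in>E. (c a - W)\<^sup>2)"
    by (simp_all add: sum_nonneg)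
  have "(\<Sum>a\<in>C i. (c a - V)\<^sup>2) = 0" "(\<Sum>a\<in>C j. (c a - V)\<^sup>2) = 0" "(\<Sum>a\<in>E. (c a - W)\<^sup>2) = 0"
    using zero nonneg by linarith+
  then have "\<forall>a\<in>C i. c a = V" "\<forall>a\<in>C j. c a = V" "\<forall>a\<in>E. c a = W"
    using fin by (simp_all add: sum_nonneg_eq_0_iff)
  moreover have "a \<in> E" if "a \<notin> C i \<union> C j" using that a by (simp add: E_def)
  ultimately have "c a = int (if a \<in> C i \<union> C j then N\<^sup>2 - N else (N - 1)\<^sup>2)"
    using L2 by auto
  then show ?thesis by (simp add: c_def)
qed

text \<open>The number is \<open>(N - 2) * (2 * N - 1)\<close>, which for \<open>N \<ge> 3\<close>
  is larger than \<open>N - 2\<close> and smaller than \<open>k\<close>. Equality with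
  \<open>N^2 - N\<close> or \<open>(N - 1)^2\<close> would mean \<open>N^2 - 4 * N + 2 = 0\<close>
  or \<open>N^2 - 3 * N + 1 = 0\<close>, and neither has an integer solution.\<close>

lemma intersection_number_neq:
  assumes "N \<ge> 3" "i < N + 1" "j < N + 1" "g \<in> carrier F" "h \<in> carrier F"
  shows "card ((C i +> g) \<inter> (C j +> h)) \<noteq> (N - 1) * (N - 2) + (N\<^sup>2 - 2 * N)"
proof -
  obtain M where M: "N = M + 3" using assms(1) by (metis add.commute le_Suc_ex)
  let ?d = "h \<ominus> g"
  have d: "?d \<in> carrier F" using assms by simp
  have "diff_count F (C i) (C j) ?d \<in> {0, k, N - 2, N\<^sup>2 - N, (N - 1)\<^sup>2}"
  proof (cases "?d = \<zero>")
    case True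
    then show ?thesis
      using C_disjoint[OF assms(2,3)] by (cases "i = j") (auto simp: diff_count_zero[OF C_closed C_closed] card_C)
  next
    case False
    then show ?thesis
      using d diff_count_C_same[of ?d i] diff_count_C_distinct[OF assms(2,3) _ d] by (cases "i = j") auto
  qed
  moreover have "(N - 1) * (N - 2) + (N\<^sup>2 - 2 * N) \<notin> {0, k, N - 2, N\<^sup>2 - N, (N - 1)\<^sup>2}"
  proof -
    define t where "t = (N - 1) * (N - 2) + (N\<^sup>2 - 2 * N)"
    have t: "t = 2 * (M * M) + 7 * M + 5"
      unfolding t_def unfolding M by (simp add: power2_eq_square algebra_simps)
    have k: "k = M * (M * M) + 8 * (M * M) + 22 * M + 20"
      unfolding k_def unfolding M by (simp add: power2_eq_square algebra_simps)
    have e: "N\<^sup>2 - N = M * M + 5 * M + 6" "(N - 1)\<^sup>2 = M * M + 4 * M + 4" "N - 2 = M + 1"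
      unfolding M by (simp_all add: power2_eq_square algebra_simps)
    have "t \<noteq> M * M + 5 * M + 6"
      unfolding t by (cases M) (simp_all add: algebra_simps)
    moreover have "t < M * (M * M) + 8 * (M * M) + 22 * M + 20" unfolding t by simp
    moreover have "t \<noteq> 0" "t \<noteq> M * M + 4 * M + 4" "t \<noteq> M + 1" unfolding t by auto
    ultimately have "t \<notin> {0, k, N - 2, N\<^sup>2 - N, (N - 1)\<^sup>2}" unfolding e k by auto
    then show ?thesis unfolding t_def .
  qed
  ultimately show ?thesis
    by (metis card_coset_Int[OF C_closed C_closed assms(4,5)])
qed

subsection \<open>Triples contained in no block, for \<open>N = 2\<close>\<close>

lemma mem_C_coset:
  assumes "x \<in> carrier F" "h \<in> carrier F"
  shows "x \<in> C i +> h \<longleftrightarrow> x \<ominus> h \<in> C i"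
proof
  assume "x \<in> C i +> h"
  then obtain u where u: "u \<in> C i" "x = u \<oplus> h" unfolding a_coset_conv by blast
  then have "u \<in> carrier F" using C_closed by blast
  then have "x \<ominus> h = u" using u assms by (simp add: minus_eq_iff)
  then show "x \<ominus> h \<in> C i" using u by simp
next
  assume "x \<ominus> h \<in> C i"
  moreover have "x = (x \<ominus> h) \<oplus> h" using assms minus_eq_iff[of x h "x \<ominus> h"] by simp
  ultimately show "x \<in> C i +> h" unfolding a_coset_conv by blast
qed

lemma ex_C:
  assumes "x \<in> carrier F" "x \<noteq> \<zero>"
  shows "\<exists>i<N + 1. x \<in> C i"
proof -
  obtain t :: nat where t: "x = \<alpha> [^] t" using ex_alpha_pow[OF assms] by metis
  have "x \<in> C (t mod (N + 1))" unfolding C_def cyclotomic_class_def t by (auto simp: cong_def)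
  moreover have "t mod (N + 1) < N + 1" by simp
  ultimately show ?thesis by blast
qed

lemma pow_nonzero: "x \<in> carrier F \<Longrightarrow> x \<noteq> \<zero> \<Longrightarrow> x [^] (m :: nat) \<noteq> \<zero>"
  by (induction m) (auto simp: integral_iff)

definition covered :: "'a \<Rightarrow> 'a \<Rightarrow> 'a \<Rightarrow> bool" where
  "covered x y z \<longleftrightarrow> (\<exists>i<N + 1. \<exists>h\<in>carrier F. {x, y, z} \<subseteq> C i +> h)"

text \<open>At \<open>N = 2\<close> the factor \<open>N - 1\<close> of \<open>k\<close> is one, so a
  class is a fibre of the norm itself and not just of the norm up to scalars. Covering a triple
  becomes an equality of three norms.\<close>

lemma pow_k_eq_norm:
  assumes "N = 2" "x \<in> carrier F"
  shows "x [^] k = x \<otimes> \<theta> x"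
proof -
  have "k = Suc (N\<^sup>2)" unfolding k_def using assms(1) by simp
  then show ?thesis using assms(2) by (simp add: m_comm)
qed

lemma norm_add:
  assumes "g \<in> carrier F" "c \<in> carrier F"
  shows "(g \<oplus> c) \<otimes> \<theta> (g \<oplus> c) = g \<otimes> \<theta> g \<oplus> (g \<otimes> \<theta> c \<oplus> c \<otimes> \<theta> g \<oplus> c \<otimes> \<theta> c)"
proof -
  have "(g \<oplus> c) \<otimes> (\<theta> g \<oplus> \<theta> c) = g \<otimes> \<theta> g \<oplus> (g \<otimes> \<theta> c \<oplus> c \<otimes> \<theta> g \<oplus> c \<otimes> \<theta> c)"
    using assms theta_closed[OF assms(1)] theta_closed[OF assms(2)] by algebra
  then show ?thesis using assms by (simp add: frob_add[OF ppower_N2])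
qed

lemma norm_mult:
  assumes "x \<in> carrier F" "y \<in> carrier F"
  shows "(x \<otimes> y) \<otimes> \<theta> (x \<otimes> y) = (x \<otimes> \<theta> x) \<otimes> (y \<otimes> \<theta> y)"
  using assms by (simp add: nat_pow_distrib m_ac)

lemma add_eq_self_iff: "x \<in> carrier F \<Longrightarrow> y \<in> carrier F \<Longrightarrow> x \<oplus> y = x \<longleftrightarrow> y = \<zero>"
  by (metis a_comm l_zero add.r_cancel zero_closed)

text \<open>Relative to \<open>h\<close>, the three points are \<open>d\<close> times
  \<open>g\<close>, \<open>g \<oplus> \<one>\<close> and \<open>g \<oplus> c\<close>. Equal norms at
  the first two force the trace of \<open>g\<close> to be \<open>\<ominus> \<one>\<close>. As
  \<open>c\<close> is its own conjugate, equal norms at the first and third force the trace to be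
  \<open>\<ominus> c\<close>.\<close>

lemma not_covered_if_Fix:
  assumes N: "N = 2" and c: "c \<in> Fix (N\<^sup>2)" "c \<noteq> \<zero>" "c \<noteq> \<one>"
    and x: "x \<in> carrier F" and d: "d \<in> carrier F" "d \<noteq> \<zero>"
  shows "\<not> covered x (x \<oplus> d) (x \<oplus> c \<otimes> d)"
proof
  assume "covered x (x \<oplus> d) (x \<oplus> c \<otimes> d)"
  then obtain i h where h: "h \<in> carrier F" "{x, x \<oplus> d, x \<oplus> c \<otimes> d} \<subseteq> C i +> h"
    unfolding covered_def by blast
  have cc [simp]: "c \<in> carrier F" using c Fix_closed by blast
  have \<theta>c: "\<theta> c = c" using c(1) by (rule theta_Fix)
  let ?g = "(x \<ominus> h) \<otimes> inv d"
  have g [simp]: "?g \<in> carrier F" using x h d by simp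
  have dd: "d \<otimes> inv d = \<one>" using d by simp
  have "d \<otimes> ?g = (x \<ominus> h) \<otimes> (d \<otimes> inv d)" using x h d inv_nonzero(1)[OF d] by algebra
  then have e0: "x \<ominus> h = d \<otimes> ?g" using x h unfolding dd by simp
  have e1: "(x \<oplus> d) \<ominus> h = d \<otimes> (?g \<oplus> \<one>)"
  proof -
    have "(x \<oplus> d) \<ominus> h = (x \<ominus> h) \<oplus> d" using x h d by algebra
    also have "\<dots> = d \<otimes> (?g \<oplus> \<one>)" unfolding e0[symmetric] using d g e0 by (simp add: r_distr)
    finally show ?thesis .
  qed
  have e2: "(x \<oplus> c \<otimes> d) \<ominus> h = d \<otimes> (?g \<oplus> c)"
  proof -
    have "(x \<oplus> c \<otimes> d) \<ominus> h = (x \<ominus> h) \<oplus> c \<otimes> d" using x h(1) d cc by algebra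
    also have "\<dots> = d \<otimes> (?g \<oplus> c)" using d g e0 by (simp add: r_distr m_comm)
    finally show ?thesis .
  qed
  have mem: "d \<otimes> ?g \<in> C i" "d \<otimes> (?g \<oplus> \<one>) \<in> C i" "d \<otimes> (?g \<oplus> c) \<in> C i"
    using h x d unfolding e0[symmetric] e1[symmetric] e2[symmetric] by (simp_all add: mem_C_coset)
  define \<nu> where "\<nu> y = y \<otimes> \<theta> y" for y
  have \<nu>d: "\<nu> d \<in> carrier F" "\<nu> d \<noteq> \<zero>"
    using d pow_nonzero[of d] by (auto simp: \<nu>_def integral_iff)
  have \<nu>: "\<nu> d \<otimes> \<nu> y = \<alpha> [^] (i * k)" if "y \<in> carrier F" "d \<otimes> y \<in> C i" for y
    using that d pow_k_eq_norm[OF N, of "d \<otimes> y"] norm_mult[of d y] by (simp add: mem_C_iff \<nu>_def)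
  have eq: "\<nu> (?g \<oplus> \<one>) = \<nu> ?g" "\<nu> (?g \<oplus> c) = \<nu> ?g"
  proof -
    have "\<nu> d \<otimes> \<nu> (?g \<oplus> \<one>) = \<nu> d \<otimes> \<nu> ?g" "\<nu> d \<otimes> \<nu> (?g \<oplus> c) = \<nu> d \<otimes> \<nu> ?g"
      using \<nu> mem g by simp_all
    then show "\<nu> (?g \<oplus> \<one>) = \<nu> ?g" "\<nu> (?g \<oplus> c) = \<nu> ?g"
      using \<nu>d g by (simp_all add: m_lcancel \<nu>_def)
  qed
  let ?t = "?g \<oplus> \<theta> ?g"
  have tc: "?t \<in> carrier F" "\<theta> ?g \<in> carrier F" by simp_all
  have t1: "?t \<oplus> \<one> = \<zero>"
    using eq(1) norm_add[OF g one_closed] add_eq_self_iff[of "\<nu> ?g" "?t \<oplus> \<one>"] by (simp add: \<nu>_def)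
  have "?g \<otimes> c \<oplus> c \<otimes> \<theta> ?g \<oplus> c \<otimes> c = c \<otimes> (?t \<oplus> c)" using g tc cc by algebra
  then have "c \<otimes> (?t \<oplus> c) = \<zero>"
    using eq(2) norm_add[OF g cc] add_eq_self_iff[of "\<nu> ?g" "c \<otimes> (?t \<oplus> c)"] by (simp add: \<nu>_def \<theta>c)
  then have "?t \<oplus> c = \<zero>" using c(2) tc by (simp add: integral_iff)
  then have "?t \<oplus> c = ?t \<oplus> \<one>" using t1 by simp
  then have "c = \<one>" using tc by simp
  then show False using c(3) by simp
qed

text \<open>Equal norms at \<open>g\<close>, \<open>g \<oplus> \<one>\<close> and
  \<open>g \<oplus> c\<close> amount to a linear system in \<open>g\<close> and its conjugate. Up to
  sign its determinant is \<open>\<theta> c \<ominus> c\<close>, which is nonzero exactly when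
  \<open>c\<close> is outside the subfield.\<close>

lemma covered_if_not_Fix:
  assumes N: "N = 2" and c: "c \<in> carrier F" "c \<notin> Fix (N\<^sup>2)"
    and x: "x \<in> carrier F" and d: "d \<in> carrier F" "d \<noteq> \<zero>"
  shows "covered x (x \<oplus> d) (x \<oplus> c \<otimes> d)"
proof -
  let ?e = "\<theta> c \<ominus> c"
  have \<theta>c: "\<theta> c \<in> carrier F" using c by simp
  have e: "?e \<in> carrier F" "?e \<noteq> \<zero>" using c \<theta>c by (auto simp: Fix_def)
  define i where "i = inv ?e"
  have i: "i \<in> carrier F" "?e \<otimes> i = \<one>" using e by (simp_all add: i_def)
  have \<theta>i: "\<theta> i = \<ominus> i"
  proof -
    have "\<theta> ?e = \<ominus> ?e"
    proof -
      have "\<theta> ?e = c \<ominus> \<theta> c" using c \<theta>c by (simp add: frob_minus[OF ppower_N2] theta_theta)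
      also have "\<dots> = \<ominus> ?e" using c(1) \<theta>c by algebra
      finally show ?thesis .
    qed
    moreover have "\<theta> ?e \<otimes> \<theta> i = \<one>" using i e by (simp flip: nat_pow_distrib)
    ultimately have "(\<ominus> ?e) \<otimes> \<theta> i = \<one>" by simp
    moreover have "(\<ominus> ?e) \<otimes> (\<ominus> i) = ?e \<otimes> i" using e(1) i(1) by algebra
    ultimately have "(\<ominus> ?e) \<otimes> \<theta> i = (\<ominus> ?e) \<otimes> (\<ominus> i)" using i(2) by simp
    moreover have "\<ominus> ?e \<noteq> \<zero>"
    proof
      assume "\<ominus> ?e = \<zero>"
      then have "\<ominus> (\<ominus> ?e) = \<zero>" by simp
      then show False using e by simp
    qed
    ultimately show ?thesis using e(1) i(1) by (subst (asm) m_lcancel) simp_all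
  qed
  \<comment> \<open>Cramer's rule for the equations \<open>t\<close> and \<open>s\<close> below.
    Since conjugation negates \<open>?e\<close>, the second unknown of the solution is indeed the
    conjugate of the first.\<close>
  define g where "g = (c \<ominus> c \<otimes> \<theta> c) \<otimes> i"
  have gc: "g \<in> carrier F" using c(1) \<theta>c i by (simp add: g_def)
  have \<theta>g: "\<theta> g = (\<theta> c \<ominus> c \<otimes> \<theta> c) \<otimes> (\<ominus> i)"
    using c(1) \<theta>c i(1) unfolding g_def
    by (simp add: nat_pow_distrib frob_minus[OF ppower_N2] theta_theta \<theta>i m_comm)
  have t: "g \<oplus> \<theta> g \<oplus> \<one> = \<zero>"
  proof -
    have "g \<oplus> \<theta> g = \<ominus> (?e \<otimes> i)" unfolding \<theta>g unfolding g_def using c(1) \<theta>c i(1) by algebra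
    then show ?thesis by (simp add: i l_neg)
  qed
  have s: "g \<otimes> \<theta> c \<oplus> c \<otimes> \<theta> g \<oplus> c \<otimes> \<theta> c = \<zero>"
  proof -
    have "g \<otimes> \<theta> c \<oplus> c \<otimes> \<theta> g = \<ominus> (c \<otimes> \<theta> c \<otimes> (?e \<otimes> i))"
      unfolding \<theta>g unfolding g_def using c(1) \<theta>c i(1) by algebra
    then show ?thesis using c(1) \<theta>c by (simp add: i l_neg)
  qed
  \<comment> \<open>With \<open>g\<close> zero, the trace equation would read
    \<open>\<one> = \<zero>\<close>. A nonzero \<open>g\<close> is what places
    \<open>d \<otimes> g\<close> in a class.\<close>
  have g0: "g \<noteq> \<zero>" using t N by (auto simp: nat_pow_zero)
  have n1: "(g \<oplus> \<one>) \<otimes> \<theta> (g \<oplus> \<one>) = g \<otimes> \<theta> g"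
    using norm_add[OF gc one_closed] t gc by simp
  have nc: "(g \<oplus> c) \<otimes> \<theta> (g \<oplus> c) = g \<otimes> \<theta> g"
    using norm_add[OF gc c(1)] s gc by simp
  have dg: "d \<otimes> g \<in> carrier F" "d \<otimes> g \<noteq> \<zero>" using d gc g0 by (simp_all add: integral_iff)
  obtain j where j: "j < N + 1" "d \<otimes> g \<in> C j" using ex_C[OF dg] by blast
  have nz: "g \<otimes> \<theta> g \<noteq> \<zero>" using gc g0 pow_nonzero[OF gc] by (simp add: integral_iff)
  have mem: "d \<otimes> y \<in> C j" if y: "y \<in> carrier F" "y \<otimes> \<theta> y = g \<otimes> \<theta> g" for y
  proof -
    have "y \<noteq> \<zero>" using y(2) nz by auto
    moreover have "(d \<otimes> y) [^] k = (d \<otimes> g) [^] k"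
      using y d gc pow_k_eq_norm[OF N] norm_mult by simp
    ultimately show ?thesis using j(2) y d by (simp add: mem_C_iff integral_iff)
  qed
  let ?h = "x \<ominus> d \<otimes> g"
  have h: "?h \<in> carrier F" using x dg by simp
  have "x \<ominus> ?h = d \<otimes> g" using x dg by (simp add: minus_minus_cancel)
  moreover have "(x \<oplus> d) \<ominus> ?h = d \<otimes> (g \<oplus> \<one>)" using x d(1) gc by algebra
  moreover have "(x \<oplus> c \<otimes> d) \<ominus> ?h = d \<otimes> (g \<oplus> c)" using x d(1) gc c(1) by algebra
  ultimately have "{x, x \<oplus> d, x \<oplus> c \<otimes> d} \<subseteq> C j +> ?h"
    using j(2) mem[OF _ n1] mem[OF _ nc] gc c(1) x d h by (simp add: mem_C_coset)
  then show ?thesis unfolding covered_def using j(1) h by blast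
qed

text \<open>A triple is in no block if and only if it is contained in a line of the affine plane over the
  subfield with four elements.\<close>

lemma not_covered_trans:
  assumes N: "N = 2" and xyzw: "x \<in> carrier F" "y \<in> carrier F" "z \<in> carrier F" "w \<in> carrier F"
    and dist: "x \<noteq> y" "x \<noteq> z" "x \<noteq> w" "z \<noteq> w"
    and "\<not> covered x y z" "\<not> covered x y w"
  shows "\<not> covered x z w"
proof -
  define d where "d = y \<ominus> x"
  have d: "d \<in> carrier F" "d \<noteq> \<zero>" using xyzw dist by (auto simp: d_def)
  have rep: "\<exists>c. c \<in> carrier F \<and> u = x \<oplus> c \<otimes> d" if "u \<in> carrier F" for u
  proof -
    have "((u \<ominus> x) \<otimes> inv d) \<otimes> d = (u \<ominus> x) \<otimes> (d \<otimes> inv d)"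
      using that xyzw(1) d inv_nonzero(1)[OF d] by algebra
    moreover have "u = x \<oplus> (u \<ominus> x)" using that xyzw(1) by algebra
    ultimately have "u = x \<oplus> ((u \<ominus> x) \<otimes> inv d) \<otimes> d"
      using that xyzw(1) d by simp
    then show ?thesis using that xyzw(1) d by (intro exI[of _ "(u \<ominus> x) \<otimes> inv d"]) simp
  qed
  have y: "y = x \<oplus> d" using xyzw minus_eq_iff[of y x d] d by (simp add: d_def a_comm)
  obtain c where c: "c \<in> carrier F" "z = x \<oplus> c \<otimes> d" using rep xyzw by blast
  obtain c' where c': "c' \<in> carrier F" "w = x \<oplus> c' \<otimes> d" using rep xyzw by blast
  have Fix: "c \<in> Fix (N\<^sup>2)" "c' \<in> Fix (N\<^sup>2)"
    using covered_if_not_Fix[OF N c(1) _ xyzw(1) d] covered_if_not_Fix[OF N c'(1) _ xyzw(1) d] assms(10,11)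
    unfolding c(2) c'(2) y by blast+
  have n0: "c \<noteq> \<zero>" "c' \<noteq> \<zero>" using dist c c' d xyzw by auto
  have ne: "c \<noteq> c'" using dist c c' by auto
  \<comment> \<open>The coordinate of \<open>w\<close> seen from \<open>x\<close> in direction
    \<open>z \<ominus> x\<close>; the subfield is closed under quotients, so it lies there
    too.\<close>
  let ?q = "c' \<otimes> inv c"
  have "?q \<otimes> (c \<otimes> d) = c' \<otimes> (c \<otimes> inv c) \<otimes> d" using c(1) c'(1) d n0 inv_nonzero(1)[OF c(1) n0(1)] by algebra
  then have w: "w = x \<oplus> ?q \<otimes> (c \<otimes> d)" using c c' d n0 by simp
  have "?q \<in> Fix (N\<^sup>2)" using Fix n0 by (intro Fix_mult Fix_inv)
  moreover have "?q \<noteq> \<zero>"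
  proof -
    have "inv c \<noteq> \<zero>" using inv_nonzero(2)[OF c(1) n0(1)] c(1) by auto
    then show ?thesis using n0 c(1) c'(1) by (simp add: integral_iff)
  qed
  moreover have "?q \<noteq> \<one>"
  proof
    assume q: "?q = \<one>"
    have "c' = ?q \<otimes> c" using c(1) c'(1) n0 by (simp add: m_assoc m_comm[of "inv c" c])
    then show False using q ne c(1) by simp
  qed
  ultimately have "\<not> covered x (x \<oplus> c \<otimes> d) (x \<oplus> ?q \<otimes> (c \<otimes> d))"
    using n0 c(1) d by (intro not_covered_if_Fix[OF N]) (auto simp: integral_iff xyzw)
  then show ?thesis unfolding c(2) w[symmetric] .
qed

end

section \<open>Rings in which \<open>p\<close> generates a square-zero ideal with quotient of order \<open>N\<^sup>2\<close>\<close>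

text \<open>Beyond commutativity, the Galois ring enters only through two cardinalities, the
  relation \<open>p_square\<close> and the unit \<xi>. That the ring is local with residue field of
  order N^2 is derived from these by counting.\<close>

locale momihara_ring = cring R for R (structure) +
  fixes p n N :: nat and \<xi>
  assumes prime_p: "Factorial_Ring.prime p" and n_pos: "n \<ge> 1" and N_eq: "N = p ^ n"
    and finite_R: "finite (carrier R)" and card_R: "card (carrier R) = N ^ 4"
    and card_multiples: "card (multiples R p (carrier R)) = N\<^sup>2"
    and p_square: "[p] \<cdot> ([p] \<cdot> \<one>) = \<zero>"
    and xi_Units: "\<xi> \<in> Units R" and ord_xi: "group.ord (units_of R) \<xi> = N\<^sup>2 - 1"
begin

sublocale finite_abelian_group R
  by unfold_locales (rule finite_R)

definition \<pi> where "\<pi> = [p] \<cdot> \<one>"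

definition I where "I = {\<pi> \<otimes> x | x. x \<in> carrier R}"

definition cg :: "'a \<Rightarrow> 'a \<Rightarrow> bool" (infix "\<approx>\<^sub>p" 50) where "x \<approx>\<^sub>p y \<longleftrightarrow> x \<ominus> y \<in> I"

section \<open>The square-zero ideal generated by p\<close>

lemma pi_closed [simp]: "\<pi> \<in> carrier R"
  by (simp add: \<pi>_def)

lemma add_pow_p: "x \<in> carrier R \<Longrightarrow> [p] \<cdot> x = \<pi> \<otimes> x"
  by (simp add: \<pi>_def add_pow_ldistr)

lemma pi_pi: "\<pi> \<otimes> \<pi> = \<zero>"
  using p_square by (simp add: add_pow_p \<pi>_def[symmetric])

lemma pi_pi_left [simp]: "x \<in> carrier R \<Longrightarrow> \<pi> \<otimes> (\<pi> \<otimes> x) = \<zero>"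
  by (simp add: pi_pi flip: m_assoc)

lemma multiples_eq_I: "multiples R p (carrier R) = I"
  unfolding multiples_def I_def using add_pow_p by metis

lemma card_I: "card I = N\<^sup>2"
  using card_multiples by (simp add: multiples_eq_I)

lemma N_ge_2: "N \<ge> 2"
proof -
  have "p \<le> p ^ n" using n_pos prime_gt_0_nat[OF prime_p] by (simp add: self_le_power)
  then show ?thesis using prime_ge_2_nat[OF prime_p] N_eq by linarith
qed

lemma I_closed: "y \<in> I \<Longrightarrow> y \<in> carrier R"
  by (auto simp: I_def)

lemma I_subset: "I \<subseteq> carrier R"
  using I_closed by blast

lemma piI [intro]: "x \<in> carrier R \<Longrightarrow> \<pi> \<otimes> x \<in> I"
  by (auto simp: I_def)

lemma zero_I [simp]: "\<zero> \<in> I"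
  using piI[of \<zero>] by simp

lemma I_E:
  assumes "y \<in> I"
  obtains x where "x \<in> carrier R" "y = \<pi> \<otimes> x"
  using assms unfolding I_def by blast

lemma I_add:
  assumes "x \<in> I" "y \<in> I"
  shows "x \<oplus> y \<in> I"
proof -
  obtain a b where "a \<in> carrier R" "b \<in> carrier R" "x = \<pi> \<otimes> a" "y = \<pi> \<otimes> b"
    using assms by (metis I_E)
  then show ?thesis using r_distr[of a b \<pi>] piI[of "a \<oplus> b"] by simp
qed

lemma I_mult:
  assumes "a \<in> carrier R" "y \<in> I"
  shows "a \<otimes> y \<in> I"
proof -
  obtain b where "b \<in> carrier R" "y = \<pi> \<otimes> b"
    using assms by (metis I_E)
  then show ?thesis using m_lcomm[of a \<pi> b] piI[of "a \<otimes> b"] assms by simp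
qed

lemma I_uminus: "x \<in> I \<Longrightarrow> \<ominus> x \<in> I"
  using I_mult[of "\<ominus> \<one>" x] I_closed[of x] by (simp add: l_minus)

lemma I_minus: "x \<in> I \<Longrightarrow> y \<in> I \<Longrightarrow> x \<ominus> y \<in> I"
  by (simp add: a_minus_def I_add I_uminus)

lemma I_mult2: "a \<in> carrier R \<Longrightarrow> y \<in> I \<Longrightarrow> y \<otimes> a \<in> I"
  using I_mult[of a y] I_closed[of y] by (simp add: m_comm)

lemma pi_I:
  assumes "y \<in> I"
  shows "\<pi> \<otimes> y = \<zero>"
proof -
  obtain b where "b \<in> carrier R" "y = \<pi> \<otimes> b" using assms by (rule I_E)
  then show ?thesis by simp
qed

lemma I_I:
  assumes "x \<in> I" "y \<in> I"
  shows "x \<otimes> y = \<zero>"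
proof -
  obtain a where a: "a \<in> carrier R" "x = \<pi> \<otimes> a" using assms(1) by (rule I_E)
  have y: "y \<in> carrier R" using assms(2) by (rule I_closed)
  have "x \<otimes> y = a \<otimes> (\<pi> \<otimes> y)" using a y m_lcomm[of \<pi> a y] by (simp add: m_assoc)
  then show ?thesis using assms(2) a by (simp add: pi_I)
qed

lemma one_notin_I: "\<one> \<notin> I"
proof
  assume "\<one> \<in> I"
  then have "\<one> = \<zero>" using I_I[of \<one> \<one>] by simp
  then have "carrier R = {\<zero>}" by (metis one_zeroD)
  then have "N ^ 4 = 1" using card_R by simp
  then show False using N_ge_2 by simp
qed

lemma Units_notin_I:
  assumes "x \<in> Units R"
  shows "x \<notin> I"
proof
  assume "x \<in> I"
  then have "inv x \<otimes> x \<in> I" using assms by (intro I_mult) simp_all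
  then show False using assms one_notin_I by simp
qed

section \<open>Congruence modulo p\<close>

lemma cg_refl [simp]: "x \<in> carrier R \<Longrightarrow> x \<approx>\<^sub>p x"
  by (simp add: cg_def a_minus_def r_neg)

lemma cg_sym: "x \<approx>\<^sub>p y \<Longrightarrow> x \<in> carrier R \<Longrightarrow> y \<in> carrier R \<Longrightarrow> y \<approx>\<^sub>p x"
  unfolding cg_def using I_uminus[of "x \<ominus> y"] by (simp add: a_minus_def minus_add a_comm)

lemma cg_trans:
  assumes "x \<approx>\<^sub>p y" "y \<approx>\<^sub>p z" "x \<in> carrier R" "y \<in> carrier R" "z \<in> carrier R"
  shows "x \<approx>\<^sub>p z"
proof -
  have "x \<ominus> z = (x \<ominus> y) \<oplus> (y \<ominus> z)" using assms(3-5) by algebra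
  then show ?thesis using assms I_add by (simp add: cg_def)
qed

lemma cg_add:
  assumes "x \<approx>\<^sub>p y" "x' \<approx>\<^sub>p y'" "x \<in> carrier R" "y \<in> carrier R" "x' \<in> carrier R" "y' \<in> carrier R"
  shows "x \<oplus> x' \<approx>\<^sub>p y \<oplus> y'"
proof -
  have "(x \<oplus> x') \<ominus> (y \<oplus> y') = (x \<ominus> y) \<oplus> (x' \<ominus> y')" using assms(3-6) by algebra
  then show ?thesis using assms I_add by (simp add: cg_def)
qed

lemma cg_mult:
  assumes "x \<approx>\<^sub>p y" "x' \<approx>\<^sub>p y'" "x \<in> carrier R" "y \<in> carrier R" "x' \<in> carrier R" "y' \<in> carrier R"
  shows "x \<otimes> x' \<approx>\<^sub>p y \<otimes> y'"
proof -
  have "(x \<otimes> x') \<ominus> (y \<otimes> y') = (x \<ominus> y) \<otimes> x' \<oplus> y \<otimes> (x' \<ominus> y')" using assms(3-6) by algebra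
  then show ?thesis using assms I_add I_mult I_mult2 by (simp add: cg_def)
qed

lemma cg_zero_iff: "x \<in> carrier R \<Longrightarrow> x \<approx>\<^sub>p \<zero> \<longleftrightarrow> x \<in> I"
  by (simp add: cg_def a_minus_def)

lemma cg_I_iff:
  assumes "x \<approx>\<^sub>p y" "x \<in> carrier R" "y \<in> carrier R"
  shows "x \<in> I \<longleftrightarrow> y \<in> I"
proof -
  have "y \<approx>\<^sub>p x" using assms by (rule cg_sym)
  then show ?thesis
    using assms cg_trans[of x y \<zero>] cg_trans[of y x \<zero>] by (auto simp: cg_zero_iff)
qed

lemma cg_add_I: "x \<in> carrier R \<Longrightarrow> y \<in> I \<Longrightarrow> x \<oplus> y \<approx>\<^sub>p x"
  using cg_add[of x x y \<zero>] cg_zero_iff[of y] I_closed by simp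

lemma pi_cong:
  assumes "x \<approx>\<^sub>p y" "x \<in> carrier R" "y \<in> carrier R"
  shows "\<pi> \<otimes> x = \<pi> \<otimes> y"
proof -
  have "\<pi> \<otimes> x \<ominus> \<pi> \<otimes> y = \<pi> \<otimes> (x \<ominus> y)" using assms(2,3) pi_closed by algebra
  also have "\<dots> = \<zero>" using assms(1) by (simp add: cg_def pi_I)
  finally show ?thesis using assms by simp
qed

text \<open>Only the linear term of the binomial expansion survives, because products of two
  elements of \<open>I\<close> vanish.\<close>

lemma pow_add_I:
  assumes [simp]: "x \<in> carrier R" and y: "y \<in> I"
  shows "(x \<oplus> y) [^] Suc m = x [^] Suc m \<oplus> [Suc m] \<cdot> (x [^] m \<otimes> y)"
proof (induction m)
  case 0
  show ?case using y I_closed by simp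
next
  case (Suc m)
  have [simp]: "y \<in> carrier R" using y I_closed by blast
  have z: "([Suc m] \<cdot> (x [^] m \<otimes> y)) \<otimes> y = \<zero>"
  proof -
    have "([Suc m] \<cdot> (x [^] m \<otimes> y)) \<otimes> y = [Suc m] \<cdot> ((x [^] m \<otimes> y) \<otimes> y)"
      by (rule add_pow_ldistr) auto
    also have "(x [^] m \<otimes> y) \<otimes> y = \<zero>" using y by (simp add: m_assoc I_I)
    finally show ?thesis by (simp del: add.nat_pow_Suc)
  qed
  have "(x \<oplus> y) [^] Suc (Suc m) = (x [^] Suc m \<oplus> [Suc m] \<cdot> (x [^] m \<otimes> y)) \<otimes> (x \<oplus> y)"
    by (simp only: nat_pow_Suc[of _ "Suc m"] Suc)
  also have "\<dots> = x [^] Suc m \<otimes> x \<oplus> x [^] Suc m \<otimes> y \<oplus> ([Suc m] \<cdot> (x [^] m \<otimes> y)) \<otimes> x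
      \<oplus> ([Suc m] \<cdot> (x [^] m \<otimes> y)) \<otimes> y"
    by (simp add: l_distr r_distr a_ac del: nat_pow_Suc add.nat_pow_Suc)
  also have "([Suc m] \<cdot> (x [^] m \<otimes> y)) \<otimes> x = [Suc m] \<cdot> (x [^] Suc m \<otimes> y)"
  proof -
    have "([Suc m] \<cdot> (x [^] m \<otimes> y)) \<otimes> x = [Suc m] \<cdot> ((x [^] m \<otimes> y) \<otimes> x)"
      by (rule add_pow_ldistr) auto
    also have "(x [^] m \<otimes> y) \<otimes> x = x [^] Suc m \<otimes> y" by (simp add: m_ac)
    finally show ?thesis .
  qed
  finally show ?case unfolding z by (simp add: a_ac)
qed

text \<open>The linear term carries the factor \<open>p\<close>, which annihilates \<open>I\<close>.
  So a \<open>p\<close>-th power depends on the residue class only, and congruences can be turned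
  into equalities; Teichmueller lifts rest on this.\<close>

lemma pow_p_cong:
  assumes "x \<approx>\<^sub>p y" and [simp]: "x \<in> carrier R" "y \<in> carrier R"
  shows "x [^] p = y [^] p"
proof -
  obtain m where m: "p = Suc m" using prime_gt_0_nat[OF prime_p] by (cases p) auto
  have I: "x \<ominus> y \<in> I" using assms(1) by (simp add: cg_def)
  have "x = y \<oplus> (x \<ominus> y)" using assms(2,3) by algebra
  then have "x [^] p = (y \<oplus> (x \<ominus> y)) [^] p" by simp
  also have "\<dots> = y [^] p \<oplus> [p] \<cdot> (y [^] m \<otimes> (x \<ominus> y))"
    unfolding m using pow_add_I[OF assms(3) I] .
  also have "[p] \<cdot> (y [^] m \<otimes> (x \<ominus> y)) = \<zero>"
    by (subst add_pow_p) (use I I_mult pi_I in auto)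
  finally show ?thesis by simp
qed

lemma pow_N_cong:
  assumes "x \<approx>\<^sub>p y" and [simp]: "x \<in> carrier R" "y \<in> carrier R"
  shows "x [^] N = y [^] N"
proof -
  have N: "N = p * p ^ (n - 1)" using n_pos by (simp add: N_eq flip: power_Suc)
  show ?thesis unfolding N using pow_p_cong[OF assms] by (simp flip: nat_pow_pow)
qed

section \<open>Powers of \<xi> and the residue field\<close>

lemma N2_minus_one: "N\<^sup>2 - 1 = (N + 1) * (N - 1)"
  using N_ge_2 by (simp add: power2_eq_square algebra_simps diff_mult_distrib)

lemma xi_closed [simp]: "\<xi> \<in> carrier R"
  using xi_Units by (rule Units_closed)

lemma xi_pow_closed [simp]: "\<xi> [^] (l :: nat) \<in> carrier R"
  using xi_Units by (intro nat_pow_closed Units_closed)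

lemma xi_pow_Units: "\<xi> [^] (l :: nat) \<in> Units R"
  using xi_Units by (rule Units_pow_closed)

lemma xi_pow_eq_one_iff: "\<xi> [^] (l :: nat) = \<one> \<longleftrightarrow> N\<^sup>2 - 1 dvd l"
proof -
  interpret U: group "units_of R" by (rule units_group)
  show ?thesis
    using U.pow_eq_id[of \<xi> l] ord_xi xi_Units
    by (simp add: units_of_carrier units_of_one units_of_pow)
qed

text \<open>Taking \<open>p\<close>-th powers turns the congruence into an equality, and
  \<open>p\<close> is coprime to the order of \<xi>. Hence \<xi> keeps its order modulo
  \<open>p\<close>.\<close>

lemma xi_pow_cg_one:
  assumes "\<xi> [^] (l :: nat) \<approx>\<^sub>p \<one>"
  shows "N\<^sup>2 - 1 dvd l"
proof -
  have "\<xi> [^] (l * p) = \<one>" using pow_p_cong[OF assms] Units_closed[OF xi_Units] by (simp add: nat_pow_pow)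
  then have "N\<^sup>2 - 1 dvd l * p" by (simp add: xi_pow_eq_one_iff)
  moreover have "coprime (N\<^sup>2 - 1) p"
  proof -
    have "coprime (N\<^sup>2 - 1) (N\<^sup>2)" using N_ge_2 by (intro coprime_diff_one_left_nat) simp
    then show ?thesis using n_pos by (simp add: N_eq)
  qed
  ultimately show ?thesis by (simp add: coprime_dvd_mult_left_iff)
qed

lemma xi_pow_cg_imp:
  assumes "\<xi> [^] (a :: nat) \<approx>\<^sub>p \<xi> [^] (b :: nat)"
  shows "[a = b] (mod N\<^sup>2 - 1)"
proof -
  have *: "[a = b] (mod N\<^sup>2 - 1)" if "a \<le> b" "\<xi> [^] a \<approx>\<^sub>p \<xi> [^] b" for a b :: nat
  proof -
    have inv: "inv (\<xi> [^] a) \<otimes> \<xi> [^] a = \<one>" "inv (\<xi> [^] a) \<in> carrier R"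
      using xi_pow_Units[of a] by auto
    have "\<xi> [^] b = \<xi> [^] a \<otimes> \<xi> [^] (b - a)"
      using that(1) Units_closed[OF xi_Units] by (simp add: nat_pow_mult)
    then have "inv (\<xi> [^] a) \<otimes> \<xi> [^] b = \<xi> [^] (b - a)" using inv by (simp flip: m_assoc)
    moreover have "inv (\<xi> [^] a) \<otimes> \<xi> [^] a \<approx>\<^sub>p inv (\<xi> [^] a) \<otimes> \<xi> [^] b"
      using inv that(2) by (intro cg_mult) auto
    ultimately have "\<one> \<approx>\<^sub>p \<xi> [^] (b - a)" using inv by simp
    then have "\<xi> [^] (b - a) \<approx>\<^sub>p \<one>" by (rule cg_sym) auto
    then have "N\<^sup>2 - 1 dvd b - a" by (rule xi_pow_cg_one)
    then show ?thesis using that(1) by (metis cong_altdef_nat cong_sym)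
  qed
  show ?thesis
  proof (cases "a \<le> b")
    case False
    then show ?thesis using *[of b a] cg_sym[OF assms] cong_sym by simp
  qed (use * assms in simp)
qed

lemma xi_pow_eq: "[a = b] (mod N\<^sup>2 - 1) \<Longrightarrow> \<xi> [^] (a :: nat) = \<xi> [^] (b :: nat)"
proof -
  interpret U: group "units_of R" by (rule units_group)
  have c: "\<xi> \<in> carrier (units_of R)" by (simp add: units_of_carrier xi_Units)
  assume "[a = b] (mod N\<^sup>2 - 1)"
  then have "[int b = int a] (mod int (N\<^sup>2 - 1))" by (metis cong_int_iff cong_sym)
  then have "int (U.ord \<xi>) dvd int b - int a" by (simp only: ord_xi cong_iff_dvd_diff)
  then have "\<xi> [^]\<^bsub>units_of R\<^esub> int a = \<xi> [^]\<^bsub>units_of R\<^esub> int b" by (simp only: U.int_pow_eq[OF c])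
  then show ?thesis by (simp add: int_pow_int units_of_pow[OF xi_Units])
qed

text \<open>Zero and the \<open>N^2 - 1\<close> powers of \<xi> are pairwise incongruent, so their
  sums with the \<open>N^2\<close> elements of \<open>I\<close> are all distinct and exhaust the
  \<open>N ^ 4\<close> elements of the ring.\<close>

lemma carrier_cases:
  assumes x: "x \<in> carrier R"
  obtains "x \<in> I" | l :: nat where "x \<approx>\<^sub>p \<xi> [^] l"
proof -
  define T where "T = insert \<zero> ((\<lambda>l :: nat. \<xi> [^] l) ` {..<N\<^sup>2 - 1})"
  let ?f = "\<lambda>(y, t). y \<oplus> t"
  have Tc: "t \<in> carrier R" if "t \<in> T" for t using that by (auto simp: T_def)
  have inj: "inj_on (\<lambda>l :: nat. \<xi> [^] l) {..<N\<^sup>2 - 1}"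
  proof (rule inj_onI)
    fix a b :: nat assume *: "a \<in> {..<N\<^sup>2 - 1}" "b \<in> {..<N\<^sup>2 - 1}" "\<xi> [^] a = \<xi> [^] b"
    have "\<xi> [^] a \<approx>\<^sub>p \<xi> [^] b" unfolding *(3) by (rule cg_refl) simp
    then have "[a = b] (mod N\<^sup>2 - 1)" by (rule xi_pow_cg_imp)
    then show "a = b" using *(1,2) by (auto intro: cong_less_modulus_unique_nat)
  qed
  have zero_pow: "\<zero> \<notin> (\<lambda>l :: nat. \<xi> [^] l) ` {..<N\<^sup>2 - 1}"
  proof
    assume "\<zero> \<in> (\<lambda>l :: nat. \<xi> [^] l) ` {..<N\<^sup>2 - 1}"
    then obtain l :: nat where l: "\<zero> = \<xi> [^] l" by blast
    show False using Units_notin_I[OF xi_pow_Units, of l] unfolding l[symmetric] by simp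
  qed
  have cardT: "card T = N\<^sup>2"
  proof -
    have "card ((\<lambda>l :: nat. \<xi> [^] l) ` {..<N\<^sup>2 - 1}) = N\<^sup>2 - 1"
      by (simp only: card_image[OF inj] card_lessThan)
    moreover have "\<zero> \<notin> (\<lambda>l :: nat. \<xi> [^] l) ` {..<N\<^sup>2 - 1}" by (fact zero_pow)
    ultimately have "card T = Suc (N\<^sup>2 - 1)"
      by (simp only: T_def card_insert_disjoint finite_imageI finite_lessThan not_False_eq_True)
    then show ?thesis using N_ge_2 by simp
  qed
  have T_eq: "t = t'" if tt: "t \<in> T" "t' \<in> T" "t \<approx>\<^sub>p t'" for t t'
  proof -
    have nI: "\<xi> [^] l \<notin> I" for l :: nat using Units_notin_I[OF xi_pow_Units] .
    have T_cases: "t = \<zero> \<or> (\<exists>a<N\<^sup>2 - 1. t = \<xi> [^] a)" if "t \<in> T" for t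
      using that unfolding T_def by blast
    consider "t = \<zero>" "t' = \<zero>" | l :: nat where "t = \<zero>" "t' = \<xi> [^] l" | l :: nat where "t = \<xi> [^] l" "t' = \<zero>"
      | a b :: nat where "t = \<xi> [^] a" "t' = \<xi> [^] b" "a < N\<^sup>2 - 1" "b < N\<^sup>2 - 1"
      using T_cases[OF tt(1)] T_cases[OF tt(2)] by blast
    then show ?thesis
    proof cases
      case 2
      then show ?thesis using tt(3) nI cg_I_iff[of t t'] by simp
    next
      case 3
      then show ?thesis using tt(3) nI cg_I_iff[of t t'] by simp
    next
      case 4
      then have "[a = b] (mod N\<^sup>2 - 1)" using tt(3) xi_pow_cg_imp by simp
      then have "a = b" using 4(3,4) by (rule cong_less_modulus_unique_nat)
      then show ?thesis using 4 by simp
    qed simp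
  qed
  have "inj_on ?f (I \<times> T)"
  proof (rule inj_onI, clarify)
    fix y t y' t' assume *: "y \<in> I" "t \<in> T" "y' \<in> I" "t' \<in> T" "y \<oplus> t = y' \<oplus> t'"
    have c: "y \<in> carrier R" "y' \<in> carrier R" "t \<in> carrier R" "t' \<in> carrier R"
      using * I_closed Tc by auto
    have "t \<ominus> t' = (y \<oplus> t) \<ominus> (y' \<oplus> t') \<ominus> (y \<ominus> y')" using c by algebra
    also have "\<dots> = \<ominus> (y \<ominus> y')" unfolding *(5) using c by (simp add: a_minus_def r_neg)
    finally have "t \<approx>\<^sub>p t'" using * by (simp add: cg_def I_minus I_uminus)
    then have "t = t'" using * T_eq by blast
    then show "y = y' \<and> t = t'" using * c by simp
  qed
  moreover have "card (I \<times> T) = card (carrier R)"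
    by (simp add: card_cartesian_product card_I cardT card_R power4_eq_xxxx power2_eq_square)
  moreover have "?f ` (I \<times> T) \<subseteq> carrier R" using I_closed Tc by auto
  ultimately have "?f ` (I \<times> T) = carrier R"
    using finite_R by (intro card_subset_eq) (simp_all add: card_image)
  then obtain y t where yt: "y \<in> I" "t \<in> T" "x = y \<oplus> t" using x by fastforce
  show thesis
  proof (cases "t = \<zero>")
    case True
    then show thesis using yt I_closed that(1) by simp
  next
    case False
    then obtain l :: nat where l: "t = \<xi> [^] l" using yt by (auto simp: T_def)
    have "x \<approx>\<^sub>p \<xi> [^] l" using yt l cg_add_I[of t y] I_closed by (simp add: a_comm)
    then show thesis by (rule that(2))
  qed
qed

text \<open>Up to a power of \<xi>, an element outside \<open>I\<close> is
  \<open>\<one> \<oplus> y\<close> with \<open>y\<close> in \<open>I\<close>, and its inverse is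
  \<open>\<one> \<ominus> y\<close> because \<open>y\<close> has square zero.\<close>

lemma Units_iff: "x \<in> Units R \<longleftrightarrow> x \<in> carrier R \<and> x \<notin> I"
proof
  assume x: "x \<in> carrier R \<and> x \<notin> I"
  from conjunct1[OF x] have "\<exists>l :: nat. x \<approx>\<^sub>p \<xi> [^] l"
    by (cases rule: carrier_cases) (use x in auto)
  then obtain l :: nat where l: "x \<approx>\<^sub>p \<xi> [^] l" by blast
  let ?i = "inv (\<xi> [^] l)"
  have i: "?i \<in> carrier R" "\<xi> [^] l \<otimes> ?i = \<one>" using xi_pow_Units[of l] by auto
  have xc: "x \<in> carrier R" using x by simp
  have "x \<otimes> ?i \<approx>\<^sub>p \<one>" using cg_mult[OF l cg_refl[OF i(1)]] x i by simp
  then have y: "x \<otimes> ?i \<ominus> \<one> \<in> I" by (simp add: cg_def)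
  let ?y = "x \<otimes> ?i \<ominus> \<one>"
  have "x \<otimes> (?i \<otimes> (\<one> \<ominus> ?y)) = (\<one> \<oplus> ?y) \<otimes> (\<one> \<ominus> ?y)" using xc i(1) by algebra
  also have "\<dots> = \<one> \<ominus> ?y \<otimes> ?y" using xc i(1) by algebra
  also have "\<dots> = \<one>" unfolding I_I[OF y y] by (simp add: a_minus_def)
  finally have e: "x \<otimes> (?i \<otimes> (\<one> \<ominus> ?y)) = \<one>" .
  have c: "?i \<otimes> (\<one> \<ominus> ?y) \<in> carrier R" using xc i by simp
  show "x \<in> Units R" unfolding Units_def using xc c e m_comm[OF xc c] by auto
qed (auto simp: Units_notin_I)

lemma I_prime:
  assumes "x \<otimes> y \<in> I" "x \<in> carrier R" "y \<in> carrier R" "x \<notin> I"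
  shows "y \<in> I"
proof -
  have "x \<in> Units R" using assms by (simp add: Units_iff)
  then have "inv x \<otimes> (x \<otimes> y) = y" "inv x \<in> carrier R" using assms by (simp_all flip: m_assoc)
  then show ?thesis using I_mult[of "inv x" "x \<otimes> y"] assms by simp
qed

text \<open>A unit annihilated by \<open>\<pi>\<close> would make \<open>\<pi>\<close> zero and
  \<open>I\<close> trivial, against \<open>card_I\<close>. Consequently \<open>I\<close> is a copy
  of the residue field.\<close>

lemma pi_eq_zero:
  assumes "\<pi> \<otimes> x = \<zero>" "x \<in> carrier R"
  shows "x \<in> I"
proof (rule ccontr)
  assume "x \<notin> I"
  then have u: "x \<in> Units R" using assms by (simp add: Units_iff)
  have "\<pi> = (\<pi> \<otimes> x) \<otimes> inv x" using u assms(2) by (simp add: m_assoc)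
  also have "\<dots> = \<zero>" using u by (simp add: assms(1))
  finally have "I \<subseteq> {\<zero>}" by (auto simp: I_def)
  then have "card I \<le> card {\<zero>}" by (intro card_mono) auto
  then show False using power_mono[OF N_ge_2, of 2] by (simp add: card_I)
qed

lemma pi_eq_iff: "x \<in> carrier R \<Longrightarrow> y \<in> carrier R \<Longrightarrow> \<pi> \<otimes> x = \<pi> \<otimes> y \<longleftrightarrow> x \<approx>\<^sub>p y"
proof
  assume c: "x \<in> carrier R" "y \<in> carrier R" and "\<pi> \<otimes> x = \<pi> \<otimes> y"
  moreover have "\<pi> \<otimes> (x \<ominus> y) = \<pi> \<otimes> x \<ominus> \<pi> \<otimes> y" using c pi_closed by algebra
  ultimately have "\<pi> \<otimes> (x \<ominus> y) = \<zero>" by simp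
  then show "x \<approx>\<^sub>p y" using c pi_eq_zero[of "x \<ominus> y"] by (simp add: cg_def)
qed (rule pi_cong)

text \<open>The error after the first \<open>p\<close>-th power lies in \<open>I\<close>, so the
  next \<open>p\<close>-th power erases it. Only the error of the last step remains.\<close>

lemma pow_sum:
  assumes "subring H R" "x \<in> H" "y \<in> H"
  shows "\<exists>z\<in>H. (x \<oplus> y) [^] (p ^ Suc m) = x [^] (p ^ Suc m) \<oplus> y [^] (p ^ Suc m) \<oplus> \<pi> \<otimes> z"
  using assms(2,3)
proof (induction m arbitrary: x y)
  case 0
  obtain z where z: "z \<in> H" "(x \<oplus> y) [^] p = x [^] p \<oplus> y [^] p \<oplus> [p] \<cdot> z"
    using pow_sum_subring[OF prime_p assms(1) 0] by blast
  have "z \<in> carrier R" using z(1) subringE(1)[OF assms(1)] by blast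
  then have "[p] \<cdot> z = \<pi> \<otimes> z" by (rule add_pow_p)
  then show ?case using z by auto
next
  case (Suc m)
  have H: "H \<subseteq> carrier R" using subringE(1)[OF assms(1)] .
  have c [simp]: "x \<in> carrier R" "y \<in> carrier R" using Suc.prems H by auto
  have pH: "h [^] (i :: nat) \<in> H" if "h \<in> H" for h i
    using that by (induction i) (auto simp: subringE[OF assms(1)])
  obtain z where z: "z \<in> H" "(x \<oplus> y) [^] p = x [^] p \<oplus> y [^] p \<oplus> \<pi> \<otimes> z"
  proof -
    obtain z where z: "z \<in> H" "(x \<oplus> y) [^] p = x [^] p \<oplus> y [^] p \<oplus> [p] \<cdot> z"
      using pow_sum_subring[OF prime_p assms(1) Suc.prems] by blast
    have "z \<in> carrier R" using z(1) H by blast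
    then have "[p] \<cdot> z = \<pi> \<otimes> z" by (rule add_pow_p)
    then show thesis using z that by simp
  qed
  have zc: "z \<in> carrier R" using z H by blast
  have p_dvd: "p ^ Suc m = p * p ^ m" by simp
  have "(x \<oplus> y) [^] (p ^ Suc (Suc m)) = ((x \<oplus> y) [^] p) [^] (p ^ Suc m)"
    by (simp add: nat_pow_pow)
  also have "\<dots> = (x [^] p \<oplus> y [^] p \<oplus> \<pi> \<otimes> z) [^] (p ^ Suc m)" unfolding z(2) ..
  also have "\<dots> = (x [^] p \<oplus> y [^] p) [^] (p ^ Suc m)"
  proof -
    have "(x [^] p \<oplus> y [^] p \<oplus> \<pi> \<otimes> z) [^] p = (x [^] p \<oplus> y [^] p) [^] p"
      using zc by (intro pow_p_cong cg_add_I) auto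
    then show ?thesis unfolding p_dvd using zc by (simp flip: nat_pow_pow)
  qed
  finally show ?case
    using Suc.IH[OF pH[OF Suc.prems(1), of p] pH[OF Suc.prems(2), of p]] by (simp add: nat_pow_pow)
qed

lemma pow_N_sum:
  assumes "subring H R" "x \<in> H" "y \<in> H"
  shows "\<exists>z\<in>H. (x \<oplus> y) [^] N = x [^] N \<oplus> y [^] N \<oplus> \<pi> \<otimes> z"
proof -
  have "N = p ^ Suc (n - 1)" using n_pos by (simp add: N_eq)
  then show ?thesis using pow_sum[OF assms] by metis
qed

lemma pow_N_sum_cg:
  assumes [simp]: "x \<in> carrier R" "y \<in> carrier R"
  shows "(x \<oplus> y) [^] N \<approx>\<^sub>p x [^] N \<oplus> y [^] N"
proof -
  obtain z where "z \<in> carrier R" "(x \<oplus> y) [^] N = x [^] N \<oplus> y [^] N \<oplus> \<pi> \<otimes> z"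
    using pow_N_sum[OF carrier_is_subring assms] by blast
  then show ?thesis by (simp add: cg_add_I piI)
qed

text \<open>The Teichmueller set of the subring is the set of solutions of \<open>c\<^sup>N = c\<close>, and \<open>B\<close> is the
  preimage of the subfield of order \<open>N\<close> of the residue field.\<close>

definition Tn where "Tn = {c \<in> carrier R. c [^] N = c}"

definition B where "B = {x \<in> carrier R. x [^] N \<approx>\<^sub>p x}"

definition A where "A = {c \<oplus> \<pi> \<otimes> d | c d. c \<in> Tn \<and> d \<in> Tn}"

section \<open>Teichmueller elements and the subring A\<close>

lemma Tn_closed: "c \<in> Tn \<Longrightarrow> c \<in> carrier R"
  by (simp add: Tn_def)

lemma B_closed: "c \<in> B \<Longrightarrow> c \<in> carrier R"
  by (simp add: B_def)

lemma Tn_mult: "c \<in> Tn \<Longrightarrow> d \<in> Tn \<Longrightarrow> c \<otimes> d \<in> Tn"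
  by (simp add: Tn_def nat_pow_distrib)

lemma zero_Tn [simp]: "\<zero> \<in> Tn" and one_Tn [simp]: "\<one> \<in> Tn"
  using N_ge_2 by (simp_all add: Tn_def nat_pow_zero)

lemma Tn_subset_B: "Tn \<subseteq> B"
  by (auto simp: Tn_def B_def)

text \<open>On \<open>B\<close> the \<open>N\<close>-th power is the Teichmueller lift: it stays in
  the residue class, and its own \<open>N\<close>-th power is the same element.\<close>

lemma B_pow_N: "x \<in> B \<Longrightarrow> x [^] N \<in> Tn"
  using pow_N_cong[of "x [^] N" x] by (simp add: Tn_def B_def)

lemma B_cg: "x \<in> B \<Longrightarrow> x [^] N \<approx>\<^sub>p x"
  by (simp add: B_def)

lemma Tn_eq: "c \<in> Tn \<Longrightarrow> d \<in> Tn \<Longrightarrow> c \<approx>\<^sub>p d \<Longrightarrow> c = d"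
  using pow_N_cong[of c d] by (simp add: Tn_def)

lemma Tn_I: "c \<in> Tn \<Longrightarrow> c \<in> I \<Longrightarrow> c = \<zero>"
  using Tn_eq[of c \<zero>] cg_zero_iff[of c] Tn_closed by simp

lemma B_add:
  assumes "x \<in> B" "y \<in> B"
  shows "x \<oplus> y \<in> B"
proof -
  have c: "x \<in> carrier R" "y \<in> carrier R" using assms B_closed by auto
  have "(x \<oplus> y) [^] N \<approx>\<^sub>p x [^] N \<oplus> y [^] N" using c by (rule pow_N_sum_cg)
  moreover have "x [^] N \<oplus> y [^] N \<approx>\<^sub>p x \<oplus> y" using assms c by (intro cg_add B_cg) auto
  ultimately show ?thesis using c cg_trans by (simp add: B_def)
qed

lemma B_mult: "x \<in> B \<Longrightarrow> y \<in> B \<Longrightarrow> x \<otimes> y \<in> B"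
  using cg_mult[of "x [^] N" x "y [^] N" y] by (simp add: B_def nat_pow_distrib)

lemma I_subset_B: "I \<subseteq> B"
proof
  fix x assume x: "x \<in> I"
  have "x [^] N = \<zero>" using pow_N_cong[of x \<zero>] x I_closed cg_zero_iff N_ge_2 by (simp add: nat_pow_zero)
  moreover have "\<zero> \<approx>\<^sub>p x" using x I_closed cg_sym[of x \<zero>] by (simp add: cg_zero_iff)
  ultimately show "x \<in> B" using x I_closed by (simp add: B_def)
qed

lemma B_uminus_one: "\<ominus> \<one> \<in> B"
proof -
  have "(\<one> \<oplus> \<ominus> \<one>) [^] N \<approx>\<^sub>p \<one> [^] N \<oplus> (\<ominus> \<one>) [^] N" by (rule pow_N_sum_cg) auto
  then have "\<zero> \<approx>\<^sub>p \<one> \<oplus> (\<ominus> \<one>) [^] N" using N_ge_2 by (simp add: r_neg nat_pow_zero)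
  then have "\<zero> \<oplus> \<ominus> \<one> \<approx>\<^sub>p (\<one> \<oplus> (\<ominus> \<one>) [^] N) \<oplus> \<ominus> \<one>" by (intro cg_add) auto
  moreover have "(\<one> \<oplus> (\<ominus> \<one>) [^] N) \<oplus> \<ominus> \<one> = (\<ominus> \<one>) [^] N" by (simp add: a_ac r_neg r_neg1 r_neg2)
  ultimately show ?thesis using cg_sym by (simp add: B_def)
qed

lemma B_uminus: "x \<in> B \<Longrightarrow> \<ominus> x \<in> B"
  using B_mult[OF B_uminus_one, of x] B_closed by (simp add: l_minus)

lemma B_subring: "subring B R"
  using B_add B_mult B_uminus Tn_subset_B one_Tn B_closed by (intro subringI) auto

text \<open>Behind the factor \<open>\<pi>\<close> an element of \<open>B\<close> may be replaced by
  its lift. The closure proofs below therefore have to control the second digit only up to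
  membership in \<open>B\<close>.\<close>

lemma A_I: "c \<in> Tn \<Longrightarrow> d \<in> B \<Longrightarrow> c \<oplus> \<pi> \<otimes> d \<in> A"
proof -
  assume *: "c \<in> Tn" "d \<in> B"
  have "\<pi> \<otimes> d [^] N = \<pi> \<otimes> d" using * B_closed B_cg by (intro pi_cong) auto
  then have "c \<oplus> \<pi> \<otimes> d = c \<oplus> \<pi> \<otimes> d [^] N" by simp
  then show ?thesis using * B_pow_N unfolding A_def by blast
qed

lemma A_E:
  assumes "x \<in> A"
  obtains c d where "c \<in> Tn" "d \<in> Tn" "x = c \<oplus> \<pi> \<otimes> d" "c \<in> carrier R" "d \<in> carrier R"
  using assms Tn_closed by (auto simp: A_def)

lemma A_closed: "x \<in> A \<Longrightarrow> x \<in> carrier R"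
  by (auto elim!: A_E)

lemma A_subset_B: "A \<subseteq> B"
  using Tn_subset_B I_subset_B B_add by (auto elim!: A_E intro!: B_add)

text \<open>Addition with carry, as for Witt vectors of length two: the first digit of the sum is
  the lift \<open>(c \<oplus> c') [^] N\<close>, and the carry \<open>\<ominus> z\<close> goes to
  the second digit.\<close>

lemma A_add:
  assumes "x \<in> A" "y \<in> A"
  shows "x \<oplus> y \<in> A"
proof -
  obtain c d where x: "c \<in> Tn" "d \<in> Tn" "x = c \<oplus> \<pi> \<otimes> d" and cx: "c \<in> carrier R" "d \<in> carrier R"
    using assms(1) by (rule A_E)
  obtain c' d' where y: "c' \<in> Tn" "d' \<in> Tn" "y = c' \<oplus> \<pi> \<otimes> d'" and cy: "c' \<in> carrier R" "d' \<in> carrier R"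
    using assms(2) by (rule A_E)
  have cB: "c \<in> B" "c' \<in> B" "d \<in> B" "d' \<in> B" using x y Tn_subset_B by auto
  obtain z where z: "z \<in> B" "(c \<oplus> c') [^] N = c [^] N \<oplus> c' [^] N \<oplus> \<pi> \<otimes> z"
    using pow_N_sum[OF B_subring cB(1,2)] by blast
  have zc: "z \<in> carrier R" using z B_closed by blast
  have e: "(c \<oplus> c') [^] N = c \<oplus> c' \<oplus> \<pi> \<otimes> z" using z(2) x(1) y(1) by (simp add: Tn_def)
  have "x \<oplus> y = (c \<oplus> c' \<oplus> \<pi> \<otimes> z) \<oplus> \<pi> \<otimes> (d \<oplus> d' \<oplus> \<ominus> z)"
    unfolding x(3) y(3) using cx cy zc pi_closed by algebra
  also have "\<dots> = (c \<oplus> c') [^] N \<oplus> \<pi> \<otimes> (d \<oplus> d' \<oplus> \<ominus> z)" by (simp add: e)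
  finally have xy: "x \<oplus> y = (c \<oplus> c') [^] N \<oplus> \<pi> \<otimes> (d \<oplus> d' \<oplus> \<ominus> z)" .
  show ?thesis
  proof -
    have "(c \<oplus> c') [^] N \<in> Tn" by (intro B_pow_N B_add cB)
    moreover have "d \<oplus> d' \<oplus> \<ominus> z \<in> B" by (intro B_add B_uminus cB z(1))
    ultimately show ?thesis unfolding xy by (rule A_I)
  qed
qed

lemma A_mult:
  assumes "x \<in> A" "y \<in> A"
  shows "x \<otimes> y \<in> A"
proof -
  obtain c d where x: "c \<in> Tn" "d \<in> Tn" "x = c \<oplus> \<pi> \<otimes> d" and cx: "c \<in> carrier R" "d \<in> carrier R"
    using assms(1) by (rule A_E)
  obtain c' d' where y: "c' \<in> Tn" "d' \<in> Tn" "y = c' \<oplus> \<pi> \<otimes> d'" and cy: "c' \<in> carrier R" "d' \<in> carrier R"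
    using assms(2) by (rule A_E)
  have "x \<otimes> y = (c \<otimes> c' \<oplus> \<pi> \<otimes> (c \<otimes> d' \<oplus> c' \<otimes> d)) \<oplus> (\<pi> \<otimes> \<pi>) \<otimes> (d \<otimes> d')"
    unfolding x(3) y(3) using cx cy pi_closed by algebra
  also have "\<dots> = c \<otimes> c' \<oplus> \<pi> \<otimes> (c \<otimes> d' \<oplus> c' \<otimes> d)"
    using cx cy by (simp add: pi_pi)
  finally show ?thesis
    using x(1,2) y(1,2) by (simp only:) (intro A_I B_add subsetD[OF Tn_subset_B] Tn_mult)
qed

lemma Tn_subset_A: "Tn \<subseteq> A"
proof
  fix c assume "c \<in> Tn"
  then show "c \<in> A" using A_I[of c \<zero>] Tn_closed subsetD[OF Tn_subset_B zero_Tn] by simp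
qed

lemma one_A [simp]: "\<one> \<in> A" and zero_A [simp]: "\<zero> \<in> A"
  using Tn_subset_A by auto

text \<open>For \<open>p = 2\<close> the element \<open>\<ominus> \<one>\<close> is not in
  \<open>Tn\<close>, since its \<open>N\<close>-th power is \<open>\<one>\<close>. Its two digits
  are read off from the expansion of
  \<open>(\<one> \<oplus> \<ominus> \<one>) [^] N = \<zero>\<close>, which works for every
  \<open>p\<close>.\<close>

lemma A_uminus_one: "\<ominus> \<one> \<in> A"
proof -
  have oB: "\<one> \<in> B" using Tn_subset_B by auto
  obtain z where z: "z \<in> B" "(\<one> \<oplus> \<ominus> \<one>) [^] N = \<one> [^] N \<oplus> (\<ominus> \<one>) [^] N \<oplus> \<pi> \<otimes> z"
    using pow_N_sum[OF B_subring oB B_uminus_one] by blast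
  let ?t = "(\<ominus> \<one>) [^] N"
  have c: "z \<in> carrier R" "?t \<in> carrier R" using z B_closed by auto
  have 0: "\<one> \<oplus> ?t \<oplus> \<pi> \<otimes> z = \<zero>" using z(2) N_ge_2 by (simp add: r_neg nat_pow_zero)
  have "?t \<oplus> \<pi> \<otimes> z = (\<one> \<oplus> ?t \<oplus> \<pi> \<otimes> z) \<ominus> \<one>" using c pi_closed by algebra
  also have "\<dots> = \<ominus> \<one>" unfolding 0 by (simp add: a_minus_def)
  finally show ?thesis using A_I[OF B_pow_N[OF B_uminus_one] z(1)] by simp
qed

lemma A_uminus: "x \<in> A \<Longrightarrow> \<ominus> x \<in> A"
  using A_mult[OF A_uminus_one, of x] A_closed by (simp add: l_minus)

lemma A_minus: "x \<in> A \<Longrightarrow> y \<in> A \<Longrightarrow> x \<ominus> y \<in> A"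
  by (simp add: a_minus_def A_add A_uminus)

text \<open>For an exponent \<open>t\<close>, the congruence \<open>t * N = t\<close> modulo
  \<open>(N - 1) * (N + 1)\<close> holds exactly when \<open>N + 1\<close> divides
  \<open>t\<close>.\<close>

lemma teichmueller_eq: "teichmueller R (\<xi> [^] (N + 1)) (N - 1) = Tn"
proof (intro equalityI subsetI)
  have sq: "N\<^sup>2 - 1 = (N - 1) * (N + 1)"
    by (simp only: N2_minus_one mult.commute)
  fix c assume "c \<in> teichmueller R (\<xi> [^] (N + 1)) (N - 1)"
  then consider "c = \<zero>" | l :: nat where "c = (\<xi> [^] (N + 1)) [^] l"
    by (auto simp: teichmueller_def)
  then show "c \<in> Tn"
  proof cases
    case 2
    then have c: "c = \<xi> [^] ((N + 1) * l)" using Units_closed[OF xi_Units] by (simp only: nat_pow_pow)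
    have "N\<^sup>2 - 1 dvd (N + 1) * l * N - (N + 1) * l"
    proof -
      have "(N + 1) * l * N - (N + 1) * l = (N\<^sup>2 - 1) * l"
        unfolding sq using N_ge_2 by (simp add: algebra_simps diff_mult_distrib diff_mult_distrib2)
      then show ?thesis by simp
    qed
    then have "[(N + 1) * l * N = (N + 1) * l] (mod N\<^sup>2 - 1)"
      using N_ge_2 by (subst cong_altdef_nat) auto
    then have "\<xi> [^] ((N + 1) * l * N) = \<xi> [^] ((N + 1) * l)" by (rule xi_pow_eq)
    then show ?thesis using Units_closed[OF xi_Units] unfolding c Tn_def by (simp add: nat_pow_pow)
  qed simp
next
  have sq: "N\<^sup>2 - 1 = (N - 1) * (N + 1)"
    by (simp only: N2_minus_one mult.commute)
  fix c assume c: "c \<in> Tn"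
  then have cc: "c \<in> carrier R" by (rule Tn_closed)
  from cc show "c \<in> teichmueller R (\<xi> [^] (N + 1)) (N - 1)"
  proof (cases rule: carrier_cases)
    case 1
    then show ?thesis using Tn_I[OF c] by (simp add: teichmueller_def)
  next
    case (2 l)
    \<comment> \<open>So far \<open>c\<close> is only congruent to a power of \<xi>; passing to
      \<open>N\<close>-th powers makes this an equality.\<close>
    have "c = c [^] N" using c by (simp add: Tn_def)
    also have "\<dots> = \<xi> [^] (l * N)"
      using pow_N_cong[OF 2 cc] Units_closed[OF xi_Units] by (simp add: nat_pow_pow)
    finally have e: "c = \<xi> [^] (l * N)" .
    let ?t = "l * N"
    have "\<xi> [^] (?t * N) = \<xi> [^] ?t"
      using c Units_closed[OF xi_Units] unfolding e Tn_def by (simp add: nat_pow_pow)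
    then have "\<xi> [^] (?t * N) \<approx>\<^sub>p \<xi> [^] ?t" by simp
    then have "[?t * N = ?t] (mod N\<^sup>2 - 1)" by (rule xi_pow_cg_imp)
    then have "(N - 1) * (N + 1) dvd ?t * N - ?t"
      unfolding sq using N_ge_2 by (subst (asm) cong_altdef_nat) auto
    moreover have "?t * N - ?t = (N - 1) * ?t" by (simp add: algebra_simps diff_mult_distrib)
    ultimately have "(N - 1) * (N + 1) dvd (N - 1) * ?t" by (simp only:)
    then have "N + 1 dvd ?t" using N_ge_2 by (subst (asm) nat_mult_dvd_cancel1) auto
    then obtain s where s: "?t = (N + 1) * s" by blast
    have "[(N + 1) * s = (N + 1) * (s mod (N - 1))] (mod (N + 1) * (N - 1))"
      unfolding cong_def mod_mult_mult1 by simp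
    then have "[?t = (N + 1) * (s mod (N - 1))] (mod N\<^sup>2 - 1)" unfolding s sq by (simp only: mult.commute[of "N - 1" "N + 1"])
    then have "c = \<xi> [^] ((N + 1) * (s mod (N - 1)))" unfolding e by (rule xi_pow_eq)
    also have "\<dots> = (\<xi> [^] (N + 1)) [^] (s mod (N - 1))"
      using Units_closed[OF xi_Units] by (simp only: nat_pow_pow)
    finally have "c = (\<xi> [^] (N + 1)) [^] (s mod (N - 1))" .
    moreover have "s mod (N - 1) < N - 1" using N_ge_2 by simp
    ultimately show ?thesis unfolding teichmueller_def by blast
  qed
qed

lemma galois_subring_eq: "galois_subring R p n \<xi> = A"
proof -
  have "galois_subring R p n \<xi> = {a\<^sub>0 \<oplus> [p] \<cdot> a\<^sub>1 | a\<^sub>0 a\<^sub>1. a\<^sub>0 \<in> Tn \<and> a\<^sub>1 \<in> Tn}"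
    unfolding galois_subring_def Let_def N_eq[symmetric] teichmueller_eq ..
  also have "\<dots> = A" unfolding A_def by (rule Collect_cong) (metis add_pow_p Tn_closed)
  finally show ?thesis .
qed

section \<open>Cardinalities and units of the subring\<close>

lemma Tn_nonzeroE:
  assumes "c \<in> Tn" "c \<noteq> \<zero>"
  obtains a :: nat where "c = \<xi> [^] ((N + 1) * a)"
proof -
  have "c \<in> teichmueller R (\<xi> [^] (N + 1)) (N - 1)" using assms by (simp only: teichmueller_eq)
  then obtain a :: nat where "c = (\<xi> [^] (N + 1)) [^] a" using assms(2) unfolding teichmueller_def by blast
  then have "c = \<xi> [^] ((N + 1) * a)" by (simp only: nat_pow_pow[OF xi_closed])
  then show thesis by (rule that)
qed

lemma xi_pow_Tn: "\<xi> [^] ((N + 1) * a) \<in> Tn"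
proof -
  have "\<xi> [^] ((N + 1) * a) = (\<xi> [^] (N + 1)) [^] (a mod (N - 1))"
  proof -
    have "[(N + 1) * a = (N + 1) * (a mod (N - 1))] (mod N\<^sup>2 - 1)"
      unfolding N2_minus_one cong_def mod_mult_mult1 by simp
    then have "\<xi> [^] ((N + 1) * a) = \<xi> [^] ((N + 1) * (a mod (N - 1)))" by (rule xi_pow_eq)
    then show ?thesis by (simp only: nat_pow_pow[OF xi_closed])
  qed
  moreover have "a mod (N - 1) < N - 1" using N_ge_2 by simp
  ultimately have "\<xi> [^] ((N + 1) * a) \<in> teichmueller R (\<xi> [^] (N + 1)) (N - 1)"
    unfolding teichmueller_def by blast
  then show ?thesis by (simp only: teichmueller_eq)
qed

lemma card_Tn: "card Tn = N"
proof -
  let ?f = "\<lambda>l :: nat. (\<xi> [^] (N + 1)) [^] l"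
  have T: "Tn = insert \<zero> (?f ` {..<N - 1})"
    unfolding teichmueller_eq[symmetric] teichmueller_def by blast
  have inj: "inj_on ?f {..<N - 1}"
  proof (rule inj_onI)
    fix a b assume *: "a \<in> {..<N - 1}" "b \<in> {..<N - 1}" "?f a = ?f b"
    then have e: "\<xi> [^] ((N + 1) * a) = \<xi> [^] ((N + 1) * b)" by (simp only: nat_pow_pow[OF xi_closed])
    have "\<xi> [^] ((N + 1) * a) \<approx>\<^sub>p \<xi> [^] ((N + 1) * b)" unfolding e by (rule cg_refl) simp
    then have "[(N + 1) * a = (N + 1) * b] (mod (N + 1) * (N - 1))"
      unfolding N2_minus_one[symmetric] by (rule xi_pow_cg_imp)
    then have "(N + 1) * (a mod (N - 1)) = (N + 1) * (b mod (N - 1))"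
      unfolding cong_def mod_mult_mult1 .
    then have "a mod (N - 1) = b mod (N - 1)" by (subst (asm) nat_mult_eq_cancel1) simp_all
    then have "[a = b] (mod N - 1)" by (simp only: cong_def)
    then show "a = b" using *(1,2) by (auto intro: cong_less_modulus_unique_nat)
  qed
  have nz: "\<zero> \<notin> ?f ` {..<N - 1}"
  proof
    assume "\<zero> \<in> ?f ` {..<N - 1}"
    then obtain l where "\<zero> = ?f l" by blast
    moreover have "?f l \<in> Units R" by (intro Units_pow_closed xi_pow_Units)
    ultimately show False using Units_notin_I[of "?f l"] zero_I by simp
  qed
  have "card Tn = Suc (card (?f ` {..<N - 1}))"
    unfolding T using nz by (intro card_insert_disjoint) auto
  also have "card (?f ` {..<N - 1}) = N - 1" by (simp only: card_image[OF inj] card_lessThan)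
  finally show ?thesis using N_ge_2 by simp
qed

lemma finite_A: "finite A"
  by (rule finite_subset[OF _ finite_R]) (use A_closed in blast)

lemma card_A: "card A = N\<^sup>2"
proof -
  let ?f = "\<lambda>(c, d). c \<oplus> \<pi> \<otimes> d"
  have "inj_on ?f (Tn \<times> Tn)"
  proof (rule inj_onI, clarify)
    fix c d c' d' assume *: "c \<in> Tn" "d \<in> Tn" "c' \<in> Tn" "d' \<in> Tn" "c \<oplus> \<pi> \<otimes> d = c' \<oplus> \<pi> \<otimes> d'"
    have cl: "c \<in> carrier R" "d \<in> carrier R" "c' \<in> carrier R" "d' \<in> carrier R" using * Tn_closed by auto
    have "c \<approx>\<^sub>p c \<oplus> \<pi> \<otimes> d" using cl by (intro cg_sym[OF cg_add_I] piI) auto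
    moreover have "c' \<oplus> \<pi> \<otimes> d' \<approx>\<^sub>p c'" using cl by (intro cg_add_I piI) auto
    ultimately have "c \<approx>\<^sub>p c'" using cg_trans[of c "c \<oplus> \<pi> \<otimes> d" c'] cl *(5) by simp
    then have cc: "c = c'" using * Tn_eq by blast
    then have "\<pi> \<otimes> d = \<pi> \<otimes> d'" using *(5) cl by simp
    then have "d \<approx>\<^sub>p d'" using cl by (simp add: pi_eq_iff)
    then show "c = c' \<and> d = d'" using cc * Tn_eq by blast
  qed
  moreover have "A = ?f ` (Tn \<times> Tn)" unfolding A_def by force
  ultimately show ?thesis by (simp add: card_image card_cartesian_product card_Tn power2_eq_square)
qed

lemma A_Int_I_E:
  assumes "r \<in> A" "r \<in> I"
  obtains d where "d \<in> Tn" "r = \<pi> \<otimes> d"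
proof -
  obtain c d where r: "c \<in> Tn" "d \<in> Tn" "r = c \<oplus> \<pi> \<otimes> d" "c \<in> carrier R" "d \<in> carrier R"
    using assms(1) by (rule A_E)
  have "r \<approx>\<^sub>p c" unfolding r(3) using r by (intro cg_add_I piI) auto
  then have "c \<in> I" using cg_I_iff[of r c] assms A_closed r by blast
  then have "c = \<zero>" using Tn_I r by blast
  then have "r = \<pi> \<otimes> d" using r by simp
  with r(2) show thesis by (rule that)
qed

lemma card_A_Int_I: "card (A \<inter> I) = N"
proof -
  have "A \<inter> I = (\<lambda>d. \<pi> \<otimes> d) ` Tn"
  proof (intro equalityI subsetI)
    fix r assume "r \<in> A \<inter> I"
    then show "r \<in> (\<lambda>d. \<pi> \<otimes> d) ` Tn" using A_Int_I_E by blast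
  next
    fix r assume "r \<in> (\<lambda>d. \<pi> \<otimes> d) ` Tn"
    then obtain d where d: "d \<in> Tn" "r = \<pi> \<otimes> d" by blast
    have "\<zero> \<oplus> \<pi> \<otimes> d \<in> A" using d Tn_subset_B by (intro A_I) auto
    then show "r \<in> A \<inter> I" using d Tn_closed[OF d(1)] by (simp add: piI)
  qed
  moreover have "inj_on (\<lambda>d. \<pi> \<otimes> d) Tn"
    by (rule inj_onI) (metis Tn_closed Tn_eq pi_eq_iff)
  ultimately show ?thesis by (simp add: card_image card_Tn)
qed

lemma A_pow: "r \<in> A \<Longrightarrow> r [^] (m :: nat) \<in> A"
  by (induction m) (simp_all add: A_mult)

text \<open>The unit group of \<open>R\<close> is finite, so the inverse of an element of
  \<open>A\<close> is a power of that element and stays in \<open>A\<close>.\<close>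

lemma Units_A: "Units (R\<lparr>carrier := A\<rparr>) = A - I"
proof (intro equalityI subsetI)
  fix r assume "r \<in> Units (R\<lparr>carrier := A\<rparr>)"
  then obtain s where "r \<in> A" "s \<in> A" "s \<otimes> r = \<one>" "r \<otimes> s = \<one>" unfolding Units_def by auto
  then have "r \<in> Units R" "r \<in> A" unfolding Units_def using A_closed by auto
  then show "r \<in> A - I" using Units_notin_I by blast
next
  fix r assume r: "r \<in> A - I"
  then have u: "r \<in> Units R" using Units_iff A_closed by blast
  have fin: "finite (Units R)" by (rule finite_subset[OF _ finite_R]) (use Units_closed in blast)
  then have pos: "card (Units R) > 0" using u by (auto simp: card_gt_0_iff)
  define s where "s = r [^] (card (Units R) - 1)"
  have rc: "r \<in> carrier R" using u by (rule Units_closed)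
  have "s \<otimes> r = r [^] Suc (card (Units R) - 1)" by (simp add: s_def)
  also have "\<dots> = \<one>" using pos units_power_order_eq_one[OF fin u] by simp
  finally have e: "s \<otimes> r = \<one>" .
  have e': "r \<otimes> s = \<one>" using e m_comm[OF rc, of s] rc by (simp add: s_def)
  have "s \<in> A" unfolding s_def using r A_pow by blast
  then show "r \<in> Units (R\<lparr>carrier := A\<rparr>)" using r e e' by (auto simp: Units_def)
qed

text \<open>The elements \<open>\<xi>\<^sup>0, \<dots>, \<xi>\<^sup>N\<close> span the \<open>N + 1\<close> different lines of the residue field
  over its subfield of order \<open>N\<close>.\<close>

lemma xi_line:
  assumes jk: "j \<le> N" "k \<le> N" "j \<noteq> k" and B: "r \<in> B" "s \<in> B"
    and eq: "\<xi> [^] j \<otimes> r \<approx>\<^sub>p \<xi> [^] k \<otimes> s"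
  shows "r \<in> I \<and> s \<in> I"
proof -
  have c [simp]: "r \<in> carrier R" "s \<in> carrier R" using B B_closed by auto
  have nI: "\<xi> [^] i \<notin> I" for i :: nat by (rule Units_notin_I[OF xi_pow_Units])
  have mem: "\<xi> [^] i \<otimes> t \<in> I \<longleftrightarrow> t \<in> I" if "t \<in> carrier R" for i :: nat and t
    using that nI I_mult[of "\<xi> [^] i" t] I_prime[of "\<xi> [^] i" t] by auto
  have iff: "r \<in> I \<longleftrightarrow> s \<in> I"
    using cg_I_iff[OF eq] mem[OF c(1)] mem[OF c(2)] by simp
  show ?thesis
  proof (rule ccontr)
    assume "\<not> (r \<in> I \<and> s \<in> I)"
    then have rs: "r \<notin> I" "s \<notin> I" using iff by auto
    have rep: "\<exists>a :: nat. \<xi> [^] ((N + 1) * a) \<approx>\<^sub>p t" if t: "t \<in> B" "t \<notin> I" for t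
    proof -
      have tc: "t \<in> carrier R" using t B_closed by blast
      have "t [^] N \<noteq> \<zero>"
        using t tc B_cg[OF t(1)] cg_I_iff[of "t [^] N" t] by auto
      then obtain a :: nat where "t [^] N = \<xi> [^] ((N + 1) * a)"
        using Tn_nonzeroE[OF B_pow_N[OF t(1)]] by metis
      then show ?thesis using B_cg[OF t(1)] by metis
    qed
    \<comment> \<open>Elements of \<open>B\<close> outside \<open>I\<close> are congruent to powers
      of \<xi> whose exponents are multiples of \<open>N + 1\<close>. Comparing exponents modulo
      \<open>N + 1\<close> thus isolates \<open>j\<close> and \<open>k\<close>, which are at most
      \<open>N\<close>.\<close>
    obtain a b :: nat where ab: "\<xi> [^] ((N + 1) * a) \<approx>\<^sub>p r" "\<xi> [^] ((N + 1) * b) \<approx>\<^sub>p s"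
      using rep B rs by blast
    have e: "\<xi> [^] i \<otimes> \<xi> [^] ((N + 1) * m) = \<xi> [^] (i + (N + 1) * m)" for i m :: nat
      by (rule nat_pow_mult) simp
    have 1: "\<xi> [^] (j + (N + 1) * a) \<approx>\<^sub>p \<xi> [^] j \<otimes> r"
      unfolding e[symmetric] using ab(1) by (intro cg_mult cg_refl) auto
    have 2: "\<xi> [^] (k + (N + 1) * b) \<approx>\<^sub>p \<xi> [^] k \<otimes> s"
      unfolding e[symmetric] using ab(2) by (intro cg_mult cg_refl) auto
    have 3: "\<xi> [^] (j + (N + 1) * a) \<approx>\<^sub>p \<xi> [^] k \<otimes> s"
      using cg_trans[OF 1 eq] by simp
    have 4: "\<xi> [^] k \<otimes> s \<approx>\<^sub>p \<xi> [^] (k + (N + 1) * b)" by (rule cg_sym[OF 2]) auto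
    have "\<xi> [^] (j + (N + 1) * a) \<approx>\<^sub>p \<xi> [^] (k + (N + 1) * b)"
      using cg_trans[OF 3 4] by simp
    then have "[j + (N + 1) * a = k + (N + 1) * b] (mod (N + 1) * (N - 1))"
      unfolding N2_minus_one[symmetric] by (rule xi_pow_cg_imp)
    then have "[j + (N + 1) * a = k + (N + 1) * b] (mod (N + 1))"
      by (rule cong_dvd_modulus_nat[OF _ dvd_triv_left])
    then have "j mod (N + 1) = k mod (N + 1)" by (simp only: cong_def mod_mult_self2)
    then show False using jk by simp
  qed
qed

end

locale momihara_family = momihara_ring +
  fixes x :: "nat \<Rightarrow> 'a"
  assumes x_closed: "j < N \<Longrightarrow> x j \<in> carrier R"
begin

definition v where "v j = \<xi> [^] j \<otimes> (\<one> \<oplus> \<pi> \<otimes> x j)" for j :: nat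

text \<open>The factors \<open>\<xi> [^] (l * (N + 1))\<close> run through the nonzero elements of
  \<open>Tn\<close>. So this is a line of \<open>I\<close> without zero, in the direction
  \<open>\<xi> [^] N\<close> that no \<open>v j\<close> with \<open>j < N\<close> has modulo
  \<open>p\<close>.\<close>

definition P where "P = {\<pi> \<otimes> \<xi> [^] (l * (N + 1) + N) | l :: nat. l < N - 1}"

definition D0 where "D0 = P \<union> (\<Union>j<N. (\<lambda>u. v j \<otimes> u) ` (A - I))"

lemma momihara_block_eq: "momihara_block R p n \<xi> x i = (\<lambda>u. \<xi> [^] i \<otimes> u) ` D0"
proof -
  have P: "{[p] \<cdot> (\<xi> [^] (l * (N + 1) + N)) | l :: nat. l < N - 1} = P"
    unfolding P_def by (simp add: add_pow_p)
  have U: "(\<Union>j<N. (\<xi> [^] j \<otimes> (\<one> \<oplus> [p] \<cdot> x j)) <# (A - I)) = (\<Union>j<N. (\<lambda>u. v j \<otimes> u) ` (A - I))"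
    by (rule SUP_cong) (auto simp: v_def l_coset_def add_pow_p x_closed)
  show ?thesis
    unfolding momihara_block_def Let_def galois_subring_eq Units_A N_eq[symmetric]
    unfolding P U unfolding D0_def[symmetric]
    by (auto simp: l_coset_def)
qed

section \<open>The modules spanned by the elements v j\<close>

lemma v_closed [simp]: "j < N \<Longrightarrow> v j \<in> carrier R"
  using x_closed by (simp add: v_def)

lemma v_cg: "j < N \<Longrightarrow> v j \<approx>\<^sub>p \<xi> [^] j"
proof -
  assume j: "j < N"
  have "\<xi> [^] j \<otimes> (\<one> \<oplus> \<pi> \<otimes> x j) \<approx>\<^sub>p \<xi> [^] j \<otimes> \<one>"
    using x_closed[OF j] by (intro cg_mult cg_refl cg_add_I piI) auto
  then show ?thesis by (simp add: v_def)
qed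

lemma v_Units:
  assumes "j < N"
  shows "v j \<in> Units R"
proof -
  have "v j \<notin> I"
    using cg_I_iff[OF v_cg[OF assms]] v_closed[OF assms] Units_notin_I[OF xi_pow_Units, of j] by simp
  then show ?thesis using v_closed[OF assms] by (simp add: Units_iff)
qed

lemma v_mult_cg: "j < N \<Longrightarrow> r \<in> carrier R \<Longrightarrow> v j \<otimes> r \<approx>\<^sub>p \<xi> [^] j \<otimes> r"
  by (intro cg_mult v_cg cg_refl) auto

lemma v_mult_I: "j < N \<Longrightarrow> r \<in> carrier R \<Longrightarrow> v j \<otimes> r \<in> I \<longleftrightarrow> r \<in> I"
  using I_mult[of "v j" r] I_prime[of "v j" r] Units_notin_I[OF v_Units] by auto

lemma v_line:
  assumes jk: "j < N" "k < N" "j \<noteq> k" and A: "r \<in> A" "s \<in> A" and eq: "v j \<otimes> r \<approx>\<^sub>p v k \<otimes> s"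
  shows "r \<in> I \<and> s \<in> I"
proof -
  have c [simp]: "r \<in> carrier R" "s \<in> carrier R" using A A_closed by auto
  have 1: "\<xi> [^] j \<otimes> r \<approx>\<^sub>p v j \<otimes> r" using jk by (intro cg_sym[OF v_mult_cg]) auto
  have 2: "\<xi> [^] j \<otimes> r \<approx>\<^sub>p v k \<otimes> s" using cg_trans[OF 1 eq] jk by simp
  have "\<xi> [^] j \<otimes> r \<approx>\<^sub>p \<xi> [^] k \<otimes> s" using cg_trans[OF 2 v_mult_cg] jk by simp
  then show ?thesis using jk A A_subset_B by (intro xi_line[of j k]) auto
qed

text \<open>The argument with lines is used twice: modulo \<open>p\<close> it moves \<open>r\<close>
  and \<open>s\<close> into \<open>I\<close>, and after cancelling \<open>\<pi>\<close> it applies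
  again to their second digits.\<close>

lemma v_direct:
  assumes jk: "j < N" "k < N" "j \<noteq> k" and A: "r \<in> A" "s \<in> A" and eq: "v j \<otimes> r = v k \<otimes> s"
  shows "r = \<zero> \<and> s = \<zero>"
proof -
  have c [simp]: "r \<in> carrier R" "s \<in> carrier R" using A A_closed by auto
  have "v j \<otimes> r \<approx>\<^sub>p v k \<otimes> s" unfolding eq using jk by (intro cg_refl) auto
  then have rs: "r \<in> I" "s \<in> I" using v_line[OF jk A] by auto
  obtain d where d: "d \<in> Tn" "r = \<pi> \<otimes> d" using A_Int_I_E[OF A(1) rs(1)] .
  obtain e where e: "e \<in> Tn" "s = \<pi> \<otimes> e" using A_Int_I_E[OF A(2) rs(2)] .
  have dc: "d \<in> carrier R" "e \<in> carrier R" using d e Tn_closed by auto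
  have "\<pi> \<otimes> (v j \<otimes> d) = \<pi> \<otimes> (v k \<otimes> e)"
    using eq jk dc unfolding d(2) e(2) by (simp add: m_lcomm[of _ \<pi>])
  then have "v j \<otimes> d \<approx>\<^sub>p v k \<otimes> e" using dc jk by (simp add: pi_eq_iff)
  then have "d \<in> I \<and> e \<in> I" using jk d e Tn_subset_A by (intro v_line[of j k]) auto
  then show ?thesis unfolding d(2) e(2) by (simp add: pi_I)
qed

text \<open>By \<open>v_direct\<close> the map from \<open>A \<times> A\<close> is injective, and
  both sides have \<open>N ^ 4\<close> elements.\<close>

lemma v_sum:
  assumes jk: "j < N" "k < N" "j \<noteq> k" and y: "y \<in> carrier R"
  shows "\<exists>r\<in>A. \<exists>s\<in>A. v j \<otimes> r \<ominus> v k \<otimes> s = y"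
proof -
  let ?f = "\<lambda>(r, s). v j \<otimes> r \<ominus> v k \<otimes> s"
  have vc: "v j \<in> carrier R" "v k \<in> carrier R" using jk by auto
  have "inj_on ?f (A \<times> A)"
  proof (rule inj_onI, clarify)
    fix r s r' s' assume *: "r \<in> A" "s \<in> A" "r' \<in> A" "s' \<in> A"
      "v j \<otimes> r \<ominus> v k \<otimes> s = v j \<otimes> r' \<ominus> v k \<otimes> s'"
    have c: "r \<in> carrier R" "s \<in> carrier R" "r' \<in> carrier R" "s' \<in> carrier R"
      using * A_closed by auto
    have "v j \<otimes> (r \<ominus> r') = (v j \<otimes> r \<ominus> v k \<otimes> s) \<ominus> (v j \<otimes> r' \<ominus> v k \<otimes> s') \<oplus> v k \<otimes> (s \<ominus> s')"
      using c vc by algebra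
    also have "\<dots> = v k \<otimes> (s \<ominus> s')" unfolding *(5) using c vc by (simp add: a_minus_def r_neg)
    finally have "r \<ominus> r' = \<zero> \<and> s \<ominus> s' = \<zero>"
      using v_direct[OF jk A_minus[OF *(1,3)] A_minus[OF *(2,4)]] by blast
    then show "r = r' \<and> s = s'" using c by simp
  qed
  moreover have "card (A \<times> A) = card (carrier R)"
    by (simp add: card_cartesian_product card_A card_R power4_eq_xxxx power2_eq_square)
  moreover have "?f ` (A \<times> A) \<subseteq> carrier R" using A_closed vc by auto
  ultimately have "?f ` (A \<times> A) = carrier R"
    using finite_R by (intro card_subset_eq) (simp_all add: card_image)
  then have "y \<in> ?f ` (A \<times> A)" using y by simp
  then show ?thesis by auto
qed

lemma P_E:
  assumes "u \<in> P"
  obtains c where "c \<in> Tn" "c \<notin> I" "u = \<pi> \<otimes> (\<xi> [^] N \<otimes> c)"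
proof -
  obtain l :: nat where l: "u = \<pi> \<otimes> \<xi> [^] (l * (N + 1) + N)" using assms unfolding P_def by blast
  have "\<xi> [^] (l * (N + 1) + N) = \<xi> [^] N \<otimes> \<xi> [^] ((N + 1) * l)"
    using nat_pow_mult[OF xi_closed, of N "(N + 1) * l"] by (simp only: add.commute mult.commute)
  then have "u = \<pi> \<otimes> (\<xi> [^] N \<otimes> \<xi> [^] ((N + 1) * l))" using l by simp
  then show thesis using that[OF xi_pow_Tn Units_notin_I[OF xi_pow_Units]] by blast
qed

lemma P_subset_I: "P \<subseteq> I"
  by (auto simp: P_def intro: piI)

text \<open>Inside \<open>I\<close>, the module of \<open>v 0\<close> has direction
  \<open>\<xi> [^] 0\<close> and \<open>P\<close> has direction \<open>\<xi> [^] N\<close>. These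
  are different lines, as \<open>xi_line\<close> admits the index \<open>N\<close> too.\<close>

lemma v0_notin_P:
  assumes "r \<in> A"
  shows "v 0 \<otimes> r \<notin> P"
proof
  have N0: "0 < N" using N_ge_2 by simp
  have rc: "r \<in> carrier R" using assms A_closed by blast
  assume P: "v 0 \<otimes> r \<in> P"
  then have "r \<in> I" using P_subset_I v_mult_I[OF N0 rc] by blast
  then obtain d where d: "d \<in> Tn" "r = \<pi> \<otimes> d" using A_Int_I_E[OF assms] by blast
  obtain c where c: "c \<in> Tn" "c \<notin> I" "v 0 \<otimes> r = \<pi> \<otimes> (\<xi> [^] N \<otimes> c)" using P_E[OF P] by blast
  have cc [simp]: "c \<in> carrier R" "d \<in> carrier R" using c d Tn_closed by auto
  have "\<pi> \<otimes> (\<xi> [^] N \<otimes> c) = \<pi> \<otimes> (v 0 \<otimes> d)"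
    unfolding c(3)[symmetric] d(2) using N0 by (simp add: m_lcomm[of _ \<pi>])
  then have 1: "\<xi> [^] N \<otimes> c \<approx>\<^sub>p v 0 \<otimes> d" using N0 by (simp add: pi_eq_iff)
  have "\<xi> [^] N \<otimes> c \<approx>\<^sub>p \<xi> [^] (0 :: nat) \<otimes> d"
    by (rule cg_trans[OF 1 v_mult_cg[OF N0]]) (use N0 in auto)
  then have "c \<in> I \<and> d \<in> I"
    using N0 c d Tn_subset_B by (intro xi_line[of N 0]) auto
  then show False using c by blast
qed

section \<open>Differences within D0\<close>

lemma D0_cases:
  assumes "u \<in> D0"
  obtains "u \<in> P" | j r where "j < N" "r \<in> A" "r \<notin> I" "u = v j \<otimes> r"
  using assms unfolding D0_def by blast

lemma D0_I: "j < N \<Longrightarrow> r \<in> A \<Longrightarrow> r \<notin> I \<Longrightarrow> v j \<otimes> r \<in> D0"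
  unfolding D0_def by blast

lemma D0_closed: "D0 \<subseteq> carrier R"
  using P_subset_I I_subset A_closed by (auto simp: D0_def)

text \<open>\<open>A\<close> splits into \<open>N\<close> residue classes of size \<open>N\<close>,
  and exactly the classes of \<open>\<zero>\<close> and \<open>\<one>\<close> are excluded.\<close>

lemma card_shifted_units: "card {r \<in> A. r \<notin> I \<and> r \<ominus> \<one> \<notin> I} = N\<^sup>2 - 2 * N"
proof -
  have sub: "{r \<in> A. r \<ominus> \<one> \<in> I} = (\<lambda>y. y \<oplus> \<one>) ` (A \<inter> I)"
  proof (intro equalityI subsetI)
    fix r assume "r \<in> {r \<in> A. r \<ominus> \<one> \<in> I}"
    then have r: "r \<in> A" "r \<ominus> \<one> \<in> I" by auto
    then have "r = (r \<ominus> \<one>) \<oplus> \<one>" using A_closed[of r] minus_eq_iff[of r \<one> "r \<ominus> \<one>"] by simp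
    moreover have "r \<ominus> \<one> \<in> A" using r by (simp add: A_minus)
    ultimately show "r \<in> (\<lambda>y. y \<oplus> \<one>) ` (A \<inter> I)" using r(2) by blast
  next
    fix r assume "r \<in> (\<lambda>y. y \<oplus> \<one>) ` (A \<inter> I)"
    then obtain y where y: "y \<in> A" "y \<in> I" "r = y \<oplus> \<one>" by blast
    have "(y \<oplus> \<one>) \<ominus> \<one> = y" using A_closed[OF y(1)] by (simp add: minus_eq_iff)
    then show "r \<in> {r \<in> A. r \<ominus> \<one> \<in> I}" using y by (simp add: A_add)
  qed
  have inj: "inj_on (\<lambda>y. y \<oplus> \<one>) (A \<inter> I)"
    by (rule inj_onI) (use A_closed in auto)
  have c: "card {r \<in> A. r \<ominus> \<one> \<in> I} = N" unfolding sub card_image[OF inj] by (rule card_A_Int_I)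
  have disj: "A \<inter> I \<inter> {r \<in> A. r \<ominus> \<one> \<in> I} = {}"
  proof (rule ccontr)
    assume "A \<inter> I \<inter> {r \<in> A. r \<ominus> \<one> \<in> I} \<noteq> {}"
    then obtain r where r: "r \<in> A" "r \<in> I" "r \<ominus> \<one> \<in> I" by blast
    have "\<one> = r \<ominus> (r \<ominus> \<one>)" using A_closed[OF r(1)] by (simp add: minus_minus_cancel)
    then show False using I_minus[OF r(2,3)] one_notin_I by simp
  qed
  have "{r \<in> A. r \<notin> I \<and> r \<ominus> \<one> \<notin> I} = A - (A \<inter> I \<union> {r \<in> A. r \<ominus> \<one> \<in> I})" by blast
  also have "card \<dots> = card A - card (A \<inter> I \<union> {r \<in> A. r \<ominus> \<one> \<in> I})"
    using finite_A by (intro card_Diff_subset) auto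
  also have "card (A \<inter> I \<union> {r \<in> A. r \<ominus> \<one> \<in> I}) = N + N"
    using finite_A disj by (subst card_Un_disjoint) (auto simp: card_A_Int_I c)
  finally show ?thesis by (simp add: card_A)
qed

text \<open>Inside the module of \<open>v 0\<close>, a difference \<open>v 0\<close> requires
  \<open>r\<close> and \<open>r \<ominus> \<one>\<close> to be units, which gives
  \<open>N^2 - 2 * N\<close> pairs. For each of the \<open>(N - 1) * (N - 2)\<close> ordered pairs
  of distinct nonzero indices, \<open>v 0\<close> has unique coordinates, giving one pair. Every
  other combination, among them those with an element of \<open>P\<close>, is excluded because
  \<open>v 0\<close> is a unit and distinct directions are independent.\<close>

lemma diff_count_D0: "diff_count R D0 D0 (v 0) = (N - 1) * (N - 2) + (N\<^sup>2 - 2 * N)"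
proof -
  have N0: "0 < N" using N_ge_2 by simp
  have v0 [simp]: "v 0 \<in> carrier R" using N0 by simp
  have v0u: "v 0 \<in> Units R" using N0 by (rule v_Units)
  define V where "V = {r \<in> A. r \<notin> I \<and> r \<ominus> \<one> \<notin> I}"
  define S1 where "S1 = (\<lambda>r. (v 0 \<otimes> r, v 0 \<otimes> (r \<ominus> \<one>))) ` V"
  define S2 where "S2 = (\<lambda>(j, k). {(v j \<otimes> r, v k \<otimes> s) | r s. r \<in> A \<and> s \<in> A \<and> v j \<otimes> r \<ominus> v k \<otimes> s = v 0})"
  define J where "J = {(j, k). j \<in> {1..<N} \<and> k \<in> {1..<N} \<and> j \<noteq> k}"
  \<comment> \<open>The coordinates of \<open>v 0\<close> with respect to \<open>v j\<close> and
    \<open>v k\<close> are units automatically: otherwise \<open>v 0\<close> would lie modulo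
    \<open>p\<close> on the line of one of them.\<close>
  have notI: "r \<notin> I \<and> s \<notin> I"
    if "j \<in> {1..<N}" "k \<in> {1..<N}" "r \<in> A" "s \<in> A" "v j \<otimes> r \<ominus> v k \<otimes> s = v 0" for j k r s
  proof -
    have jk: "0 < N" "j < N" "k < N" "0 \<noteq> j" "0 \<noteq> k" using that(1,2) by auto
    have c: "r \<in> carrier R" "s \<in> carrier R" "v j \<in> carrier R" "v k \<in> carrier R" using that A_closed jk by auto
    have sum: "v j \<otimes> r = v 0 \<oplus> v k \<otimes> s" using that(5) c by (simp add: minus_eq_iff)
    have "r \<notin> I"
    proof
      assume "r \<in> I"
      have "v 0 \<otimes> (\<ominus> \<one>) \<ominus> v k \<otimes> s = \<ominus> (v j \<otimes> r)"
        unfolding sum using c v0 by algebra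
      moreover have "\<ominus> (v j \<otimes> r) \<in> I" using \<open>r \<in> I\<close> c by (intro I_uminus I_mult) auto
      ultimately have "v 0 \<otimes> (\<ominus> \<one>) \<approx>\<^sub>p v k \<otimes> s" by (simp add: cg_def)
      then have "\<ominus> \<one> \<in> I" using v_line[OF jk(1,3,5) A_uminus_one that(4)] by blast
      then show False using I_uminus[of "\<ominus> \<one>"] one_notin_I by simp
    qed
    moreover have "s \<notin> I"
    proof
      assume "s \<in> I"
      have "v 0 \<otimes> \<one> \<ominus> v j \<otimes> r = \<ominus> (v k \<otimes> s)" unfolding sum using c v0 by algebra
      moreover have "\<ominus> (v k \<otimes> s) \<in> I" using \<open>s \<in> I\<close> c by (intro I_uminus I_mult) auto
      ultimately have "v 0 \<otimes> \<one> \<approx>\<^sub>p v j \<otimes> r" by (simp add: cg_def)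
      then have "\<one> \<in> I" using v_line[OF jk(1,2,4) one_A that(3)] by blast
      then show False using one_notin_I by simp
    qed
    ultimately show ?thesis by blast
  qed
  have SE: "{(u, w). u \<in> D0 \<and> w \<in> D0 \<and> u \<ominus> w = v 0} = S1 \<union> (\<Union>jk\<in>J. S2 jk)"
  proof (intro equalityI subsetI)
    fix z assume "z \<in> {(u, w). u \<in> D0 \<and> w \<in> D0 \<and> u \<ominus> w = v 0}"
    then obtain u w where z: "z = (u, w)" "u \<in> D0" "w \<in> D0" "u \<ominus> w = v 0" by blast
    have c: "u \<in> carrier R" "w \<in> carrier R" using z D0_closed by auto
    have sum: "u = v 0 \<oplus> w" using z(4) c by (simp add: minus_eq_iff)
    have v0I: "v 0 \<notin> I" by (rule Units_notin_I[OF v0u])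
    show "z \<in> S1 \<union> (\<Union>jk\<in>J. S2 jk)"
      using z(2)
    proof (cases rule: D0_cases)
      case 1
      then have uI: "u \<in> I" using P_subset_I by blast
      show ?thesis using z(3)
      proof (cases rule: D0_cases)
        case 1
        then have "u \<ominus> w \<in> I" using uI P_subset_I by (intro I_minus) auto
        then show ?thesis using z(4) v0I by simp
      next
        case (2 k s)
        have sc: "s \<in> carrier R" "v k \<in> carrier R" using 2 A_closed by auto
        show ?thesis
        proof (cases "k = 0")
          case True
          have "u = v 0 \<otimes> (\<one> \<oplus> s)" unfolding sum 2(4) True using sc by (simp add: r_distr)
          then show ?thesis using v0_notin_P[OF A_add[OF one_A 2(2)]] \<open>u \<in> P\<close> by simp
        next
          case False
          have "v 0 \<otimes> \<ominus> \<one> \<ominus> v k \<otimes> s = \<ominus> u" unfolding sum 2(4) using sc v0 by algebra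
          then have "v 0 \<otimes> \<ominus> \<one> \<approx>\<^sub>p v k \<otimes> s" using I_uminus[OF uI] by (simp add: cg_def)
          then have "s \<in> I" using v_line[OF N0 2(1) _ A_uminus_one 2(2)] False by blast
          then show ?thesis using 2 by blast
        qed
      qed
    next
      case (2 j r)
      note u = this
      have rc: "r \<in> carrier R" "v j \<in> carrier R" using u A_closed by auto
      show ?thesis using z(3)
      proof (cases rule: D0_cases)
        case 1
        then have wI: "w \<in> I" using P_subset_I by blast
        show ?thesis
        proof (cases "j = 0")
          case True
          have "w = u \<ominus> v 0" unfolding sum using c v0 by algebra
          also have "\<dots> = v 0 \<otimes> (r \<ominus> \<one>)" unfolding u(4) True using rc v0 by algebra
          finally show ?thesis using v0_notin_P[OF A_minus[OF u(2) one_A]] 1 by simp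
        next
          case False
          have "v j \<otimes> r \<ominus> v 0 \<otimes> \<one> = w" unfolding u(4)[symmetric] sum using c v0 by algebra
          then have "v j \<otimes> r \<approx>\<^sub>p v 0 \<otimes> \<one>" using wI by (simp add: cg_def)
          then have "r \<in> I" using v_line[OF u(1) N0 False u(2) one_A] by blast
          then show ?thesis using u by blast
        qed
      next
        case (2 k s)
        note w = this
        have sc: "s \<in> carrier R" "v k \<in> carrier R" using w A_closed by auto
        \<comment> \<open>In the three mixed cases the equation equates elements of two different
          modules, which \<open>v_direct\<close> forces to vanish.\<close>
        consider "j = 0" "k = 0" | "j = 0" "k \<noteq> 0" | "j \<noteq> 0" "k = 0" | "j \<noteq> 0" "j = k" | "j \<noteq> 0" "k \<noteq> 0" "j \<noteq> k"
          by blast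
        then show ?thesis
        proof cases
          case 1
          have "v 0 \<otimes> s = u \<ominus> v 0" unfolding sum w(4) 1 using sc v0 by algebra
          also have "\<dots> = v 0 \<otimes> (r \<ominus> \<one>)" unfolding u(4) 1 using rc v0 by algebra
          finally have "s = r \<ominus> \<one>" using v0u sc rc by simp
          then have "r \<in> V" "z = (v 0 \<otimes> r, v 0 \<otimes> (r \<ominus> \<one>))" using u w z 1 by (simp_all add: V_def)
          then show ?thesis unfolding S1_def by blast
        next
          case 2
          have "v 0 \<otimes> (r \<ominus> \<one>) = u \<ominus> v 0" unfolding u(4) 2(1) using rc v0 by algebra
          also have "\<dots> = v k \<otimes> s" unfolding sum w(4) using sc v0 by algebra
          finally have "s = \<zero>" using v_direct[OF N0 w(1) 2(2)[symmetric] A_minus[OF u(2) one_A] w(2)] by blast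
          then show ?thesis using w by simp
        next
          case 3
          have "v j \<otimes> r = v 0 \<otimes> (\<one> \<oplus> s)" unfolding u(4)[symmetric] sum w(4) 3(2) using sc by (simp add: r_distr)
          then have "r = \<zero>" using v_direct[OF u(1) N0 3(1) u(2) A_add[OF one_A w(2)]] by blast
          then show ?thesis using u by simp
        next
          case 4
          have "v j \<otimes> (r \<ominus> s) = u \<ominus> w" unfolding u(4) w(4) 4(2)[symmetric] using rc sc by algebra
          also have "\<dots> = v 0 \<otimes> \<one>" using z(4) by simp
          finally have "\<one> = \<zero>" using v_direct[OF u(1) N0 4(1) A_minus[OF u(2) w(2)] one_A] by blast
          then show ?thesis using one_notin_I zero_I by simp
        next
          case 5
          then have "(j, k) \<in> J" using u w by (simp add: J_def)
          moreover have "z \<in> S2 (j, k)" unfolding S2_def using z u w by auto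
          ultimately show ?thesis by blast
        qed
      qed
    qed
  next
    fix z assume "z \<in> S1 \<union> (\<Union>jk\<in>J. S2 jk)"
    then show "z \<in> {(u, w). u \<in> D0 \<and> w \<in> D0 \<and> u \<ominus> w = v 0}"
    proof
      assume "z \<in> S1"
      then obtain r where r: "z = (v 0 \<otimes> r, v 0 \<otimes> (r \<ominus> \<one>))" "r \<in> A" "r \<notin> I" "r \<ominus> \<one> \<notin> I"
        unfolding S1_def V_def by blast
      have "v 0 \<otimes> r \<ominus> v 0 \<otimes> (r \<ominus> \<one>) = v 0" using A_closed[OF r(2)] v0 by algebra
      then show ?thesis using r N0 D0_I A_minus[OF r(2) one_A] by simp
    next
      assume "z \<in> (\<Union>jk\<in>J. S2 jk)"
      then obtain j k r s where z: "j \<in> {1..<N}" "k \<in> {1..<N}" "z = (v j \<otimes> r, v k \<otimes> s)" "r \<in> A" "s \<in> A"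
        "v j \<otimes> r \<ominus> v k \<otimes> s = v 0" unfolding S2_def J_def by auto
      then show ?thesis using notI[OF z(1,2,4,5,6)] D0_I by simp
    qed
  qed
  have "card (S1 \<union> (\<Union>jk\<in>J. S2 jk)) = card S1 + card (\<Union>jk\<in>J. S2 jk)"
  proof (rule card_Un_disjoint)
    have sub: "S1 \<union> (\<Union>jk\<in>J. S2 jk) \<subseteq> D0 \<times> D0"
      unfolding SE[symmetric] by auto
    have "finite (D0 \<times> D0)" using finite_subset[OF D0_closed finite_R] by blast
    then show "finite S1" "finite (\<Union>jk\<in>J. S2 jk)" using sub finite_subset by (metis Un_subset_iff)+
    show "S1 \<inter> (\<Union>jk\<in>J. S2 jk) = {}"
    proof (rule ccontr)
      assume "S1 \<inter> (\<Union>jk\<in>J. S2 jk) \<noteq> {}"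
      then obtain z jk where "z \<in> S1" "jk \<in> J" "z \<in> S2 jk" by blast
      then obtain r' j k r s where *: "r' \<in> A" "r' \<notin> I" "j \<in> {1..<N}" "r \<in> A" "v 0 \<otimes> r' = v j \<otimes> r"
        unfolding S1_def S2_def J_def V_def by auto
      then have "r' = \<zero>" using v_direct[OF N0 _ _ *(1,4,5)] by auto
      then show False using *(2) by simp
    qed
  qed
  moreover have "card S1 = N\<^sup>2 - 2 * N"
  proof -
    have "inj_on (\<lambda>r. (v 0 \<otimes> r, v 0 \<otimes> (r \<ominus> \<one>))) V"
      by (rule inj_onI) (use v0u A_closed in \<open>auto simp: V_def\<close>)
    then show ?thesis unfolding S1_def using card_shifted_units by (simp add: card_image V_def)
  qed
  moreover have "card (\<Union>jk\<in>J. S2 jk) = (N - 1) * (N - 2)"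
  proof -
    have one: "\<exists>z. S2 jk = {z}" if "jk \<in> J" for jk
    proof -
      obtain j k where e: "jk = (j, k)" by fastforce
      have jk: "j < N" "k < N" "j \<noteq> k" using that e by (auto simp: J_def)
      obtain r s where rs: "r \<in> A" "s \<in> A" "v j \<otimes> r \<ominus> v k \<otimes> s = v 0" using v_sum[OF jk v0] by blast
      have "r' = r \<and> s' = s" if "r' \<in> A" "s' \<in> A" "v j \<otimes> r' \<ominus> v k \<otimes> s' = v 0" for r' s'
      proof -
        have c: "r \<in> carrier R" "s \<in> carrier R" "r' \<in> carrier R" "s' \<in> carrier R" "v j \<in> carrier R" "v k \<in> carrier R"
          using rs that A_closed jk by auto
        have "v j \<otimes> (r' \<ominus> r) = (v j \<otimes> r' \<ominus> v k \<otimes> s') \<ominus> (v j \<otimes> r \<ominus> v k \<otimes> s) \<oplus> v k \<otimes> (s' \<ominus> s)"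
          using c by algebra
        also have "\<dots> = v k \<otimes> (s' \<ominus> s)" unfolding that(3) rs(3) using c by (simp add: a_minus_def r_neg)
        finally have "r' \<ominus> r = \<zero> \<and> s' \<ominus> s = \<zero>"
          using v_direct[OF jk A_minus[OF that(1) rs(1)] A_minus[OF that(2) rs(2)]] by blast
        then show ?thesis using c by simp
      qed
      then have "S2 jk = {(v j \<otimes> r, v k \<otimes> s)}" unfolding S2_def e using rs by blast
      then show ?thesis by blast
    qed
    have finJ: "finite J" by (rule finite_subset[of _ "{..<N} \<times> {..<N}"]) (auto simp: J_def)
    have "card (\<Union>jk\<in>J. S2 jk) = (\<Sum>jk\<in>J. card (S2 jk))"
    proof (rule card_UN_disjoint[OF finJ])
      show "\<forall>jk\<in>J. finite (S2 jk)" using one by (metis finite.emptyI finite_insert)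
      show "\<forall>jk\<in>J. \<forall>jk'\<in>J. jk \<noteq> jk' \<longrightarrow> S2 jk \<inter> S2 jk' = {}"
      proof (intro ballI impI, rule ccontr)
        fix jk jk' assume *: "jk \<in> J" "jk' \<in> J" "jk \<noteq> jk'" "S2 jk \<inter> S2 jk' \<noteq> {}"
        obtain j k j' k' where e: "jk = (j, k)" "jk' = (j', k')" by fastforce
        have b: "j \<in> {1..<N}" "k \<in> {1..<N}" "j' \<in> {1..<N}" "k' \<in> {1..<N}" using * e by (auto simp: J_def)
        obtain r s r' s' where rs: "r \<in> A" "s \<in> A" "v j \<otimes> r \<ominus> v k \<otimes> s = v 0" "r' \<in> A" "s' \<in> A"
          "v j \<otimes> r = v j' \<otimes> r'" "v k \<otimes> s = v k' \<otimes> s'"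
          using *(4) unfolding e S2_def by auto
        have n: "r \<notin> I" "s \<notin> I" using notI[OF b(1,2) rs(1,2,3)] by auto
        have "j = j'"
        proof (rule ccontr)
          assume "j \<noteq> j'"
          then have "r = \<zero>" using v_direct[OF _ _ _ rs(1,4,6)] b by auto
          then show False using n by simp
        qed
        moreover have "k = k'"
        proof (rule ccontr)
          assume "k \<noteq> k'"
          then have "s = \<zero>" using v_direct[OF _ _ _ rs(2,5,7)] b by auto
          then show False using n by simp
        qed
        ultimately show False using * e by simp
      qed
    qed
    also have "\<dots> = (\<Sum>jk\<in>J. 1)"
    proof (rule sum.cong)
      fix jk assume "jk \<in> J"
      then obtain z where "S2 jk = {z}" using one by blast
      then show "card (S2 jk) = 1" by simp
    qed simp
    also have "\<dots> = card J" by simp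
    also have "card J = (N - 1) * (N - 1) - (N - 1)"
    proof -
      have J: "J = {1..<N} \<times> {1..<N} - (\<lambda>j. (j, j)) ` {1..<N}" by (auto simp: J_def)
      show ?thesis unfolding J
        by (subst card_Diff_subset) (auto simp: card_cartesian_product card_image inj_on_def)
    qed
    also have "\<dots> = (N - 1) * (N - 2)" by (simp add: diff_mult_distrib2)
    finally show ?thesis .
  qed
  ultimately show ?thesis unfolding diff_count_def SE by simp
qed

subsection \<open>Triples contained in no block, for \<open>N = 2\<close>\<close>

text \<open>At \<open>N = 2\<close> the number in \<open>diff_count_D0\<close> is zero, so
  \<open>v 0\<close> is not a difference of \<open>D0\<close>; multiplication by
  \<open>\<xi> [^] i\<close> carries this to the other base blocks.\<close>

lemma block_no_difference:
  assumes N: "N = 2" and uw: "u \<in> momihara_block R p n \<xi> x i" "w \<in> momihara_block R p n \<xi> x i"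
  shows "u \<ominus> w \<noteq> \<xi> [^] i \<otimes> v 0"
proof
  assume eq: "u \<ominus> w = \<xi> [^] i \<otimes> v 0"
  obtain u' w' where *: "u' \<in> D0" "w' \<in> D0" "u = \<xi> [^] i \<otimes> u'" "w = \<xi> [^] i \<otimes> w'"
    using uw unfolding momihara_block_eq by blast
  have c: "u' \<in> carrier R" "w' \<in> carrier R" "v 0 \<in> carrier R" using * D0_closed N by auto
  have "\<xi> [^] i \<otimes> (u' \<ominus> w') = \<xi> [^] i \<otimes> v 0"
  proof -
    have "\<xi> [^] i \<otimes> (u' \<ominus> w') = u \<ominus> w" unfolding *(3,4) using c xi_pow_closed[of i] by algebra
    then show ?thesis using eq by simp
  qed
  then have e: "u' \<ominus> w' = v 0" using c xi_pow_Units[of i] by simp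
  have "finite {(u, w). u \<in> D0 \<and> w \<in> D0 \<and> u \<ominus> w = v 0}"
    by (rule finite_subset[of _ "D0 \<times> D0"]) (use finite_subset[OF D0_closed finite_R] in auto)
  moreover have "card {(u, w). u \<in> D0 \<and> w \<in> D0 \<and> u \<ominus> w = v 0} = 0"
    using diff_count_D0 N by (simp add: diff_count_def)
  ultimately have "{(u, w). u \<in> D0 \<and> w \<in> D0 \<and> u \<ominus> w = v 0} = {}" by simp
  then show False using * e by blast
qed

lemma coset_difference:
  assumes "S \<subseteq> carrier R" "h \<in> carrier R" "y \<in> S +> h" "z \<in> S +> h"
  obtains u w where "u \<in> S" "w \<in> S" "y \<ominus> z = u \<ominus> w"
proof -
  obtain u w where *: "u \<in> S" "w \<in> S" "y = u \<oplus> h" "z = w \<oplus> h"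
    using assms(3,4) unfolding a_coset_conv by blast
  have "y \<ominus> z = u \<ominus> w"
    unfolding *(3,4) using subsetD[OF assms(1) *(1)] subsetD[OF assms(1) *(2)] assms(2) by algebra
  with *(1,2) show thesis by (rule that)
qed

lemma block_closed: "momihara_block R p n \<xi> x i \<subseteq> carrier R"
  unfolding momihara_block_eq using D0_closed by auto

lemma coset_no_difference:
  assumes N: "N = 2" and h: "h \<in> carrier R"
    and yz: "y \<in> momihara_block R p n \<xi> x i +> h" "z \<in> momihara_block R p n \<xi> x i +> h"
  shows "y \<ominus> z \<noteq> \<xi> [^] i \<otimes> v 0"
proof -
  obtain u w where "u \<in> momihara_block R p n \<xi> x i" "w \<in> momihara_block R p n \<xi> x i" "y \<ominus> z = u \<ominus> w"
    by (rule coset_difference[OF block_closed h yz])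
  then show ?thesis using block_no_difference[OF N] by simp
qed

lemma momihara_block_0: "momihara_block R p n \<xi> x 0 = D0"
proof -
  have "(\<lambda>u. \<xi> [^] (0 :: nat) \<otimes> u) ` D0 = (\<lambda>u. u) ` D0"
    by (rule image_cong) (use D0_closed in auto)
  then show ?thesis unfolding momihara_block_eq by simp
qed

text \<open>Each of the three differences rules out one of the three base blocks.\<close>

lemma rainbow_not_covered:
  assumes N: "N = 2" and i: "i < N + 1" and h: "h \<in> carrier R"
    and d: "y0 \<ominus> z0 = v 0" "y1 \<ominus> z1 = \<xi> \<otimes> v 0" "y2 \<ominus> z2 = \<xi> [^] (2 :: nat) \<otimes> v 0"
  shows "\<not> {y0, z0, y1, z1, y2, z2} \<subseteq> momihara_block R p n \<xi> x i +> h"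
proof
  assume sub: "{y0, z0, y1, z1, y2, z2} \<subseteq> momihara_block R p n \<xi> x i +> h"
  have v0: "v 0 \<in> carrier R" using N by simp
  have "i = 0 \<or> i = 1 \<or> i = 2" using i N by auto
  then show False
  proof (elim disjE)
    assume "i = 0"
    then have "y0 \<ominus> z0 = \<xi> [^] i \<otimes> v 0" using d(1) v0 by simp
    then show False using coset_no_difference[OF N h, of y0 i z0] sub by blast
  next
    assume "i = 1"
    then have "y1 \<ominus> z1 = \<xi> [^] i \<otimes> v 0" using d(2) by simp
    then show False using coset_no_difference[OF N h, of y1 i z1] sub by blast
  next
    assume "i = 2"
    then have "y2 \<ominus> z2 = \<xi> [^] i \<otimes> v 0" using d(3) by (simp only:)
    then show False using coset_no_difference[OF N h, of y2 i z2] sub by blast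
  qed
qed

section \<open>Arithmetic with a primitive cube root of unity\<close>

lemma xi_minus_one_Units:
  assumes "N = 2"
  shows "\<xi> \<ominus> \<one> \<in> Units R"
proof -
  have "\<xi> \<ominus> \<one> \<notin> I"
  proof
    assume "\<xi> \<ominus> \<one> \<in> I"
    then have "\<xi> [^] (1 :: nat) \<approx>\<^sub>p \<one>" by (simp add: cg_def)
    then have "N\<^sup>2 - 1 dvd 1" by (rule xi_pow_cg_one)
    then show False using assms by simp
  qed
  then show ?thesis by (simp add: Units_iff)
qed

lemma N2_facts:
  assumes N: "N = 2"
  shows "\<xi> \<otimes> (\<xi> \<otimes> \<xi>) = \<one>" "\<one> \<oplus> \<xi> \<oplus> \<xi> \<otimes> \<xi> = \<zero>" "\<pi> = \<one> \<oplus> \<one>" "\<pi> \<oplus> \<pi> = \<zero>"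
proof -
  have "\<xi> [^] (3 :: nat) = \<one>" unfolding xi_pow_eq_one_iff using N by simp
  then show 1: "\<xi> \<otimes> (\<xi> \<otimes> \<xi>) = \<one>" by (simp add: numeral_3_eq_3 m_assoc)
  note u = xi_minus_one_Units[OF N]
  have "(\<xi> \<ominus> \<one>) \<otimes> (\<one> \<oplus> \<xi> \<oplus> \<xi> \<otimes> \<xi>) = \<xi> \<otimes> (\<xi> \<otimes> \<xi>) \<ominus> \<one>" using xi_closed by algebra
  also have "\<dots> = (\<xi> \<ominus> \<one>) \<otimes> \<zero>" unfolding 1 by (simp add: a_minus_def r_neg)
  finally show "\<one> \<oplus> \<xi> \<oplus> \<xi> \<otimes> \<xi> = \<zero>" by (subst (asm) Units_l_cancel[OF u]) simp_all
  have "p = 2"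
  proof -
    have "p dvd N" using n_pos by (simp add: N_eq)
    then show ?thesis using N prime_ge_2_nat[OF prime_p] dvd_imp_le[of p 2] by simp
  qed
  then have "[p] \<cdot> \<one> = \<one> \<oplus> \<one>" by (simp add: numeral_2_eq_2)
  then show p2: "\<pi> = \<one> \<oplus> \<one>" by (simp only: \<pi>_def)
  have "\<pi> \<oplus> \<pi> = (\<one> \<oplus> \<one>) \<otimes> \<pi>" by (simp add: l_distr)
  also have "\<dots> = \<zero>" unfolding p2[symmetric] by (rule pi_pi)
  finally show "\<pi> \<oplus> \<pi> = \<zero>" .
qed

text \<open>After translation by a suitable \<open>u\<close> the three points lie in the three parts
  of \<open>D0\<close>: \<open>u\<close> in the module of \<open>v 1\<close>,
  \<open>u \<ominus> \<xi> \<otimes> v 0\<close> in \<open>P\<close>, and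
  \<open>u \<ominus> \<xi> \<otimes> \<xi> \<otimes> v 0\<close> in the module of
  \<open>v 0\<close>. The condition linking \<open>x 1\<close> to \<open>x 0\<close> is what puts
  \<open>u\<close> on the first of these.\<close>

lemma special_triple_covered:
  assumes N: "N = 2" and r: "r \<in> A" "\<pi> \<otimes> x 1 = \<pi> \<otimes> r \<oplus> (\<pi> \<otimes> x 0 \<oplus> \<pi> \<otimes> (\<xi> \<otimes> \<xi>))"
  shows "\<exists>h\<in>carrier R. {\<zero>, \<ominus> (\<xi> \<otimes> v 0), \<ominus> (\<xi> \<otimes> \<xi> \<otimes> v 0)} \<subseteq> D0 +> h"
proof -
  note f = N2_facts[OF N]
  have x0: "x 0 \<in> carrier R" and rc: "r \<in> carrier R" and v0: "v 0 \<in> carrier R"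
    using x_closed[of 0] A_closed[OF r(1)] N by auto
  note c = x0 rc v0 xi_closed pi_closed
  have v0_eq: "v 0 = \<one> \<oplus> \<pi> \<otimes> x 0" using x0 by (simp add: v_def)
  have v1_eq: "v 1 = \<xi> \<otimes> (\<one> \<oplus> (\<pi> \<otimes> r \<oplus> (\<pi> \<otimes> x 0 \<oplus> \<pi> \<otimes> (\<xi> \<otimes> \<xi>))))"
    unfolding v_def r(2) by simp
  have m1: "\<ominus> \<pi> = \<pi>" using f(4) by (intro minus_equality) simp_all
  \<comment> \<open>Since \<open>\<pi>\<close> is \<open>\<one> \<oplus> \<one>\<close>, subtracting
    \<open>\<xi> \<otimes> v 0\<close> leaves
    \<open>v 0 \<otimes> \<pi> \<otimes> (\<one> \<ominus> \<xi>)\<close>, which lies in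
    \<open>I\<close>; subtracting \<open>\<xi> \<otimes> \<xi> \<otimes> v 0\<close> leaves three
    times \<open>v 0\<close>, which is its negative.\<close>
  define u where "u = v 0 \<otimes> (\<pi> \<ominus> \<xi>)"
  have uc: "u \<in> carrier R" using c by (simp add: u_def)
  have u1: "u = v 1 \<otimes> (\<ominus> \<one> \<oplus> \<pi> \<otimes> r)"
  proof -
    let ?w = "\<pi> \<otimes> r"
    have wc: "?w \<in> carrier R" using rc by simp
    have "v 1 \<otimes> (\<ominus> \<one> \<oplus> \<pi> \<otimes> r)
        = \<ominus> \<xi> \<ominus> \<xi> \<otimes> (\<pi> \<otimes> x 0) \<oplus> (\<ominus> \<pi>) \<otimes> (\<xi> \<otimes> (\<xi> \<otimes> \<xi>))
          \<oplus> (\<pi> \<otimes> \<pi>) \<otimes> (\<xi> \<otimes> ((r \<oplus> (x 0 \<oplus> \<xi> \<otimes> \<xi>)) \<otimes> r))"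
      unfolding v1_eq using c by algebra
    also have "\<dots> = \<ominus> \<xi> \<ominus> \<xi> \<otimes> (\<pi> \<otimes> x 0) \<oplus> \<pi>"
      unfolding f(1) m1 pi_pi using c by simp
    also have "\<dots> = (\<one> \<oplus> \<pi> \<otimes> x 0) \<otimes> (\<pi> \<ominus> \<xi>) \<ominus> (\<pi> \<otimes> \<pi>) \<otimes> x 0" using c by algebra
    also have "\<dots> = u" unfolding pi_pi u_def v0_eq using c by (simp add: a_minus_def)
    finally show ?thesis by simp
  qed
  have uD: "u \<in> D0"
  proof -
    have rB: "r \<in> B" using r A_subset_B by blast
    have "\<zero> \<oplus> \<pi> \<otimes> r \<in> A" using rB by (intro A_I) simp_all
    then have A: "\<ominus> \<one> \<oplus> \<pi> \<otimes> r \<in> A" using A_add[OF A_uminus_one, of "\<pi> \<otimes> r"] rc by simp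
    have "\<ominus> \<one> \<oplus> \<pi> \<otimes> r \<approx>\<^sub>p \<ominus> \<one>" using rc by (intro cg_add_I piI) simp_all
    moreover have "\<ominus> \<one> \<notin> I" using I_uminus[of "\<ominus> \<one>"] one_notin_I by auto
    ultimately have "\<ominus> \<one> \<oplus> \<pi> \<otimes> r \<notin> I" using cg_I_iff[of "\<ominus> \<one> \<oplus> \<pi> \<otimes> r" "\<ominus> \<one>"] rc by simp
    then show ?thesis unfolding u1 using A N by (intro D0_I) simp_all
  qed
  have xi2: "\<one> \<oplus> \<xi> = \<ominus> (\<xi> \<otimes> \<xi>)" using f(2) xi_closed by (simp add: minus_equality)
  \<comment> \<open>At \<open>N = 2\<close> the only admissible \<open>l\<close> is
    \<open>0\<close>, so \<open>P\<close> consists of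
    \<open>\<pi> \<otimes> (\<xi> \<otimes> \<xi>)\<close> alone.\<close>
  have w1: "u \<ominus> \<xi> \<otimes> v 0 = \<pi> \<otimes> \<xi> [^] (0 * (N + 1) + N)"
  proof -
    have "u \<ominus> \<xi> \<otimes> v 0 = v 0 \<otimes> (\<pi> \<ominus> (\<one> \<oplus> \<one>) \<otimes> \<xi>)" unfolding u_def using c by algebra
    also have "\<dots> = v 0 \<otimes> (\<pi> \<ominus> \<pi> \<otimes> \<xi>)" unfolding f(3)[symmetric] ..
    also have "\<dots> = \<pi> \<otimes> (\<one> \<oplus> \<xi>) \<oplus> (\<pi> \<otimes> \<pi>) \<otimes> (x 0 \<otimes> (\<one> \<ominus> \<xi>)) \<ominus> (\<pi> \<oplus> \<pi>) \<otimes> \<xi>"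
      unfolding v0_eq using c by algebra
    also have "\<dots> = \<pi> \<otimes> (\<one> \<oplus> \<xi>)" unfolding pi_pi f(4) using c by (simp add: a_minus_def)
    also have "\<dots> = (\<ominus> \<pi>) \<otimes> (\<xi> \<otimes> \<xi>)" unfolding xi2 using c by algebra
    also have "\<dots> = \<pi> \<otimes> \<xi> [^] (0 * (N + 1) + N)" unfolding m1 N by (simp add: numeral_2_eq_2)
    finally show ?thesis .
  qed
  have w1D: "u \<ominus> \<xi> \<otimes> v 0 \<in> D0"
  proof -
    have "u \<ominus> \<xi> \<otimes> v 0 \<in> P" unfolding w1 P_def using N by (intro CollectI exI[of _ 0]) simp
    then show ?thesis unfolding D0_def by blast
  qed
  have w2: "u \<ominus> \<xi> \<otimes> \<xi> \<otimes> v 0 = v 0 \<otimes> (\<ominus> \<one>)"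
  proof -
    have "u \<ominus> \<xi> \<otimes> \<xi> \<otimes> v 0 = v 0 \<otimes> (\<pi> \<oplus> \<one> \<ominus> (\<one> \<oplus> \<xi> \<oplus> \<xi> \<otimes> \<xi>))"
      unfolding u_def using c by algebra
    also have "\<dots> = v 0 \<otimes> (\<pi> \<oplus> \<one>)" unfolding f(2) using c by (simp add: a_minus_def)
    also have "\<dots> = v 0 \<otimes> ((\<pi> \<oplus> \<pi>) \<ominus> \<one> \<oplus> ((\<one> \<oplus> \<one>) \<ominus> \<pi>))" using c by algebra
    also have "\<dots> = v 0 \<otimes> (\<ominus> \<one>)" unfolding f(4) f(3)[symmetric] using c by (simp add: a_minus_def r_neg)
    finally show ?thesis .
  qed
  have w2D: "u \<ominus> \<xi> \<otimes> \<xi> \<otimes> v 0 \<in> D0"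
  proof -
    have "\<ominus> \<one> \<notin> I" using I_uminus[of "\<ominus> \<one>"] one_notin_I by auto
    then show ?thesis unfolding w2 using A_uminus_one N by (intro D0_I) simp_all
  qed
  have "y \<in> D0 +> (\<ominus> u)" if "u \<oplus> y \<in> D0" "y \<in> carrier R" for y
  proof -
    have "y = (u \<oplus> y) \<oplus> \<ominus> u" using that uc by algebra
    then show ?thesis unfolding a_coset_conv using that by blast
  qed
  moreover have "u \<oplus> \<zero> \<in> D0" using uD uc by simp
  ultimately have "{\<zero>, \<ominus> (\<xi> \<otimes> v 0), \<ominus> (\<xi> \<otimes> \<xi> \<otimes> v 0)} \<subseteq> D0 +> (\<ominus> u)"
    using w1D w2D c by (simp add: a_minus_def)
  then show ?thesis using uc by blast
qed

text \<open>The square of \<xi> is not congruent to an element of \<open>A\<close>, so adding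
  \<open>\<pi> \<otimes> (\<xi> \<otimes> \<xi>)\<close> leaves the coset of
  \<open>\<pi> \<otimes> x 0\<close>. The new coset must be represented by \<open>x 1\<close>, the
  only other representative at \<open>N = 2\<close>.\<close>

lemma representative_direction:
  assumes N: "N = 2"
    and rep: "representative_system R (multiples R p (carrier R))
      (multiples R p (galois_subring R p n \<xi>)) (multiples R p (x ` {..<N}))"
  shows "\<exists>r\<in>A. \<pi> \<otimes> x 1 = \<pi> \<otimes> r \<oplus> (\<pi> \<otimes> x 0 \<oplus> \<pi> \<otimes> (\<xi> \<otimes> \<xi>))"
proof -
  let ?Y = "\<pi> \<otimes> x 0 \<oplus> \<pi> \<otimes> (\<xi> \<otimes> \<xi>)"
  have x0: "x 0 \<in> carrier R" using x_closed N by simp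
  have "?Y \<in> I" using x0 by (intro I_add piI) simp_all
  then obtain s where s: "s \<in> multiples R p (x ` {..<N})" "s \<in> multiples R p A +> ?Y"
    using rep unfolding representative_system_def multiples_eq_I galois_subring_eq by blast
  obtain r where r: "r \<in> A" "s = \<pi> \<otimes> r \<oplus> ?Y"
  proof -
    obtain m where m: "m \<in> multiples R p A" "s = m \<oplus> ?Y" using s(2) unfolding a_coset_conv by blast
    then obtain r where "r \<in> A" "m = [p] \<cdot> r" unfolding multiples_def by blast
    then show thesis using that m add_pow_p A_closed by metis
  qed
  have rc: "r \<in> carrier R" using r A_closed by blast
  obtain j where j: "j < N" "s = \<pi> \<otimes> x j"
  proof -
    obtain j where "j < N" "s = [p] \<cdot> (x j)" using s(1) unfolding multiples_def by blast
    then show thesis using that add_pow_p x_closed by metis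
  qed
  have "j \<noteq> 0"
  proof
    assume "j = 0"
    then have eq: "\<pi> \<otimes> x 0 = \<pi> \<otimes> r \<oplus> ?Y" using j(2) r(2) by simp
    have "\<pi> \<otimes> r \<ominus> \<pi> \<otimes> (\<ominus> (\<xi> \<otimes> \<xi>)) = (\<pi> \<otimes> r \<oplus> ?Y) \<ominus> \<pi> \<otimes> x 0"
      using rc x0 xi_closed pi_closed by algebra
    also have "\<dots> = \<zero>" unfolding eq[symmetric] using x0 by (simp add: a_minus_def r_neg)
    finally have "\<pi> \<otimes> r = \<pi> \<otimes> (\<ominus> (\<xi> \<otimes> \<xi>))" using rc by simp
    then have "r \<approx>\<^sub>p \<ominus> (\<xi> \<otimes> \<xi>)" using rc by (subst (asm) pi_eq_iff) simp_all
    then have "\<xi> [^] (0 :: nat) \<otimes> r \<approx>\<^sub>p \<xi> [^] (2 :: nat) \<otimes> \<ominus> \<one>"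
      using rc by (simp add: numeral_2_eq_2 r_minus)
    then have "\<ominus> \<one> \<in> I"
      using xi_line[of 0 2 r "\<ominus> \<one>"] N r(1) A_subset_B B_uminus_one by auto
    then show False using I_uminus[of "\<ominus> \<one>"] one_notin_I by simp
  qed
  then have "j = 1" using j(1) N by simp
  then have "\<pi> \<otimes> x 1 = \<pi> \<otimes> r \<oplus> ?Y" using j(2) r(2) by simp
  then show ?thesis using r(1) by blast
qed

text \<open>The points are \<open>v 0\<close>, \<open>\<ominus> (\<xi> \<otimes> v 0)\<close> and
  \<open>\<ominus> (\<xi> \<otimes> \<xi> \<otimes> v 0)\<close>. Because \<open>\<one> \<oplus>
  \<xi> \<oplus> \<xi> \<otimes> \<xi> = \<zero>\<close>, each of the first two triples shows all
  three differences \<open>\<xi> [^] i \<otimes> v 0\<close>, one forbidden for each base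
  block.\<close>

lemma triples_not_transitive:
  assumes N: "N = 2"
    and rep: "representative_system R (multiples R p (carrier R))
      (multiples R p (galois_subring R p n \<xi>)) (multiples R p (x ` {..<N}))"
  obtains y1 y2 y3 where "y1 \<in> carrier R" "y2 \<in> carrier R" "y3 \<in> carrier R" "distinct [\<zero>, y1, y2, y3]"
    "\<And>i h. i < N + 1 \<Longrightarrow> h \<in> carrier R \<Longrightarrow> \<not> {\<zero>, y1, y2} \<subseteq> momihara_block R p n \<xi> x i +> h"
    "\<And>i h. i < N + 1 \<Longrightarrow> h \<in> carrier R \<Longrightarrow> \<not> {\<zero>, y1, y3} \<subseteq> momihara_block R p n \<xi> x i +> h"
    "\<exists>h\<in>carrier R. {\<zero>, y2, y3} \<subseteq> momihara_block R p n \<xi> x 0 +> h"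
proof -
  note f = N2_facts[OF N]
  have v0: "v 0 \<in> carrier R" using N by simp
  have v0u: "v 0 \<in> Units R" using N by (intro v_Units) simp
  note c = v0 xi_closed
  let ?y2 = "\<ominus> (\<xi> \<otimes> v 0)" and ?y3 = "\<ominus> (\<xi> \<otimes> \<xi> \<otimes> v 0)"
  have yc: "?y2 \<in> carrier R" "?y3 \<in> carrier R" using v0 by simp_all
  have sq: "\<xi> [^] (2 :: nat) = \<xi> \<otimes> \<xi>" by (simp add: numeral_2_eq_2)
  have d: "v 0 \<ominus> \<zero> = v 0" "\<zero> \<ominus> ?y2 = \<xi> \<otimes> v 0" "\<zero> \<ominus> ?y3 = \<xi> [^] (2 :: nat) \<otimes> v 0"
    using v0 by (simp_all add: a_minus_def sq)
  have d21: "?y2 \<ominus> v 0 = \<xi> [^] (2 :: nat) \<otimes> v 0"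
  proof -
    have "?y2 \<ominus> v 0 = \<xi> \<otimes> \<xi> \<otimes> v 0 \<ominus> (\<one> \<oplus> \<xi> \<oplus> \<xi> \<otimes> \<xi>) \<otimes> v 0" using c by algebra
    then show ?thesis unfolding f(2) sq using v0 by (simp add: a_minus_def)
  qed
  have d31: "?y3 \<ominus> v 0 = \<xi> \<otimes> v 0"
  proof -
    have "?y3 \<ominus> v 0 = \<xi> \<otimes> v 0 \<ominus> (\<one> \<oplus> \<xi> \<oplus> \<xi> \<otimes> \<xi>) \<otimes> v 0" using c by algebra
    then show ?thesis unfolding f(2) using v0 by (simp add: a_minus_def)
  qed
  have d32: "?y2 \<ominus> ?y3 = (\<xi> \<ominus> \<one>) \<otimes> (\<xi> \<otimes> v 0)" using c by algebra
  have nz: "u \<otimes> v 0 \<noteq> \<zero>" if "u \<in> Units R" for u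
    using Units_notin_I[OF Units_m_closed[OF that v0u]] zero_I by metis
  have "(\<xi> \<ominus> \<one>) \<otimes> (\<xi> \<otimes> v 0) \<noteq> \<zero>"
    using nz[OF Units_m_closed[OF xi_minus_one_Units[OF N] xi_Units]] c by (simp add: m_assoc)
  moreover have "v 0 \<noteq> \<zero>" using nz[OF Units_one_closed] v0 by simp
  moreover have "\<xi> \<otimes> v 0 \<noteq> \<zero>" "\<xi> [^] (2 :: nat) \<otimes> v 0 \<noteq> \<zero>"
    using nz[OF xi_Units] nz[OF xi_pow_Units] by simp_all
  moreover have "y \<ominus> y = \<zero>" if "y \<in> carrier R" for y using that by (simp add: a_minus_def r_neg)
  ultimately have dist: "distinct [\<zero>, v 0, ?y2, ?y3]"
    using d d21 d31 d32 v0 yc zero_closed unfolding distinct.simps by (metis empty_iff empty_set insert_iff list.set(2))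
  obtain r where "r \<in> A" "\<pi> \<otimes> x 1 = \<pi> \<otimes> r \<oplus> (\<pi> \<otimes> x 0 \<oplus> \<pi> \<otimes> (\<xi> \<otimes> \<xi>))"
    using representative_direction[OF N rep] by blast
  then have cov: "\<exists>h\<in>carrier R. {\<zero>, ?y2, ?y3} \<subseteq> momihara_block R p n \<xi> x 0 +> h"
    unfolding momihara_block_0 by (rule special_triple_covered[OF N])
  show thesis
  proof (rule that[OF v0 yc dist])
    fix i h assume "i < N + 1" "h \<in> carrier R"
    then show "\<not> {\<zero>, v 0, ?y2} \<subseteq> momihara_block R p n \<xi> x i +> h"
      using rainbow_not_covered[OF N _ _ d(1,2) d21] by blast
  next
    fix i h assume "i < N + 1" "h \<in> carrier R"
    then show "\<not> {\<zero>, v 0, ?y3} \<subseteq> momihara_block R p n \<xi> x i +> h"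
      using rainbow_not_covered[OF N _ _ d(1) d31 d(3)] by blast
  qed (rule cov)
qed

end

section \<open>Galois rings\<close>

lemma add_pow_residue_ring:
  assumes "m > 1" "a \<in> carrier (residue_ring m)"
  shows "[(j :: nat)] \<cdot>\<^bsub>residue_ring m\<^esub> a = (int j * a) mod m"
proof (induction j)
  case 0
  interpret residues m "residue_ring m" by unfold_locales (use assms in simp_all)
  show ?case by (simp add: res_zero_eq)
next
  case (Suc j)
  interpret residues m "residue_ring m" by unfold_locales (use assms in simp_all)
  show ?case using Suc assms(2)
    by (simp add: res_add_eq mod_add_left_eq mod_add_right_eq algebra_simps)
qed

lemma ring_hom_add_pow:
  assumes "ring R" "ring S" "h \<in> ring_hom R S" "a \<in> carrier R"
  shows "h ([(j :: nat)] \<cdot>\<^bsub>R\<^esub> a) = [j] \<cdot>\<^bsub>S\<^esub> h a"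
proof (induction j)
  interpret R: ring R by fact
  interpret S: ring S by fact
  case 0
  show ?case using ring_hom_zero[OF assms(3,1,2)] by simp
next
  interpret R: ring R by fact
  interpret S: ring S by fact
  case (Suc j)
  then show ?case using ring_hom_add[OF assms(3), of "[j] \<cdot>\<^bsub>R\<^esub> a" a] assms(4) by simp
qed

lemma (in UP_cring) coeff_add_pow:
  assumes "g \<in> carrier P"
  shows "up_ring.coeff P ([(j :: nat)] \<cdot>\<^bsub>P\<^esub> g) i = [j] \<cdot>\<^bsub>R\<^esub> up_ring.coeff P g i"
  using assms by (induction j) (simp_all add: coeff_zero)

text \<open>Every element of the Galois ring is, modulo \<open>p\<close>, the class of a polynomial of degree
  less than \<open>r\<close> with coefficients in \<open>{0..<p}\<close>.\<close>

lemma galois_ring_card_le: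
  assumes p: "Factorial_Ring.prime p" and f: "basic_irreducible p 2 r f" and r: "r > 0"
    and fin: "finite (carrier (galois_ring p 2 f))"
  defines "R \<equiv> galois_ring p 2 f"
  shows "cring R" and "[p] \<cdot>\<^bsub>R\<^esub> ([p] \<cdot>\<^bsub>R\<^esub> \<one>\<^bsub>R\<^esub>) = \<zero>\<^bsub>R\<^esub>"
    and "card (carrier R) \<le> p ^ r * card (multiples R p (carrier R))"
proof -
  define Z where "Z = residue_ring (int (p ^ 2))"
  define Q where "Q = UP Z"
  have p1: "int (p ^ 2) > 1"
  proof -
    have "p ^ 2 > 1" using power_mono[OF prime_ge_2_nat[OF p], of 2] by simp
    then have "int 1 < int (p ^ 2)" by (simp only: of_nat_less_iff)
    then show ?thesis by (simp only: of_nat_1)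
  qed
  interpret Z: residues "int (p ^ 2)" Z by unfold_locales (use p1 in \<open>simp_all add: Z_def\<close>)
  interpret Q: UP_cring Z Q
    by (intro UP_cring.intro Z.cring) (simp add: Q_def)
  have fQ: "f \<in> carrier Q" and degf: "deg Z f = r" and lead: "coeff Q f r = \<one>\<^bsub>Z\<^esub>"
    using f unfolding basic_irreducible_def Let_def Z_def Q_def by auto
  define I where "I = PIdl\<^bsub>Q\<^esub> f"
  have R_eq: "R = Q Quot I" unfolding R_def galois_ring_def I_def Q_def Z_def Let_def ..
  have ideal: "ideal I Q" unfolding I_def using fQ by (rule Q.cgenideal_ideal)
  interpret I: ideal I Q by (rule ideal)
  show cring: "cring R" unfolding R_eq by (rule I.quotient_is_cring[OF Q.UP_cring])
  interpret R: cring R by (rule cring)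
  define \<phi> where "\<phi> g = I +>\<^bsub>Q\<^esub> g" for g
  have hom: "\<phi> \<in> ring_hom Q R" unfolding R_eq \<phi>_def by (rule I.rcos_ring_hom)
  have Qr: "ring Q" by (rule Q.UP_ring)
  have hom_pow: "\<phi> ([j] \<cdot>\<^bsub>Q\<^esub> g) = [j] \<cdot>\<^bsub>R\<^esub> \<phi> g" if "g \<in> carrier Q" for g and j :: nat
    by (rule ring_hom_add_pow[OF Qr R.ring_axioms hom that])
  have surj: "\<exists>g\<in>carrier Q. y = \<phi> g" if "y \<in> carrier R" for y
    using that unfolding R_eq FactRing_def A_RCOSETS_def' \<phi>_def by auto
  have \<phi>_closed: "\<phi> g \<in> carrier R" if "g \<in> carrier Q" for g using ring_hom_closed[OF hom that] .
  have coeff_pow: "coeff Q ([j] \<cdot>\<^bsub>Q\<^esub> g) i = (int j * coeff Q g i) mod int (p ^ 2)"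
    if "g \<in> carrier Q" for g i and j :: nat
    using Q.coeff_add_pow[OF that] add_pow_residue_ring[OF p1, folded Z_def] Q.coeff_closed[OF that] by simp
  show "[p] \<cdot>\<^bsub>R\<^esub> ([p] \<cdot>\<^bsub>R\<^esub> \<one>\<^bsub>R\<^esub>) = \<zero>\<^bsub>R\<^esub>"
  proof -
    have one: "\<one>\<^bsub>Q\<^esub> \<in> carrier Q" by simp
    have "[p] \<cdot>\<^bsub>Q\<^esub> ([p] \<cdot>\<^bsub>Q\<^esub> \<one>\<^bsub>Q\<^esub>) = \<zero>\<^bsub>Q\<^esub>"
    proof (rule Q.up_eqI)
      fix i
      have "coeff Q ([p] \<cdot>\<^bsub>Q\<^esub> ([p] \<cdot>\<^bsub>Q\<^esub> \<one>\<^bsub>Q\<^esub>)) i = (int p * ((int p * coeff Q \<one>\<^bsub>Q\<^esub> i) mod int (p ^ 2))) mod int (p ^ 2)"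
        by (simp only: coeff_pow one Q.P.add.nat_pow_closed)
      also have "\<dots> = 0"
        by (simp add: mod_mult_right_eq power2_eq_square flip: mult.assoc)
      finally show "coeff Q ([p] \<cdot>\<^bsub>Q\<^esub> ([p] \<cdot>\<^bsub>Q\<^esub> \<one>\<^bsub>Q\<^esub>)) i = coeff Q \<zero>\<^bsub>Q\<^esub> i"
        by (simp add: Z.res_zero_eq)
    qed simp_all
    then have "\<phi> ([p] \<cdot>\<^bsub>Q\<^esub> ([p] \<cdot>\<^bsub>Q\<^esub> \<one>\<^bsub>Q\<^esub>)) = \<zero>\<^bsub>R\<^esub>" using ring_hom_zero[OF hom Qr R.ring_axioms] by simp
    then show ?thesis using ring_hom_one[OF hom] by (simp add: hom_pow)
  qed
  define H where "H = {h \<in> carrier Q. (\<forall>i<r. h i \<in> {0..<int p}) \<and> (\<forall>i\<ge>r. h i = 0)}"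
  have coeff_eq: "coeff Q g = g" if "g \<in> carrier Q" for g
    using that unfolding Q_def UP_def by simp
  have cardH: "finite H \<and> card H \<le> p ^ r"
  proof -
    let ?E = "{..<r} \<rightarrow>\<^sub>E {0..<int p}"
    let ?ex = "\<lambda>e i. if i < r then e i else (0 :: int)"
    have fE: "finite ?E" by (intro finite_PiE) simp_all
    have sub: "H \<subseteq> ?ex ` ?E"
    proof
      fix h assume h: "h \<in> H"
      then have "h = ?ex (restrict h {..<r})" by (auto simp: H_def fun_eq_iff)
      moreover have "restrict h {..<r} \<in> ?E" using h by (auto simp: H_def)
      ultimately show "h \<in> ?ex ` ?E" by blast
    qed
    have "card H \<le> card (?ex ` ?E)" using sub fE by (intro card_mono) simp_all
    also have "\<dots> \<le> card ?E" using fE by (rule card_image_le)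
    also have "\<dots> = p ^ r" by (simp add: card_PiE)
    finally show ?thesis using finite_subset[OF sub] fE by simp
  qed
  have dec: "\<exists>h\<in>H. \<exists>y\<in>multiples R p (carrier R). z = \<phi> h \<oplus>\<^bsub>R\<^esub> y" if zR: "z \<in> carrier R" for z
  proof -
    obtain g where g: "g \<in> carrier Q" "z = \<phi> g" using surj[OF zR] by blast
    have f0: "f \<noteq> \<zero>\<^bsub>Q\<^esub>" 
    proof
      assume "f = \<zero>\<^bsub>Q\<^esub>"
      then have "deg Z f = 0" by (simp only: Q.deg_zero)
      then show False using degf r by simp
    qed
    obtain q s and k :: nat where q: "q \<in> carrier Q" and s: "s \<in> carrier Q"
      and div: "(coeff Q f (deg Z f)) [^]\<^bsub>Z\<^esub> k \<odot>\<^bsub>Q\<^esub> g = f \<otimes>\<^bsub>Q\<^esub> q \<oplus>\<^bsub>Q\<^esub> s"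
      and deg: "s = \<zero>\<^bsub>Q\<^esub> \<or> deg Z s < deg Z f"
      using Q.long_div_theorem[OF fQ g(1) f0] by blast
    \<comment> \<open>The power of the leading coefficient introduced by the division disappears, as
      \<open>f\<close> is monic.\<close>
    have g_eq: "g = f \<otimes>\<^bsub>Q\<^esub> q \<oplus>\<^bsub>Q\<^esub> s"
      using div g(1) unfolding degf lead by simp
    have "f \<otimes>\<^bsub>Q\<^esub> q \<in> I"
      using I.I_r_closed[OF Q.P.cgenideal_self[OF fQ, folded I_def] q] .
    then have "\<phi> (f \<otimes>\<^bsub>Q\<^esub> q) = \<zero>\<^bsub>R\<^esub>"
      unfolding R_eq FactRing_def \<phi>_def using I.a_rcos_const by simp
    then have zs: "z = \<phi> s"
      unfolding g(2) g_eq using ring_hom_add[OF hom, of "f \<otimes>\<^bsub>Q\<^esub> q" s] fQ q s \<phi>_closed by simp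
    have s_range: "s i \<in> {0..<int (p ^ 2)}" for i
      using Q.coeff_closed[OF s, of i] by (simp add: coeff_eq[OF s] Z.res_carrier_eq)
    have s_zero: "s i = 0" if "i \<ge> r" for i
    proof -
      have "coeff Q s i = \<zero>\<^bsub>Z\<^esub>"
      proof (cases "s = \<zero>\<^bsub>Q\<^esub>")
        case False
        then have "deg Z s < i" using deg that degf by auto
        then show ?thesis using s by (rule Q.deg_aboveD)
      qed simp
      then show ?thesis by (simp add: coeff_eq[OF s] Z.res_zero_eq)
    qed
    have inQ: "t \<in> carrier Q" if "\<And>i. t i \<in> {0..<int (p ^ 2)}" "\<And>i. i \<ge> r \<Longrightarrow> t i = 0" for t :: "nat \<Rightarrow> int"
    proof -
      have "bound \<zero>\<^bsub>Z\<^esub> r t" using that(2) by (intro bound.intro) (simp add: Z.res_zero_eq)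
      moreover have "t i \<in> carrier Z" for i using that(1)[of i] by (simp add: Z.res_carrier_eq)
      ultimately have "t \<in> up Z" by (intro mem_upI exI)
      then show ?thesis unfolding Q_def UP_def by simp
    qed
    \<comment> \<open>Base-\<open>p\<close> digits of the coefficients of the remainder:
      \<open>h\<close> carries the low digits and \<open>t\<close> the high ones, whose contribution
      is a multiple of \<open>p\<close>.\<close>
    define h where "h i = s i mod int p" for i
    define t where "t i = s i div int p" for i
    have pp: "int p > 0" "int p \<le> int (p ^ 2)" using prime_gt_0_nat[OF p] by (simp_all add: power2_eq_square)
    have hr: "h i \<in> {0..<int p}" for i using pp by (simp add: h_def)
    have tr: "t i \<in> {0..<int (p ^ 2)}" for i
    proof -
      have "s i div int p \<le> s i" using s_range[of i] pp(1) zdiv_mono2[of "s i" 1 "int p"] by simp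
      then show ?thesis using s_range[of i] pp by (auto simp: t_def pos_imp_zdiv_nonneg_iff)
    qed
    have hQ: "h \<in> carrier Q"
    proof (rule inQ)
      show "h i \<in> {0..<int (p ^ 2)}" for i using hr[of i] pp(2) unfolding atLeastLessThan_iff by linarith
      show "h i = 0" if "i \<ge> r" for i using s_zero[OF that] by (simp add: h_def)
    qed
    have tQ: "t \<in> carrier Q" by (rule inQ[OF tr]) (simp add: t_def s_zero)
    have s_eq: "s = h \<oplus>\<^bsub>Q\<^esub> [p] \<cdot>\<^bsub>Q\<^esub> t"
    proof (rule Q.up_eqI[OF _ s])
      fix i
      have "coeff Q (h \<oplus>\<^bsub>Q\<^esub> [p] \<cdot>\<^bsub>Q\<^esub> t) i = (h i + (int p * t i) mod int (p ^ 2)) mod int (p ^ 2)"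
        unfolding Q.coeff_add[OF hQ Q.P.add.nat_pow_closed[OF tQ]] coeff_pow[OF tQ]
          coeff_eq[OF hQ] coeff_eq[OF tQ] Z.res_add_eq ..
      also have "\<dots> = (h i + int p * t i) mod int (p ^ 2)" by (simp add: mod_add_right_eq)
      also have "h i + int p * t i = s i" by (simp add: h_def t_def)
      also have "s i mod int (p ^ 2) = s i" using s_range[of i] by simp
      finally show "coeff Q s i = coeff Q (h \<oplus>\<^bsub>Q\<^esub> [p] \<cdot>\<^bsub>Q\<^esub> t) i" by (simp add: coeff_eq[OF s])
    qed (use hQ tQ in simp)
    have "z = \<phi> h \<oplus>\<^bsub>R\<^esub> [p] \<cdot>\<^bsub>R\<^esub> \<phi> t"
      unfolding zs s_eq using ring_hom_add[OF hom hQ, of "[p] \<cdot>\<^bsub>Q\<^esub> t"] tQ by (simp add: hom_pow)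
    moreover have "h \<in> H" using hQ hr s_zero by (simp add: H_def h_def)
    moreover have "[p] \<cdot>\<^bsub>R\<^esub> \<phi> t \<in> multiples R p (carrier R)"
      unfolding multiples_def using \<phi>_closed[OF tQ] by blast
    ultimately show ?thesis by blast
  qed
  show "card (carrier R) \<le> p ^ r * card (multiples R p (carrier R))"
  proof -
    let ?M = "multiples R p (carrier R)"
    have "?M \<subseteq> carrier R" unfolding multiples_def by auto
    then have finM: "finite ?M" using fin finite_subset unfolding R_def by blast
    have "carrier R \<subseteq> (\<lambda>(h, y). \<phi> h \<oplus>\<^bsub>R\<^esub> y) ` (H \<times> ?M)" using dec by fastforce
    then have "card (carrier R) \<le> card ((\<lambda>(h, y). \<phi> h \<oplus>\<^bsub>R\<^esub> y) ` (H \<times> ?M))"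
      using cardH finM by (intro card_mono) simp_all
    also have "\<dots> \<le> card (H \<times> ?M)" using cardH finM by (intro card_image_le) simp
    also have "\<dots> \<le> p ^ r * card ?M" using cardH by (simp add: card_cartesian_product)
    finally show ?thesis .
  qed
qed

text \<open>The multiples of \<open>p\<close> are annihilated by \<open>p\<close>. If
  \<open>s\<close> picks a preimage under multiplication by \<open>\<pi>\<close>, then
  \<open>y\<close> is recovered from \<open>s y \<oplus> z\<close> by that multiplication, and
  \<open>z\<close> afterwards.\<close>

lemma (in cring) card_multiples_square_le:
  assumes fin: "finite (carrier R)" and p2: "[p] \<cdot> ([p] \<cdot> \<one>) = \<zero>"
  shows "(card (multiples R p (carrier R)))\<^sup>2 \<le> card (carrier R)"
proof -
  let ?M = "multiples R p (carrier R)"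
  define \<pi> where "\<pi> = [p] \<cdot> \<one>"
  have \<pi>c: "\<pi> \<in> carrier R" by (simp add: \<pi>_def)
  have pow: "[p] \<cdot> a = \<pi> \<otimes> a" if "a \<in> carrier R" for a
    using that by (simp add: \<pi>_def add_pow_ldistr)
  have pp: "\<pi> \<otimes> (\<pi> \<otimes> a) = \<zero>" if "a \<in> carrier R" for a
  proof -
    have "\<pi> \<otimes> \<pi> = \<zero>" using p2 pow[OF \<pi>c] by (simp add: \<pi>_def)
    then show ?thesis using that \<pi>c by (simp flip: m_assoc)
  qed
  have "\<exists>a. a \<in> carrier R \<and> y = \<pi> \<otimes> a" if "y \<in> ?M" for y
    using that pow unfolding multiples_def by auto
  then obtain s where s: "\<And>y. y \<in> ?M \<Longrightarrow> s y \<in> carrier R" "\<And>y. y \<in> ?M \<Longrightarrow> y = \<pi> \<otimes> s y"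
    by metis
  have Mc: "?M \<subseteq> carrier R" unfolding multiples_def by auto
  have M0: "\<pi> \<otimes> y = \<zero>" if "y \<in> ?M" for y using s[OF that] pp by metis
  have "inj_on (\<lambda>(y, z). s y \<oplus> z) (?M \<times> ?M)"
  proof (rule inj_onI, clarify)
    fix y z y' z' assume *: "y \<in> ?M" "z \<in> ?M" "y' \<in> ?M" "z' \<in> ?M" "s y \<oplus> z = s y' \<oplus> z'"
    have "\<pi> \<otimes> (s a \<oplus> b) = a" if "a \<in> ?M" "b \<in> ?M" for a b
      using that s[OF that(1)] M0[OF that(2)] Mc \<pi>c by (simp add: r_distr subsetD)
    then have "y = y'" using * by metis
    then show "y = y' \<and> z = z'" using * s Mc by (auto simp: subsetD)
  qed
  moreover have "(\<lambda>(y, z). s y \<oplus> z) ` (?M \<times> ?M) \<subseteq> carrier R" using s Mc by auto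
  ultimately have "card (?M \<times> ?M) \<le> card (carrier R)" using fin by (intro card_inj_on_le)
  then show ?thesis by (simp add: card_cartesian_product power2_eq_square)
qed

section \<open>The two designs\<close>

theorem theorem4p2:
  fixes p n :: nat
    and F :: "('a, 'b) ring_scheme" and \<alpha> :: 'a
    and f :: "nat \<Rightarrow> int" and R :: "(nat \<Rightarrow> int) set ring"
    and \<xi> :: "(nat \<Rightarrow> int) set"
    and S :: "(nat \<Rightarrow> int) set set" and x :: "nat \<Rightarrow> (nat \<Rightarrow> int) set"
  assumes "Factorial_Ring.prime p" and "n \<ge> 1"
    and "field F" and "finite (carrier F)" and "order F = p ^ (4 * n)"
    and "\<alpha> \<in> Units F" and "generate (units_of F) {\<alpha>} = Units F"
    and "basic_irreducible p 2 (2 * n) f" and "R = galois_ring p 2 f"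
    and "\<xi> \<in> Units R"
    and "eval (residue_ring (int (p ^ 2))) R (galois_const p 2 f) \<xi> f = \<zero>\<^bsub>R\<^esub>"
    and "group.ord (units_of R) \<xi> = p ^ (2 * n) - 1"
    and "S \<subseteq> teichmueller R \<xi> (p ^ (2 * n) - 1)" and "bij_betw x {..<p ^ n} S"
    and "representative_system R (multiples R p (carrier R))
           (multiples R p (galois_subring R p n \<xi>)) (multiples R p S)"
  shows "\<not> isomorphic_designs
           (carrier F, dev F (p ^ n + 1) (cyclotomic_class F (p ^ n + 1) \<alpha>))
           (carrier R, dev R (p ^ n + 1) (momihara_block R p n \<xi> x))"
proof
  assume iso: "isomorphic_designs
           (carrier F, dev F (p ^ n + 1) (cyclotomic_class F (p ^ n + 1) \<alpha>))
           (carrier R, dev R (p ^ n + 1) (momihara_block R p n \<xi> x))"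
  define N where "N = p ^ n"
  let ?b = "momihara_block R p n \<xi> x"
  obtain \<phi> where bij: "bij_betw \<phi> (carrier F) (carrier R)"
    and fw: "\<And>B. B \<in># dev F (N + 1) (cyclotomic_class F (N + 1) \<alpha>) \<Longrightarrow> \<phi> ` B \<in># dev R (N + 1) ?b"
    and bw: "\<And>E. E \<in># dev R (N + 1) ?b \<Longrightarrow>
      \<exists>B. B \<in># dev F (N + 1) (cyclotomic_class F (N + 1) \<alpha>) \<and> E = \<phi> ` B"
    using isomorphic_designsE[OF iso[folded N_def]] by metis
  have cardF: "card (carrier F) = N ^ 4"
    using assms(5) by (simp add: order_def N_def mult.commute flip: power_mult)
  \<comment> \<open>The lower bound on the order of the Galois ring comes for free from \<open>\<phi>\<close>.\<close>
  have finR: "finite (carrier R)" using bij_betw_finite[OF bij] assms(4) by simp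
  have cardR: "card (carrier R) = N ^ 4" using bij_betw_same_card[OF bij] cardF by simp
  have fin': "finite (carrier (galois_ring p 2 f))" using finR assms(9) by simp
  have n2: "2 * n > 0" using assms(2) by simp
  note gal = galois_ring_card_le[OF assms(1,8) n2 fin', folded assms(9)]
  interpret cring R by (rule gal(1))
  have N2: "p ^ (2 * n) = N\<^sup>2" by (simp add: N_def mult.commute flip: power_mult)
  have Npos: "N > 0" using prime_gt_0_nat[OF assms(1)] by (simp add: N_def)
  \<comment> \<open>The cardinality is squeezed: its square is at most \<open>N ^ 4\<close>, and
    \<open>N ^ 4\<close> is at most \<open>N^2\<close> times it.\<close>
  have cardM: "card (multiples R p (carrier R)) = N\<^sup>2"
  proof (rule antisym)
    have "(card (multiples R p (carrier R)))\<^sup>2 \<le> (N\<^sup>2)\<^sup>2"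
      using card_multiples_square_le[OF finR gal(2)] cardR by simp
    then show "card (multiples R p (carrier R)) \<le> N\<^sup>2" by (rule power2_le_imp_le) simp
    have "N\<^sup>2 * N\<^sup>2 \<le> N\<^sup>2 * card (multiples R p (carrier R))"
      using gal(3) cardR N2 by (simp add: power4_eq_xxxx power2_eq_square mult.assoc)
    then show "N\<^sup>2 \<le> card (multiples R p (carrier R))"
      by (rule mult_left_le_imp_le) (use Npos in simp)
  qed
  interpret F: semiprimitive_field F p n N \<alpha>
    using assms(1-4,6,7) cardF
    by (intro semiprimitive_field.intro semiprimitive_field_axioms.intro) (simp_all add: N_def)
  interpret M: momihara_ring R p n N \<xi>
    using assms(1,2,10,12) finR cardR cardM gal(2) N2
    by unfold_locales (simp_all add: N_def)
  have xc: "x j \<in> carrier R" if "j < N" for j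
  proof -
    have "x j \<in> S" using assms(14) that by (auto simp: bij_betw_def N_def)
    then have "x j \<in> teichmueller R \<xi> (p ^ (2 * n) - 1)" using assms(13) by blast
    then show ?thesis unfolding teichmueller_def by auto
  qed
  interpret M: momihara_family R p n N \<xi> x
    by unfold_locales (rule xc)
  have memF: "B \<in># dev F (N + 1) (cyclotomic_class F (N + 1) \<alpha>)
      \<longleftrightarrow> (\<exists>i<N + 1. \<exists>g\<in>carrier F. B = F.C i +>\<^bsub>F\<^esub> g)" for B
    unfolding F.C_def by (rule mem_dev_iff[OF assms(4)])
  have memR: "E \<in># dev R (N + 1) ?b \<longleftrightarrow> (\<exists>i<N + 1. \<exists>g\<in>carrier R. E = ?b i +>\<^bsub>R\<^esub> g)" for E
    by (rule mem_dev_iff[OF finR])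
  have BF: "B \<subseteq> carrier F" if "B \<in># dev F (N + 1) (cyclotomic_class F (N + 1) \<alpha>)" for B
    using that F.C_closed F.a_r_coset_subset_G unfolding memF by blast
  have inj: "inj_on \<phi> (carrier F)" using bij by (rule bij_betw_imp_inj_on)
  have v0: "M.v 0 \<in> carrier R" using Npos by simp
  show False
  proof (cases "N = 2")
    case False
    then have N3: "N \<ge> 3" using F.N_ge_2 by simp
    have E1: "M.D0 +>\<^bsub>R\<^esub> \<zero>\<^bsub>R\<^esub> \<in># dev R (N + 1) ?b"
      unfolding memR by (intro exI[of _ 0] conjI bexI[of _ "\<zero>\<^bsub>R\<^esub>"]) (simp_all add: M.momihara_block_0)
    have E2: "M.D0 +>\<^bsub>R\<^esub> M.v 0 \<in># dev R (N + 1) ?b"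
      unfolding memR using v0 by (intro exI[of _ 0] conjI bexI[of _ "M.v 0"]) (simp_all add: M.momihara_block_0)
    \<comment> \<open>Two ring blocks with the special intersection number are pulled back to field
      blocks, where that number cannot occur.\<close>
    obtain B1 B2 where B: "B1 \<in># dev F (N + 1) (cyclotomic_class F (N + 1) \<alpha>)" "M.D0 +>\<^bsub>R\<^esub> \<zero>\<^bsub>R\<^esub> = \<phi> ` B1"
      "B2 \<in># dev F (N + 1) (cyclotomic_class F (N + 1) \<alpha>)" "M.D0 +>\<^bsub>R\<^esub> M.v 0 = \<phi> ` B2"
      using bw[OF E1] bw[OF E2] by metis
    have "card (B1 \<inter> B2) = card (\<phi> ` (B1 \<inter> B2))"
      using card_image[OF inj_on_subset[OF inj]] BF[OF B(1)] by (metis inf.coboundedI1)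
    also have "\<phi> ` (B1 \<inter> B2) = \<phi> ` B1 \<inter> \<phi> ` B2"
      by (rule inj_on_image_Int[OF inj BF[OF B(1)] BF[OF B(3)]])
    also have "card (\<phi> ` B1 \<inter> \<phi> ` B2) = (N - 1) * (N - 2) + (N\<^sup>2 - 2 * N)"
      unfolding B(2,4)[symmetric]
      using card_coset_Int[OF M.D0_closed M.D0_closed zero_closed v0] M.diff_count_D0 v0
      by (simp add: a_minus_def)
    finally have card: "card (B1 \<inter> B2) = (N - 1) * (N - 2) + (N\<^sup>2 - 2 * N)" .
    obtain i g where 1: "i < N + 1" "g \<in> carrier F" "B1 = F.C i +>\<^bsub>F\<^esub> g" using B(1) unfolding memF by blast
    obtain j h where 2: "j < N + 1" "h \<in> carrier F" "B2 = F.C j +>\<^bsub>F\<^esub> h" using B(3) unfolding memF by blast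
    show False using F.intersection_number_neq[OF N3 1(1) 2(1) 1(2) 2(2)] card unfolding 1(3) 2(3) by blast
  next
    case True
    have "S = x ` {..<N}" using assms(14) by (simp add: bij_betw_def N_def)
    then obtain y1 y2 y3 where y: "y1 \<in> carrier R" "y2 \<in> carrier R" "y3 \<in> carrier R"
        "distinct [\<zero>\<^bsub>R\<^esub>, y1, y2, y3]"
      and nc1: "\<And>i h. i < N + 1 \<Longrightarrow> h \<in> carrier R \<Longrightarrow> \<not> {\<zero>\<^bsub>R\<^esub>, y1, y2} \<subseteq> ?b i +>\<^bsub>R\<^esub> h"
      and nc2: "\<And>i h. i < N + 1 \<Longrightarrow> h \<in> carrier R \<Longrightarrow> \<not> {\<zero>\<^bsub>R\<^esub>, y1, y3} \<subseteq> ?b i +>\<^bsub>R\<^esub> h"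
      and cov: "\<exists>h\<in>carrier R. {\<zero>\<^bsub>R\<^esub>, y2, y3} \<subseteq> ?b 0 +>\<^bsub>R\<^esub> h"
      using M.triples_not_transitive[OF True] assms(15) by metis
    have notR: "\<not> T \<subseteq> E"
      if E: "E \<in># dev R (N + 1) ?b"
        and nT: "\<And>i h. i < N + 1 \<Longrightarrow> h \<in> carrier R \<Longrightarrow> \<not> T \<subseteq> ?b i +>\<^bsub>R\<^esub> h" for E T
    proof -
      obtain i h where "i < N + 1" "h \<in> carrier R" "E = ?b i +>\<^bsub>R\<^esub> h" using E unfolding memR by blast
      then show ?thesis using nT by simp
    qed
    \<comment> \<open>The four points are pulled back. A covered triple on the field side would stay
      covered under \<phi>, so the first two triples are uncovered; the block through the third one
      comes from a field block. With \<open>a0\<close> and \<open>a1\<close> as the common points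
      this contradicts \<open>F.not_covered_trans\<close>.\<close>
    have preimage: "\<exists>a. a \<in> carrier F \<and> \<phi> a = y" if "y \<in> carrier R" for y
      using that unfolding bij_betw_imp_surj_on[OF bij, symmetric] by blast
    obtain a0 where a0: "a0 \<in> carrier F" "\<phi> a0 = \<zero>\<^bsub>R\<^esub>" using preimage[OF zero_closed] by blast
    obtain a1 where a1: "a1 \<in> carrier F" "\<phi> a1 = y1" using preimage[OF y(1)] by blast
    obtain a2 where a2: "a2 \<in> carrier F" "\<phi> a2 = y2" using preimage[OF y(2)] by blast
    obtain a3 where a3: "a3 \<in> carrier F" "\<phi> a3 = y3" using preimage[OF y(3)] by blast
    have coverE: "\<exists>B. B \<in># dev F (N + 1) (cyclotomic_class F (N + 1) \<alpha>) \<and> {a, b, c} \<subseteq> B" if "F.covered a b c" for a b c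
      using that unfolding F.covered_def memF by blast
    have "\<not> F.covered a0 a1 a2"
    proof
      assume "F.covered a0 a1 a2"
      then obtain B where "B \<in># dev F (N + 1) (cyclotomic_class F (N + 1) \<alpha>)" "{a0, a1, a2} \<subseteq> B"
        using coverE by blast
      then have "{\<phi> a0, \<phi> a1, \<phi> a2} \<subseteq> \<phi> ` B" "\<phi> ` B \<in># dev R (N + 1) ?b" using fw by auto
      then show False using notR[OF _ nc1] unfolding a0(2) a1(2) a2(2) by blast
    qed
    moreover have "\<not> F.covered a0 a1 a3"
    proof
      assume "F.covered a0 a1 a3"
      then obtain B where "B \<in># dev F (N + 1) (cyclotomic_class F (N + 1) \<alpha>)" "{a0, a1, a3} \<subseteq> B"
        using coverE by blast
      then have "{\<phi> a0, \<phi> a1, \<phi> a3} \<subseteq> \<phi> ` B" "\<phi> ` B \<in># dev R (N + 1) ?b" using fw by auto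
      then show False using notR[OF _ nc2] unfolding a0(2) a1(2) a3(2) by blast
    qed
    moreover have "F.covered a0 a2 a3"
    proof -
      obtain h where h: "h \<in> carrier R" "{\<zero>\<^bsub>R\<^esub>, y2, y3} \<subseteq> ?b 0 +>\<^bsub>R\<^esub> h" using cov by blast
      have Eh: "?b 0 +>\<^bsub>R\<^esub> h \<in># dev R (N + 1) ?b" unfolding memR using h(1) by auto
      obtain B where B: "B \<in># dev F (N + 1) (cyclotomic_class F (N + 1) \<alpha>)" "?b 0 +>\<^bsub>R\<^esub> h = \<phi> ` B"
        using bw[OF Eh] by blast
      have "a \<in> B" if "a \<in> carrier F" "\<phi> a \<in> \<phi> ` B" for a
        using that inj_on_image_mem_iff[OF inj that(1) BF[OF B(1)]] by blast
      then have "{a0, a2, a3} \<subseteq> B" using h(2) a0 a2 a3 unfolding B(2) by simp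
      then show ?thesis using B(1) unfolding F.covered_def memF by blast
    qed
    moreover have "a0 \<noteq> a1" "a0 \<noteq> a2" "a0 \<noteq> a3" "a2 \<noteq> a3"
      using y(4) a0(2) a1(2) a2(2) a3(2) by auto
    ultimately show False using F.not_covered_trans[OF True a0(1) a1(1) a2(1) a3(1)] by blast
  qed
qed

end
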